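(* Let $w\in\mathrm{Gr}_{\mathcal H_+}(\mathcal H)$ and $\mathbf n'\in\mathbf B$. For integers $p\ge 0$ put $\boldsymbol\gamma_p:=\boldsymbol\alpha_p-\boldsymbol\alpha_{-p-1}$ ($=\boldsymbol\beta_{p+1}$), and abbreviate $H:=H^{\mathbf n'}_w$, $H_{\mathbf v}:=H^{\mathbf n'+\mathbf v}_w$, $H^{(p|q)}:=H^{\mathbf n',(p|q)}_w$, $H^{(p|q)}_{\mathbf v}:=H^{\mathbf n'+\mathbf v,(p|q)}_w$ for $\mathbf v\in\mathbf B$. Then for every triple of integers $0\le i<j<k$, writing $P:=H_{\boldsymbol\gamma_i}H_{\boldsymbol\gamma_j}H_{\boldsymbol\gamma_k}$, $X:=H^{(i|j)}H^{(j|k)}H^{(k|i)}$, $X^T:=H^{(j|i)}H^{(k|j)}H^{(i|k)}$, the following hold in $(S^\times_{\mathbf x})^{-1}\mathbb C[[\mathbf x,\mathbf t]]$: (1) $H H^{(j|k)}H^{(k|j)}_{\boldsymbol\gamma_i}=-HH_{\boldsymbol\gamma_i}H_{\boldsymbol\gamma_j+\boldsymbol\gamma_k}+P-X$; (2) $H H^{(k|i)}H^{(i|k)}_{\boldsymbol\gamma_j}=HH_{\boldsymbol\gamma_j}H_{\boldsymbol\gamma_i+\boldsymbol\gamma_k}-P+X$; (3) $H H^{(i|j)}H^{(j|i)}_{\boldsymbol\gamma_k}=-HH_{\boldsymbol\gamma_k}H_{\boldsymbol\gamma_i+\boldsymbol\gamma_j}+P-X$; (4) $H H^{(k|j)}H^{(j|k)}_{\boldsymbol\gamma_i}=-HH_{\boldsymbol\gamma_i}H_{\boldsymbol\gamma_j+\boldsymbol\gamma_k}+P-X^T$;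 (5) $H H^{(i|k)}H^{(k|i)}_{\boldsymbol\gamma_j}=HH_{\boldsymbol\gamma_j}H_{\boldsymbol\gamma_i+\boldsymbol\gamma_k}-P+X^T$; (6) $H H^{(j|i)}H^{(i|j)}_{\boldsymbol\gamma_k}=-HH_{\boldsymbol\gamma_k}H_{\boldsymbol\gamma_i+\boldsymbol\gamma_j}+P-X^T$; (7) $H^2X H_{\boldsymbol\gamma_i+\boldsymbol\gamma_j+\boldsymbol\gamma_k}=X^2-X\big(2P-H(H_{\boldsymbol\gamma_i}H_{\boldsymbol\gamma_j+\boldsymbol\gamma_k}+H_{\boldsymbol\gamma_j}H_{\boldsymbol\gamma_i+\boldsymbol\gamma_k}+H_{\boldsymbol\gamma_k}H_{\boldsymbol\gamma_i+\boldsymbol\gamma_j})\big)+(H_{\boldsymbol\gamma_i}H_{\boldsymbol\gamma_j}-HH_{\boldsymbol\gamma_i+\boldsymbol\gamma_j})(H_{\boldsymbol\gamma_i}H_{\boldsymbol\gamma_k}-HH_{\boldsymbol\gamma_i+\boldsymbol\gamma_k})(H_{\boldsymbol\gamma_j}H_{\boldsymbol\gamma_k}-HH_{\boldsymbol\gamma_j+\boldsymbol\gamma_k})$.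
   Context: Partitions and Frobenius notation: a partition $\lambda$ of Frobenius rank $r$ is written $\lambda=(a_1,\dots,a_r\mid b_1,\dots,b_r)$ with $a_1>\dots>a_r\ge 0$, $b_1>\dots>b_r\ge 0$, $a_i=\lambda_i-i$, $b_i=\lambda'_i-i$; $(p|q)$ is a hook. Points and $\tau$-functions: a point $w\in\mathrm{Gr}_{\mathcal H_+}(\mathcal H)$ is a family $(\pi_\lambda(w))_\lambda$ of complex numbers indexed by all partitions, not all zero, satisfying all Plücker relations (for all $0<k<N$, all $(k-1)$-tuples $I$ and $(k+1)$-tuples $J$ in $\{-k,\dots,N-k-1\}$: $\sum_{j=1}^{k+1}(-1)^j\tilde\pi_{I_1..I_{k-1}J_j}(w)\tilde\pi_{J_1..\widehat{J_j}..J_{k+1}}(w)=0$, where $\tilde\pi_L(w)=\mathrm{sgn}(L)\pi_{\lambda(L)}(w)$, $\mathrm{sgn}(L)$ the sign of the sorting permutation (0 if repeated entries) and $\lambda(L)_i=L'_{k-i+1}+i$ for the sorted $L'_1<\dots<L'_k$). Its KP $\tau$-function is $\tau_w(\mathbf t)=\sum_\lambda\pi_\lambda(w)s_\lambda(\mathbf t)\in\mathbb C[[\mathbf t]]$, with $s_\lambda$ the Schur function written in $t_i=p_i/i$. $\mathbb C[[\mathbf x,\mathbf t]]$ is the ring of formal power series in $x_i$ ($i\in\mathbb Z$), $t_j$ ($j\ge1$), and $(S^\times_{\mathbf x})^{-1}\mathbb C[[\mathbf x,\mathbf t]]$ its localization at the $x_i-x_j$, $i\ne j$; $f(\mathbf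 t+\sum_in_i[x_i])$ denotes the substitution $t_j\mapsto t_j+\sum_in_ix_i^j/j$. $\mathbf A$ is the group of finitely supported integer sequences $(n_i)_{i\in\mathbb Z}$, $\boldsymbol\alpha_i$ the unit vectors. $H^{\mathbf n}_w:=\prod_{i<j}(x_i-x_j)^{n_in_j}\tau_w(\mathbf t+\sum_in_i[x_i])$ and $H^{\mathbf n,\lambda}_w:=H_w^{\mathbf n+\sum_{i=1}^r\boldsymbol\alpha_{a_i}-\sum_{i=1}^r\boldsymbol\alpha_{-b_i-1}}$. $\mathbf B\subset\mathbf A$ is the sublattice of $\mathbf n$ with $n_{i-1}=-n_{-i}$ for all $i\ge1$, generated by $\boldsymbol\beta_i:=\boldsymbol\alpha_{i-1}-\boldsymbol\alpha_{-i}$, $i\ge1$. *)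

theory Defs
  imports Complex_Main "HOL-Library.Poly_Mapping" "HOL-Library.Function_Algebras"
    "HOL-Combinatorics.Permutations"
begin

text \<open>Variables: X i is x_i (i an integer), T j is t_j (only j >= 1 is ever used).\<close>
datatype var = X int | T nat

type_synonym mono = "var \<Rightarrow>\<^sub>0 nat"
type_synonym poly = "mono \<Rightarrow>\<^sub>0 complex"
type_synonym ser  = "mono \<Rightarrow> complex"

definition pvar :: "var \<Rightarrow> poly" where
  "pvar v = Poly_Mapping.single (Poly_Mapping.single v 1) 1"

definition pconst :: "complex \<Rightarrow> poly" where
  "pconst c = Poly_Mapping.single 0 c"

definition pmonom :: "mono \<Rightarrow> poly" where
  "pmonom m = Poly_Mapping.single m 1"

fun weight :: "var \<Rightarrow> nat" where
  "weight (X i) = 1"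
| "weight (T j) = j"

definition wdeg :: "mono \<Rightarrow> nat" where
  "wdeg m = (\<Sum>v\<in>Poly_Mapping.keys m. Poly_Mapping.lookup m v * weight v)"

definition Tvars :: "var set" where
  "Tvars = {T j | j. j \<ge> 1}"

definition ser_of :: "poly \<Rightarrow> ser" where
  "ser_of p = Poly_Mapping.lookup p"

definition ser_add :: "ser \<Rightarrow> ser \<Rightarrow> ser" where
  "ser_add f g = (\<lambda>m. f m + g m)"

definition ser_neg :: "ser \<Rightarrow> ser" where
  "ser_neg f = (\<lambda>m. - f m)"

definition ser_mult :: "ser \<Rightarrow> ser \<Rightarrow> ser" where
  "ser_mult f g = (\<lambda>m. \<Sum>(a, b) \<in> {(a, b). a + b = m}. f a * g b)"

definition psubst :: "(var \<Rightarrow> poly) \<Rightarrow> poly \<Rightarrow> poly" where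
  "psubst \<sigma> p = (\<Sum>m\<in>Poly_Mapping.keys p. pconst (Poly_Mapping.lookup p m) * (\<Prod>v\<in>Poly_Mapping.keys m. \<sigma> v ^ Poly_Mapping.lookup m v))"

definition shift :: "(int \<Rightarrow> int) \<Rightarrow> var \<Rightarrow> poly" where
  "shift n v = (case v of X i \<Rightarrow> pvar (X i)
     | T j \<Rightarrow> pvar (T j) + (\<Sum>i\<in>{i. n i \<noteq> 0}. pconst (of_int (n i) / of_nat j) * pvar (X i) ^ j))"

text \<open>f(t + sum_i n_i [x_i]) for f in C[[t]]: substitution into a power series in the t's.
  Since the substituted images are weighted homogeneous of the same degree as t_j,
  only the (finitely many) t-monomials of the same weighted degree contribute.\<close>
definition ser_shift :: "(int \<Rightarrow> int) \<Rightarrow> ser \<Rightarrow> ser" where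
  "ser_shift n f = (\<lambda>M. \<Sum>m | Poly_Mapping.keys m \<subseteq> Tvars \<and> wdeg m = wdeg M.
       f m * Poly_Mapping.lookup (psubst (shift n) (pmonom m)) M)"

definition partitions :: "nat list set" where
  "partitions = {l. sorted_wrt (\<ge>) l \<and> 0 \<notin> set l}"

text \<open>Complete homogeneous h_n in t_i = p_i/i: sum over m with sum j m_j = n of prod t_j^m_j/m_j!
  (generating function exp(sum t_j z^j)).\<close>
definition hpoly :: "int \<Rightarrow> poly" where
  "hpoly n = (if n < 0 then 0 else
     (\<Sum>m | Poly_Mapping.keys m \<subseteq> Tvars \<and> int (wdeg m) = n.
        Poly_Mapping.single m (\<Prod>v\<in>Poly_Mapping.keys m. 1 / of_nat (fact (Poly_Mapping.lookup m v)))))"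

definition det :: "nat \<Rightarrow> (nat \<Rightarrow> nat \<Rightarrow> poly) \<Rightarrow> poly" where
  "det l M = (\<Sum>\<sigma> | \<sigma> permutes {0..<l}. of_int (sign \<sigma>) * (\<Prod>i<l. M i (\<sigma> i)))"

text \<open>Schur function via Jacobi--Trudi: s_lambda = det (h_{lambda_i - i + j}).\<close>
definition schur :: "nat list \<Rightarrow> poly" where
  "schur lam = det (length lam) (\<lambda>i j. hpoly (int (lam ! i) - int i + int j))"

definition sgnL :: "int list \<Rightarrow> int" where
  "sgnL L = (if distinct L then (-1) ^ card {(a, b). a < b \<and> b < length L \<and> L ! a > L ! b} else 0)"

definition lamL :: "int list \<Rightarrow> nat list" where
  "lamL L = (let k = length L; L' = sort L in
     filter (\<lambda>x. x > 0) (map (\<lambda>i. nat (L' ! (k - i) + int i)) [1..<k+1]))"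

definition pit :: "(nat list \<Rightarrow> complex) \<Rightarrow> int list \<Rightarrow> complex" where
  "pit \<pi> L = of_int (sgnL L) * \<pi> (lamL L)"

definition plucker :: "(nat list \<Rightarrow> complex) \<Rightarrow> bool" where
  "plucker \<pi> \<longleftrightarrow> (\<forall>N k I J. 0 < k \<and> k < N \<and> length I = k - 1 \<and> length J = k + 1
      \<and> set I \<subseteq> {- int k .. int N - int k - 1} \<and> set J \<subseteq> {- int k .. int N - int k - 1} \<longrightarrow>
      (\<Sum>jj = 1..k+1. (-1) ^ jj * pit \<pi> (I @ [J ! (jj - 1)]) * pit \<pi> (take (jj - 1) J @ drop jj J)) = 0)"

definition grass :: "(nat list \<Rightarrow> complex) \<Rightarrow> bool" where
  "grass \<pi> \<longleftrightarrow> (\<exists>lam\<in>partitions. \<pi> lam \<noteq> 0) \<and> plucker \<pi>"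

text \<open>tau_w = sum_lambda pi_lambda s_lambda (coefficientwise finite: s_lambda is weighted homogeneous of degree |lambda|).\<close>
definition tau :: "(nat list \<Rightarrow> complex) \<Rightarrow> ser" where
  "tau \<pi> = (\<lambda>m. \<Sum>lam | lam \<in> partitions \<and> sum_list lam = wdeg m. \<pi> lam * Poly_Mapping.lookup (schur lam) m)"

inductive_set Sx :: "poly set" where
  one: "1 \<in> Sx"
| step: "s \<in> Sx \<Longrightarrow> i \<noteq> j \<Longrightarrow> (pvar (X i) - pvar (X j)) * s \<in> Sx"

text \<open>Elements of the localization: fractions (numerator, denominator in Sx).\<close>
type_synonym loc = "ser \<times> poly"

definition lmul :: "loc \<Rightarrow> loc \<Rightarrow> loc" (infixl "**\<^sub>L" 70) where
  "a **\<^sub>L b = (ser_mult (fst a) (fst b), snd a * snd b)"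

definition ladd :: "loc \<Rightarrow> loc \<Rightarrow> loc" (infixl "++\<^sub>L" 65) where
  "a ++\<^sub>L b = (ser_add (ser_mult (fst a) (ser_of (snd b))) (ser_mult (fst b) (ser_of (snd a))),
               snd a * snd b)"

definition lneg :: "loc \<Rightarrow> loc" where
  "lneg a = (ser_neg (fst a), snd a)"

definition lsub :: "loc \<Rightarrow> loc \<Rightarrow> loc" (infixl "--\<^sub>L" 65) where
  "a --\<^sub>L b = a ++\<^sub>L lneg b"

definition leq :: "loc \<Rightarrow> loc \<Rightarrow> bool" (infix "=\<^sub>L" 50) where
  "a =\<^sub>L b \<longleftrightarrow> (\<exists>u\<in>Sx. ser_mult (ser_of u)
       (ser_add (ser_mult (fst a) (ser_of (snd b))) (ser_neg (ser_mult (fst b) (ser_of (snd a)))))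
     = (\<lambda>_. 0))"

definition alpha :: "int \<Rightarrow> int \<Rightarrow> int" where
  "alpha i = (\<lambda>m. if m = i then 1 else 0)"

definition Bset :: "(int \<Rightarrow> int) set" where
  "Bset = {n. finite {i. n i \<noteq> 0} \<and> (\<forall>i\<ge>1. n (i - 1) = - n (- i))}"

definition xdiff :: "int \<Rightarrow> int \<Rightarrow> poly" where
  "xdiff i j = pvar (X i) - pvar (X j)"

text \<open>H^n_w = prod_{i<j} (x_i - x_j)^{n_i n_j} tau_w(t + sum n_i [x_i]) as a fraction.\<close>
definition Hn :: "(nat list \<Rightarrow> complex) \<Rightarrow> (int \<Rightarrow> int) \<Rightarrow> loc" where
  "Hn \<pi> n = (ser_mult
      (ser_of (\<Prod>(i, j) \<in> {(i, j). i < j \<and> n i * n j > 0}. xdiff i j ^ nat (n i * n j)))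
      (ser_shift n (tau \<pi>)),
    (\<Prod>(i, j) \<in> {(i, j). i < j \<and> n i * n j < 0}. xdiff i j ^ nat (- (n i * n j))))"

definition frob_rank :: "nat list \<Rightarrow> nat" where
  "frob_rank lam = card {i. 1 \<le> i \<and> i \<le> length lam \<and> lam ! (i - 1) \<ge> i}"

definition conj_part :: "nat list \<Rightarrow> nat \<Rightarrow> nat" where
  "conj_part lam i = card {j. j < length lam \<and> lam ! j \<ge> i}"

definition frob_a :: "nat list \<Rightarrow> nat \<Rightarrow> int" where
  "frob_a lam i = int (lam ! (i - 1)) - int i"

definition frob_b :: "nat list \<Rightarrow> nat \<Rightarrow> int" where
  "frob_b lam i = int (conj_part lam i) - int i"

definition Hlam :: "(nat list \<Rightarrow> complex) \<Rightarrow> (int \<Rightarrow> int) \<Rightarrow> nat list \<Rightarrow> loc" where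
  "Hlam \<pi> n lam = Hn \<pi> (n + (\<Sum>i = 1..frob_rank lam. alpha (frob_a lam i))
                           - (\<Sum>i = 1..frob_rank lam. alpha (- frob_b lam i - 1)))"

definition hook :: "nat \<Rightarrow> nat \<Rightarrow> nat list" where
  "hook p q = Suc p # replicate q 1"

definition gam :: "nat \<Rightarrow> int \<Rightarrow> int" where
  "gam p = alpha (int p) - alpha (- int p - 1)"

end

(*
  At every point x_i, t_j with complex coordinates, graded by weight, a series becomes a one-variable
  power series in u, and a series vanishes if all these evaluations do. The value of H^n is then
  prod_{i<j} (y_i - y_j)^(n_i n_j) tau(t + sum_i n_i [x_i]) in a field, where y_i = x_i u.

  The Plucker relations say that the alternating form sum_L pi_L v_1(L_1)...v_k(L_k) satisfies quadratic
  identities for arbitrary vectors v. Writing c_i(l) = h_{l+i}(t), the form takes the value tau(t), up to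
  sign and high degree, on c_1, ..., c_k. Replacing c_1, c_2 by the columns h_{l+2}(t + [z]) for two values
  of z gives (z - z') tau(t + [z] + [z']), so the quadratic identities become the three-term Fay identity
    (z1 - z2)(z3 - z4) tau(t + [z1] + [z2]) tau(t + [z3] + [z4]) - ... = 0,
  that is E(n + a + b) E(n + c + d) - E(n + a + c) E(n + b + d) + E(n + a + d) E(n + b + c) = 0 for the
  values E of H and unit vectors a, b, c, d with increasing indices; the order i < j in the prefactor of H
  absorbs all signs. For the six indices -k-1 < -j-1 < -i-1 < i < j < k, the functions occurring in the
  theorem are therefore the Plucker coordinates of a point of Gr(3,6), and the seven identities follow
  from the three-term relations among these coordinates.
*)
theory Submission
  imports Defs "HOL-Computational_Algebra.Formal_Laurent_Series"
    "HOL-Library.Nat_Bijection"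
begin

section \<open>Alternating functions of lists\<close>

text \<open>Series are bare functions and fractions bare pairs compared up to a factor in
  \<open>Sx\<close>, so no ring normalisation applies to the statement directly; evaluation moves
  everything into formal Laurent series, where it does. Three obstacles shape the way there.
  Infinitely many variables have weight 1, so each evaluation keeps only the x_i with i in a finite
  set \<open>F\<close>, which grows with the monomial under test. Denominators can vanish where two
  relevant coordinates agree; the factor allowed by \<open>leq\<close> is chosen to vanish there
  too. The Plucker relations speak about finite windows of indices, so the Fay identity is checked
  one coefficient of u at a time: for u^D, partitions with at most D + 2 parts of size at most D + 2
  suffice. Triples of indices arise because every function of the theorem is H at one common vector
  plus three unit vectors: subtract the unit vectors at -i-1, -j-1, -k-1 from n'. Relative to this
  vector H is the triple of these indices, adding \<open>gam p\<close> replaces -p-1 by p, and a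
  superscript (p|q) replaces -q-1 by p.\<close>

lemma sgnL_Cons:
  "sgnL (x # xs) = (if x \<in> set xs then 0 else (-1) ^ length (filter (\<lambda>y. y < x) xs)) * sgnL xs"
proof -
  let ?I = "\<lambda>L::int list. {(a, b). a < b \<and> b < length L \<and> L ! a > L ! b}"
  let ?A = "{b. b < length xs \<and> xs ! b < x}"
  \<comment> \<open>Inversions are sorted by whether they involve the head; a head that recurs later
    makes the whole sign 0.\<close>
  have split: "?I (x # xs) = (\<lambda>b. (0, Suc b)) ` ?A \<union> map_prod Suc Suc ` ?I xs" (is "_ = ?R")
  proof (intro equalityI subsetI)
    fix p assume p: "p \<in> ?I (x # xs)"
    obtain a b where ab: "p = (a, b)" by (cases p)
    obtain b' where b': "b = Suc b'" using p ab by (cases b) auto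
    show "p \<in> ?R"
    proof (cases a)
      case 0
      then show ?thesis using p ab b' by auto
    next
      case (Suc a')
      then have "(a', b') \<in> ?I xs" using p ab b' by auto
      then have "p \<in> map_prod Suc Suc ` ?I xs"
        using ab b' Suc by (intro rev_image_eqI[of "(a', b')"]) simp_all
      then show ?thesis by (rule UnI2)
    qed
  qed auto
  have fin: "finite (?I xs)"
    by (rule finite_subset[of _ "{..<length xs} \<times> {..<length xs}"]) auto
  have "card (?I (x # xs)) = card ((\<lambda>b. (0::nat, Suc b)) ` ?A) + card (map_prod Suc Suc ` ?I xs)"
    unfolding split using fin by (intro card_Un_disjoint) auto
  also have "\<dots> = card ?A + card (?I xs)"
    by (intro arg_cong2[where f = "(+)"] card_image) (auto simp: inj_on_def)
  also have "card ?A = length (filter (\<lambda>y. y < x) xs)"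
    by (simp add: length_filter_conv_card)
  finally show ?thesis
    by (auto simp: sgnL_def power_add)
qed

text \<open>The factor contributed by an earlier entry depends only on which entries follow it, not
  on their order, so the common prefix is peeled off and the swapped pair decides.\<close>

lemma sgnL_swap_adjacent: "sgnL (xs @ a # b # ys) = - sgnL (xs @ b # a # ys)"
proof (induction xs)
  case Nil
  show ?case by (cases a b rule: linorder_cases) (auto simp: sgnL_Cons)
next
  case (Cons x xs)
  then show ?case by (auto simp: sgnL_Cons)
qed

context
  fixes f :: "'a list \<Rightarrow> 'b::comm_ring_1"
  assumes adjacent: "\<And>xs a b ys. f (xs @ a # b # ys) = - f (xs @ b # a # ys)"
begin

lemma alternating_move: "f (xs @ a # ys @ zs) = (-1) ^ length ys * f (xs @ ys @ a # zs)"
proof (induction ys arbitrary: xs)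
  case (Cons y ys)
  have "f (xs @ a # (y # ys) @ zs) = - f ((xs @ [y]) @ a # ys @ zs)"
    using adjacent[of xs a y "ys @ zs"] by simp
  then show ?case using Cons[of "xs @ [y]"] by simp
qed simp

lemma alternating_swap: "f (xs @ a # ys @ b # zs) = - f (xs @ b # ys @ a # zs)"
proof -
  have "f (xs @ a # ys @ b # zs) = (-1) ^ length ys * f ((xs @ ys) @ a # b # zs)"
    using alternating_move[of xs a ys "b # zs"] by simp
  also have "\<dots> = - ((-1) ^ length ys * f (xs @ ys @ b # a # zs))"
    using adjacent[of "xs @ ys" a b zs] by simp
  also have "\<dots> = - f (xs @ b # ys @ a # zs)"
    using alternating_move[of xs b ys "a # zs"] by simp
  finally show ?thesis .
qed

text \<open>Permutations are built from transpositions, and a transposition of positions is an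
  exchange of two entries of the list, which \<open>alternating_swap\<close> controls.\<close>

lemma alternating_permute:
  assumes "\<sigma> permutes {..<length s}"
  shows "f (permute_list \<sigma> s) = of_int (sign \<sigma>) * f s"
proof -
  have transp: "f (permute_list (Transposition.transpose a b) s) = - f s"
    if "a < b" "b < length s" for a b s
  proof -
    define xs ys zs where "xs = take a s" and "ys = take (b - Suc a) (drop (Suc a) s)"
      and "zs = drop (Suc b) s"
    have ys: "drop (Suc a) s = ys @ s ! b # zs"
      using that unfolding ys_def zs_def
      by (metis (no_types, lifting) Suc_leI add_diff_cancel_left' append_take_drop_id
          Cons_nth_drop_Suc drop_drop le_add_diff_inverse2)
    have s: "s = xs @ s ! a # ys @ s ! b # zs"
      using that ys unfolding xs_def by (metis id_take_nth_drop less_trans)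
    have len: "length xs = a" "length ys = b - Suc a"
      using that by (auto simp: xs_def ys_def)
    have "permute_list (Transposition.transpose a b) s = xs @ s ! b # ys @ s ! a # zs"
    proof (rule nth_equalityI)
      show "length (permute_list (Transposition.transpose a b) s) = length (xs @ s ! b # ys @ s ! a # zs)"
        using arg_cong[OF s, of length] by simp
    next
      fix i assume "i < length (permute_list (Transposition.transpose a b) s)"
      then have i: "i < length s" by simp
      have lhs: "permute_list (Transposition.transpose a b) s ! i = s ! Transposition.transpose a b i"
        using i by (simp add: permute_list_def)
      have si: "s ! i = (xs @ s ! a # ys @ s ! b # zs) ! i" using s by simp
      consider "i < a" | "i = a" | "a < i" "i < b" | "i = b" | "b < i" by linarith
      then show "permute_list (Transposition.transpose a b) s ! i = (xs @ s ! b # ys @ s ! a # zs) ! i"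
      proof cases
        case 1
        then show ?thesis using that si len unfolding lhs
          by (simp add: transpose_apply_other nth_append)
      next
        case 2
        then show ?thesis using that len unfolding lhs by (simp add: nth_append)
      next
        case 3
        then have "i - Suc a < b - Suc a" by simp
        then show ?thesis using 3 that si len unfolding lhs
          by (simp add: transpose_apply_other nth_append nth_Cons')
      next
        case 4
        then show ?thesis using that len unfolding lhs by (simp add: nth_append nth_Cons')
      next
        case 5
        then have "\<not> i - Suc a < b - Suc a" using that by linarith
        then show ?thesis using 5 that si len unfolding lhs
          by (simp add: transpose_apply_other nth_append nth_Cons')
      qed
    qed
    then show ?thesis using alternating_swap[of xs "s ! b" ys "s ! a" zs] s by simp
  qed
  have "length s = m \<Longrightarrow> f (permute_list \<sigma> s) = of_int (sign \<sigma>) * f s"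
    if "\<sigma> permutes {..<m}" for m s
    using that finite_lessThan[of m]
  proof (induction arbitrary: s rule: permutes_induct)
    case id
    then show ?case by simp
  next
    case (swap a b p)
    have perm: "permutation p" using swap by (auto simp: permutation_permutes)
    have tr: "f (permute_list (Transposition.transpose a b) s) = - f s"
    proof (cases "a < b")
      case True
      then show ?thesis using transp[of a b s] swap by auto
    next
      case False
      then show ?thesis using transp[of b a s] swap by (auto simp: transpose_commute)
    qed
    have "f (permute_list (Transposition.transpose a b \<circ> p) s)
        = of_int (sign p) * f (permute_list (Transposition.transpose a b) s)"
      using swap by (simp add: permute_list_compose)
    also have "\<dots> = of_int (sign (Transposition.transpose a b \<circ> p)) * f s"
      using swap perm by (simp add: tr sign_compose sign_swap_id permutation_swap_id)
    finally show ?case .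
  qed
  then show ?thesis using assms by blast
qed

end

text \<open>Exchanging the two equal entries leaves the list unchanged and flips the sign, so
  \<open>f L = - f L\<close>.\<close>

lemma alternating_repeat:
  fixes f :: "'a list \<Rightarrow> 'b::idom"
  assumes adjacent: "\<And>xs a b ys. f (xs @ a # b # ys) = - f (xs @ b # a # ys)"
    and "\<not> distinct L" and two: "(2::'b) \<noteq> 0"
  shows "f L = 0"
proof -
  obtain xs ys zs a where L: "L = xs @ a # ys @ a # zs"
    using not_distinct_decomp[OF assms(2)] by auto
  have "f L = - f L"
    unfolding L by (rule alternating_swap) (rule adjacent)
  then show ?thesis using two by (metis eq_neg_iff_add_eq_0 mult_2 mult_eq_0_iff)
qed

text \<open>Every pair of positions is an inversion.\<close>

lemma sgnL_decreasing:
  "sorted_wrt (>) L \<Longrightarrow> sgnL L = (-1) ^ (length L choose 2)"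
proof (induction L)
  case Nil
  show ?case by (simp add: sgnL_def binomial_eq_0)
next
  case (Cons x L)
  then have "filter (\<lambda>y. y < x) L = L" and "x \<notin> set L" by (auto simp: filter_id_conv)
  moreover have "Suc (length L) choose 2 = length L + (length L choose 2)"
    by (simp add: numeral_2_eq_2)
  ultimately show ?case using Cons by (simp add: sgnL_Cons power_add)
qed

lemma lamL_cong_mset:
  "mset L = mset L' \<Longrightarrow> lamL L = lamL L'"
proof -
  assume eq: "mset L = mset L'"
  then have "sort L = sort L'" by (intro properties_for_sort) simp_all
  then show ?thesis using mset_eq_length[OF eq] by (simp add: lamL_def)
qed

lemma pit_swap_adjacent: "pit \<pi> (xs @ a # b # ys) = - pit \<pi> (xs @ b # a # ys)"
proof -
  have "lamL (xs @ a # b # ys) = lamL (xs @ b # a # ys)" by (rule lamL_cong_mset) simp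
  then show ?thesis using sgnL_swap_adjacent[of xs a b ys] by (simp add: pit_def)
qed

lemma pit_permute:
  "\<sigma> permutes {..<length s} \<Longrightarrow> pit \<pi> (permute_list \<sigma> s) = of_int (sign \<sigma>) * pit \<pi> s"
  by (rule alternating_permute) (rule pit_swap_adjacent)

section \<open>The alternating form of the Plucker coordinates\<close>

definition tuples :: "int set \<Rightarrow> nat \<Rightarrow> int list set" where
  "tuples A n = {L. length L = n \<and> set L \<subseteq> A}"

lemma finite_tuples [simp]: "finite A \<Longrightarrow> finite (tuples A n)"
  using finite_lists_length_eq[of A n] by (simp add: tuples_def conj_commute)

lemma tuples_0 [simp]: "tuples A 0 = {[]}"
  by (auto simp: tuples_def)

lemma length_tuples: "L \<in> tuples A n \<Longrightarrow> length L = n"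
  by (simp add: tuples_def)

lemma sum_tuples_Suc:
  "(\<Sum>L\<in>tuples A (Suc n). g L) = (\<Sum>l\<in>A. \<Sum>L\<in>tuples A n. g (l # L))"
proof -
  have "(\<Sum>l\<in>A. \<Sum>L\<in>tuples A n. g (l # L)) = (\<Sum>(l, L)\<in>A \<times> tuples A n. g (l # L))"
    by (simp add: sum.cartesian_product)
  also have "\<dots> = (\<Sum>L\<in>tuples A (Suc n). g L)"
    by (rule sum.reindex_bij_witness[of _ "\<lambda>L. (hd L, tl L)" "\<lambda>(l, L). l # L"])
       (auto simp: tuples_def length_Suc_conv)
  finally show ?thesis by simp
qed

lemma sum_tuples_append:
  "(\<Sum>L\<in>tuples A (m + n). g L) = (\<Sum>L\<in>tuples A m. \<Sum>L'\<in>tuples A n. g (L @ L'))"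
  by (induction m arbitrary: g) (simp_all add: sum_tuples_Suc)

definition colprod :: "(int \<Rightarrow> 'b::comm_ring_1) list \<Rightarrow> int list \<Rightarrow> 'b" where
  "colprod vs L = prod_list (map2 (\<lambda>v l. v l) vs L)"

lemma colprod_Nil [simp]: "colprod [] L = 1"
  by (simp add: colprod_def)

lemma colprod_Cons [simp]: "colprod (v # vs) (l # L) = v l * colprod vs L"
  by (simp add: colprod_def)

lemma colprod_append [simp]:
  "length vs = length L \<Longrightarrow> colprod (vs @ vs') (L @ L') = colprod vs L * colprod vs' L'"
  by (simp add: colprod_def)

text \<open>The Plucker coordinates serve as coefficients of an alternating multilinear form. The
  window \<open>A\<close> of row indices is meant to be finite, and the columns take values in power
  series in u.\<close>

definition altform ::
    "(nat list \<Rightarrow> complex) \<Rightarrow> int set \<Rightarrow> (int \<Rightarrow> complex fps) list \<Rightarrow> complex fps" where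
  "altform \<pi> A vs = (\<Sum>L\<in>tuples A (length vs). fps_const (pit \<pi> L) * colprod vs L)"

lemma altform_split:
  "altform \<pi> A (xs @ v # ys) =
     (\<Sum>L\<in>tuples A (length xs). \<Sum>l\<in>A. \<Sum>L'\<in>tuples A (length ys).
        fps_const (pit \<pi> (L @ l # L')) * colprod xs L * v l * colprod ys L')"
proof -
  have "altform \<pi> A (xs @ v # ys) = (\<Sum>L\<in>tuples A (length xs). \<Sum>l\<in>A. \<Sum>L'\<in>tuples A (length ys).
        fps_const (pit \<pi> (L @ l # L')) * colprod (xs @ v # ys) (L @ l # L'))"
  proof -
    have "length (xs @ v # ys) = length xs + Suc (length ys)" by simp
    then show ?thesis unfolding altform_def by (simp only: sum_tuples_append sum_tuples_Suc)
  qed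
  also have "\<dots> = (\<Sum>L\<in>tuples A (length xs). \<Sum>l\<in>A. \<Sum>L'\<in>tuples A (length ys).
        fps_const (pit \<pi> (L @ l # L')) * colprod xs L * v l * colprod ys L')"
    by (intro sum.cong refl) (simp add: length_tuples mult.assoc)
  finally show ?thesis .
qed

lemma altform_linear:
  "altform \<pi> A (xs @ (\<lambda>l. v l + c * w l) # ys)
   = altform \<pi> A (xs @ v # ys) + c * altform \<pi> A (xs @ w # ys)"
  by (simp add: altform_split sum_distrib_left sum.distrib[symmetric] algebra_simps)

lemma altform_swap_adjacent:
  "altform \<pi> A (xs @ v # w # ys) = - altform \<pi> A (xs @ w # v # ys)"
proof -
  have expand: "altform \<pi> A (xs @ v # w # ys) =
     (\<Sum>L\<in>tuples A (length xs). \<Sum>l\<in>A. \<Sum>l'\<in>A. \<Sum>L'\<in>tuples A (length ys).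
        fps_const (pit \<pi> (L @ l # l' # L')) * colprod xs L * v l * w l' * colprod ys L')" for v w
    by (simp add: altform_split sum_tuples_Suc mult.assoc)
  have "altform \<pi> A (xs @ w # v # ys) =
     (\<Sum>L\<in>tuples A (length xs). \<Sum>l'\<in>A. \<Sum>l\<in>A. \<Sum>L'\<in>tuples A (length ys).
        fps_const (pit \<pi> (L @ l # l' # L')) * colprod xs L * w l * v l' * colprod ys L')"
    unfolding expand by (intro sum.cong[OF refl] sum.swap)
  also have "\<dots> = - altform \<pi> A (xs @ v # w # ys)"
    unfolding expand sum_negf[symmetric]
  proof (intro sum.cong refl)
    fix L L' l l'
    show "fps_const (pit \<pi> (L @ l' # l # L')) * colprod xs L * w l' * v l * colprod ys L'
      = - (fps_const (pit \<pi> (L @ l # l' # L')) * colprod xs L * v l * w l' * colprod ys L')"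
      by (subst pit_swap_adjacent) (simp add: mult_ac flip: fps_const_neg)
  qed
  finally show ?thesis by simp
qed

lemma altform_repeat: "\<not> distinct vs \<Longrightarrow> altform \<pi> A vs = 0"
  by (rule alternating_repeat[of "altform \<pi> A", OF altform_swap_adjacent])
     (simp_all add: numeral_fps_const)

text \<open>A column operation: by linearity the extra term has the argument \<open>w\<close> twice
  and vanishes.\<close>

lemma altform_add_multiple:
  assumes "w \<in> set xs \<union> set ys"
  shows "altform \<pi> A (xs @ (\<lambda>l. v l + c * w l) # ys) = altform \<pi> A (xs @ v # ys)"
proof -
  have "altform \<pi> A (xs @ w # ys) = 0" using assms by (intro altform_repeat) auto
  then show ?thesis by (simp add: altform_linear)
qed

lemma fps_const_sum: "fps_const (sum f I) = (\<Sum>i\<in>I. fps_const (f i))"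
  by (induction I rule: infinite_finite_induct) (simp_all flip: fps_const_add)

text \<open>Each relation for index tuples \<open>I\<close>, \<open>J\<close> is multiplied by the
  product of the entries of \<open>vs\<close> at \<open>I\<close> and of \<open>ws\<close> at
  \<open>J\<close>; summing over all \<open>I\<close>, \<open>J\<close> and using multilinearity
  replaces indices by vectors.\<close>

lemma altform_plucker:
  assumes "plucker \<pi>" "0 < k" "k < N" "length vs = k - 1" "length ws = k + 1"
    and A: "A = {- int k .. int N - int k - 1}"
  shows "(\<Sum>jj = 1..k+1. (-1) ^ jj * altform \<pi> A (vs @ [ws ! (jj - 1)])
            * altform \<pi> A (take (jj - 1) ws @ drop jj ws)) = 0"
proof -
  have eq: "altform \<pi> A (vs @ [ws ! (jj - 1)]) * altform \<pi> A (take (jj - 1) ws @ drop jj ws)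
     = (\<Sum>I\<in>tuples A (k - 1). \<Sum>J\<in>tuples A (k + 1).
          fps_const (pit \<pi> (I @ [J ! (jj - 1)]) * pit \<pi> (take (jj - 1) J @ drop jj J))
          * (colprod vs I * colprod ws J))" if jj: "jj \<in> {1..k+1}" for jj
  proof -
    let ?f = "\<lambda>I J. fps_const (pit \<pi> (I @ [J ! (jj - 1)]) * pit \<pi> (take (jj - 1) J @ drop jj J))
          * (colprod vs I * colprod ws J)"
    \<comment> \<open>\<open>J\<close> is cut as \<open>J1 @ l # J2\<close> at position
      \<open>jj\<close>; the entry \<open>l\<close> moves to the first factor and
      \<open>J1 @ J2\<close> stays in the second.\<close>
    have tup: "tuples A (k + 1) = tuples A ((jj - 1) + Suc (k + 1 - jj))"
      using jj by (intro arg_cong[where f = "tuples A"]) auto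
    have ws: "ws = take (jj - 1) ws @ ws ! (jj - 1) # drop jj ws"
      using jj assms(5) id_take_nth_drop[of "jj - 1" ws] by (auto simp: Suc_diff_le)
    have len: "length (take (jj - 1) ws) = jj - 1" "length (drop jj ws) = k + 1 - jj"
      using jj assms(5) by auto
    have "(\<Sum>I\<in>tuples A (k - 1). \<Sum>J\<in>tuples A (k + 1). ?f I J)
        = (\<Sum>I\<in>tuples A (k - 1). \<Sum>J1\<in>tuples A (jj - 1). \<Sum>l\<in>A. \<Sum>J2\<in>tuples A (k + 1 - jj).
            ?f I (J1 @ l # J2))"
      unfolding tup sum_tuples_append sum_tuples_Suc ..
    also have "\<dots> = (\<Sum>I\<in>tuples A (k - 1). \<Sum>J1\<in>tuples A (jj - 1). \<Sum>l\<in>A. \<Sum>J2\<in>tuples A (k + 1 - jj).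
        (fps_const (pit \<pi> (I @ [l])) * colprod vs I * (ws ! (jj - 1)) l) *
        (fps_const (pit \<pi> (J1 @ J2)) * (colprod (take (jj - 1) ws) J1 * colprod (drop jj ws) J2)))"
    proof (intro sum.cong refl)
      fix I J1 l J2
      assume J: "J1 \<in> tuples A (jj - 1)" "J2 \<in> tuples A (k + 1 - jj)"
      have "colprod ws (J1 @ l # J2) =
          colprod (take (jj - 1) ws) J1 * ((ws ! (jj - 1)) l * colprod (drop jj ws) J2)"
        using J len by (subst ws, subst colprod_append) (simp_all add: length_tuples)
      moreover have "(J1 @ l # J2) ! (jj - 1) = l"
          "take (jj - 1) (J1 @ l # J2) @ drop jj (J1 @ l # J2) = J1 @ J2"
        using J jj by (auto simp: length_tuples nth_append Suc_diff_le drop_Cons' )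
      ultimately show "?f I (J1 @ l # J2) =
         (fps_const (pit \<pi> (I @ [l])) * colprod vs I * (ws ! (jj - 1)) l) *
        (fps_const (pit \<pi> (J1 @ J2)) * (colprod (take (jj - 1) ws) J1 * colprod (drop jj ws) J2))"
        by (simp add: mult_ac flip: fps_const_mult)
    qed
    also have "\<dots> = (\<Sum>I\<in>tuples A (k - 1). \<Sum>l\<in>A. \<Sum>J1\<in>tuples A (jj - 1). \<Sum>J2\<in>tuples A (k + 1 - jj).
        (fps_const (pit \<pi> (I @ [l])) * colprod vs I * (ws ! (jj - 1)) l) *
        (fps_const (pit \<pi> (J1 @ J2)) * (colprod (take (jj - 1) ws) J1 * colprod (drop jj ws) J2)))"
      by (intro sum.cong refl sum.swap)
    also have "\<dots> = (\<Sum>I\<in>tuples A (k - 1). \<Sum>l\<in>A.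
        fps_const (pit \<pi> (I @ [l])) * colprod vs I * (ws ! (jj - 1)) l) *
        (\<Sum>J1\<in>tuples A (jj - 1). \<Sum>J2\<in>tuples A (k + 1 - jj).
        fps_const (pit \<pi> (J1 @ J2)) * (colprod (take (jj - 1) ws) J1 * colprod (drop jj ws) J2))"
      by (simp only: sum_distrib_right) (simp only: sum_distrib_left)
    also have "(\<Sum>I\<in>tuples A (k - 1). \<Sum>l\<in>A.
        fps_const (pit \<pi> (I @ [l])) * colprod vs I * (ws ! (jj - 1)) l) = altform \<pi> A (vs @ [ws ! (jj - 1)])"
      using assms(4) by (simp add: altform_split)
    also have "(\<Sum>J1\<in>tuples A (jj - 1). \<Sum>J2\<in>tuples A (k + 1 - jj).
        fps_const (pit \<pi> (J1 @ J2)) * (colprod (take (jj - 1) ws) J1 * colprod (drop jj ws) J2))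
        = altform \<pi> A (take (jj - 1) ws @ drop jj ws)"
    proof -
      have "length (take (jj - 1) ws @ drop jj ws) = (jj - 1) + (k + 1 - jj)"
        by (simp only: length_append len)
      then show ?thesis using len unfolding altform_def
        by (simp only: sum_tuples_append) (intro sum.cong refl, simp add: length_tuples)
    qed
    finally show ?thesis by simp
  qed
  have "(\<Sum>jj = 1..k+1. (-1) ^ jj * altform \<pi> A (vs @ [ws ! (jj - 1)])
            * altform \<pi> A (take (jj - 1) ws @ drop jj ws))
      = (\<Sum>jj = 1..k+1. \<Sum>I\<in>tuples A (k - 1). \<Sum>J\<in>tuples A (k + 1).
          fps_const ((-1) ^ jj * pit \<pi> (I @ [J ! (jj - 1)]) * pit \<pi> (take (jj - 1) J @ drop jj J))
          * (colprod vs I * colprod ws J))"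
  proof (intro sum.cong refl)
    fix jj assume "jj \<in> {1..k+1}"
    have c: "fps_const ((-1) ^ jj * x) = (-1) ^ jj * fps_const (x :: complex)" for x
      by (cases "even jj") simp_all
    show "(-1) ^ jj * altform \<pi> A (vs @ [ws ! (jj - 1)]) * altform \<pi> A (take (jj - 1) ws @ drop jj ws)
       = (\<Sum>I\<in>tuples A (k - 1). \<Sum>J\<in>tuples A (k + 1).
          fps_const ((-1) ^ jj * pit \<pi> (I @ [J ! (jj - 1)]) * pit \<pi> (take (jj - 1) J @ drop jj J))
          * (colprod vs I * colprod ws J))"
      unfolding mult.assoc c eq[OF \<open>jj \<in> {1..k+1}\<close>] sum_distrib_left ..
  qed
  also have "\<dots> = (\<Sum>I\<in>tuples A (k - 1). \<Sum>J\<in>tuples A (k + 1). \<Sum>jj = 1..k+1.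
          fps_const ((-1) ^ jj * pit \<pi> (I @ [J ! (jj - 1)]) * pit \<pi> (take (jj - 1) J @ drop jj J))
          * (colprod vs I * colprod ws J))"
    by (subst sum.swap) (intro sum.cong refl, rule sum.swap)
  also have "\<dots> = 0"
  proof (rule sum.neutral, rule ballI, rule sum.neutral, rule ballI)
    fix I J assume IJ: "I \<in> tuples A (k - 1)" "J \<in> tuples A (k + 1)"
    have "(\<Sum>jj = 1..k+1. (-1) ^ jj * pit \<pi> (I @ [J ! (jj - 1)]) * pit \<pi> (take (jj - 1) J @ drop jj J)) = 0"
      using assms(1-3) IJ unfolding plucker_def tuples_def A by blast
    moreover have "(\<Sum>jj = 1..k+1. fps_const (f jj) * c) = fps_const (\<Sum>jj = 1..k+1. f jj) * c"
      for f :: "nat \<Rightarrow> complex" and c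
      by (simp only: fps_const_sum sum_distrib_right)
    ultimately show "(\<Sum>jj = 1..k+1.
          fps_const ((-1) ^ jj * pit \<pi> (I @ [J ! (jj - 1)]) * pit \<pi> (take (jj - 1) J @ drop jj J))
          * (colprod vs I * colprod ws J)) = 0"
      by (simp only: fps_const_0_eq_0 mult_zero_left)
  qed
  finally show ?thesis .
qed

text \<open>With \<open>h\<close>, \<open>h1\<close>, \<open>h2\<close>, \<open>h12\<close> the complete homogeneous functions at \<open>t\<close>, \<open>t + [y1]\<close>, \<open>t + [y2]\<close>,
  \<open>t + [y1] + [y2]\<close>: the columns of \<open>h\<close> from the third on turn into columns of \<open>h12\<close> by unitriangular
  column operations.\<close>

lemma altform_insert_two:
  fixes h h1 h2 h12 :: "int \<Rightarrow> complex fps"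
  assumes h1: "\<And>l. h1 l = h12 l - y2 * h12 (l - 1)" and h2: "\<And>l. h2 l = h12 l - y1 * h12 (l - 1)"
    and h: "\<And>l. h l = h1 l - y1 * h1 (l - 1)"
  shows "altform \<pi> A ((\<lambda>l. h1 (l + 2)) # (\<lambda>l. h2 (l + 2)) # map (\<lambda>i l. h (l + int i)) [3..<m + 3])
     = (y1 - y2) * altform \<pi> A (map (\<lambda>i l. h12 (l + int i)) [1..<m + 3])"
proof -
  define c c' where "c = (\<lambda>i l. h (l + int i))" and "c' = (\<lambda>i l. h12 (l + int i))"
  \<comment> \<open>With S the shift from l to l - 1, \<open>h\<close> is (1 - y1 S)(1 - y2 S)
    applied to \<open>h12\<close>. The expansion is nested so that
    \<open>altform_add_multiple\<close> can strip one term at a time.\<close>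
  have cc': "c (Suc (Suc i)) = (\<lambda>l. (\<lambda>l. c' (Suc (Suc i)) l + (- (y1 + y2)) * c' (Suc i) l) l + (y1 * y2) * c' i l)" for i
    by (auto simp: c_def c'_def h h1 algebra_simps fun_eq_iff)
  \<comment> \<open>Working from left to right, the two preceding columns are already columns of
    \<open>h12\<close>, so both lower terms of \<open>cc'\<close> are multiples of columns
    present.\<close>
  have clear: "altform \<pi> A (map c' [1..<n + 3] @ map c [n + 3..<n + r + 3])
      = altform \<pi> A (map c' [1..<n + r + 3])" for n r
  proof (induction r arbitrary: n)
    case (Suc r)
    have "map c [n + 3..<n + Suc r + 3] = c (Suc (Suc (Suc n))) # map c [Suc n + 3..<Suc n + r + 3]"
      by (simp add: upt_rec eval_nat_numeral)
    then have "altform \<pi> A (map c' [1..<n + 3] @ map c [n + 3..<n + Suc r + 3])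
      = altform \<pi> A (map c' [1..<n + 3] @ (\<lambda>l. (\<lambda>l. c' (Suc (Suc (Suc n))) l + (- (y1 + y2)) * c' (Suc (Suc n)) l) l
          + (y1 * y2) * c' (Suc n) l) # map c [Suc n + 3..<Suc n + r + 3])"
      by (simp only: cc')
    also have "\<dots> = altform \<pi> A (map c' [1..<n + 3] @ (\<lambda>l. c' (Suc (Suc (Suc n))) l + (- (y1 + y2)) * c' (Suc (Suc n)) l)
          # map c [Suc n + 3..<Suc n + r + 3])"
      by (rule altform_add_multiple) force
    also have "\<dots> = altform \<pi> A (map c' [1..<n + 3] @ c' (Suc (Suc (Suc n))) # map c [Suc n + 3..<Suc n + r + 3])"
      by (rule altform_add_multiple) force
    also have "\<dots> = altform \<pi> A (map c' [1..<Suc n + 3] @ map c [Suc n + 3..<Suc n + r + 3])"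
      by (simp add: eval_nat_numeral)
    also have "\<dots> = altform \<pi> A (map c' [1..<n + Suc r + 3])"
      using Suc[of "Suc n"] by simp
    finally show ?case .
  qed simp
  let ?R = "map c [3..<m + 3]"
  have "(\<lambda>l. h1 (l + 2)) = (\<lambda>l. c' 2 l + (- y2) * c' 1 l)"
    "(\<lambda>l. h2 (l + 2)) = (\<lambda>l. c' 2 l + (- y1) * c' 1 l)"
    by (auto simp: c'_def h1 h2 algebra_simps)
  then have "altform \<pi> A ((\<lambda>l. h1 (l + 2)) # (\<lambda>l. h2 (l + 2)) # ?R)
      = altform \<pi> A ([] @ (\<lambda>l. c' 2 l + (- y2) * c' 1 l) # (\<lambda>l. c' 2 l + (- y1) * c' 1 l) # ?R)"
    by simp
  also have "\<dots> = altform \<pi> A ([c' 2] @ (\<lambda>l. c' 2 l + (- y1) * c' 1 l) # ?R)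
      - y2 * altform \<pi> A ([c' 1] @ (\<lambda>l. c' 2 l + (- y1) * c' 1 l) # ?R)"
    using altform_linear[of \<pi> A "[]" "c' 2" "- y2" "c' 1" "(\<lambda>l. c' 2 l + (- y1) * c' 1 l) # ?R"] by simp
  \<comment> \<open>Only the terms containing both \<open>c' 1\<close> and \<open>c' 2\<close>
    survive; their coefficients form a 2 by 2 determinant.\<close>
  also have "\<dots> = - y1 * altform \<pi> A ([] @ c' 2 # c' 1 # ?R) - y2 * altform \<pi> A ([c' 1] @ c' 2 # ?R)"
    unfolding altform_linear by (simp add: altform_repeat algebra_simps)
  also have "\<dots> = (y1 - y2) * altform \<pi> A ([c' 1] @ c' 2 # ?R)"
    unfolding altform_swap_adjacent[of \<pi> A "[]" "c' 2"] by (simp add: algebra_simps)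
  also have "[c' 1] @ c' 2 # ?R = map c' [1..<0 + 3] @ map c [0 + 3..<0 + m + 3]"
    by (simp add: upt_rec eval_nat_numeral)
  also have "altform \<pi> A \<dots> = altform \<pi> A (map c' [1..<m + 3])"
    using clear[of 0 m] by simp
  finally show ?thesis unfolding c_def c'_def .
qed

text \<open>The general relation is applied to \<open>w1 # cs\<close> and
  \<open>w2 # w3 # w4 # cs\<close>. Sharing the columns \<open>cs\<close> cuts its m + 3 terms down
  to three.\<close>

lemma altform_three_term:
  assumes "plucker \<pi>" "m + 2 < N" and A: "A = {- int (m + 2) .. int N - int (m + 2) - 1}"
    and len: "length cs = m"
  shows "altform \<pi> A (w1 # w2 # cs) * altform \<pi> A (w3 # w4 # cs)
       - altform \<pi> A (w1 # w3 # cs) * altform \<pi> A (w2 # w4 # cs)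
       + altform \<pi> A (w1 # w4 # cs) * altform \<pi> A (w2 # w3 # cs) = 0"
proof -
  let ?ws = "w2 # w3 # w4 # cs"
  let ?t = "\<lambda>jj. (-1) ^ jj * altform \<pi> A ((w1 # cs) @ [?ws ! (jj - 1)])
            * altform \<pi> A (take (jj - 1) ?ws @ drop jj ?ws)"
  have "0 = (\<Sum>jj = 1..(m + 2) + 1. ?t jj)"
    using assms len by (intro altform_plucker[symmetric, where N = N]) auto
  also have "{1..(m + 2) + 1} = {1, 2, 3} \<union> {4..m + 3}" by auto
  also have "(\<Sum>jj\<in>\<dots>. ?t jj) = (\<Sum>jj\<in>{1, 2, 3}. ?t jj) + (\<Sum>jj\<in>{4..m + 3}. ?t jj)"
    by (intro sum.union_disjoint) auto
  \<comment> \<open>From the fourth term on, the transferred vector comes from \<open>cs\<close> and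
    so occurs twice in the first factor.\<close>
  also have "(\<Sum>jj\<in>{4..m + 3}. ?t jj) = 0"
  proof (intro sum.neutral ballI)
    fix jj assume "jj \<in> {4..m + 3}"
    then have "?ws ! (jj - 1) = cs ! (jj - 4)" "jj - 4 < length cs"
      using len by (auto simp: nth_Cons' numeral_eq_Suc)
    then have "\<not> distinct ((w1 # cs) @ [?ws ! (jj - 1)])" by simp
    then have "altform \<pi> A ((w1 # cs) @ [?ws ! (jj - 1)]) = 0" by (rule altform_repeat)
    then show "?t jj = 0" by (simp only: mult_zero_left mult_zero_right)
  qed
  finally have sum0: "- (altform \<pi> A (w1 # cs @ [w2]) * altform \<pi> A (w3 # w4 # cs))
     + altform \<pi> A (w1 # cs @ [w3]) * altform \<pi> A (w2 # w4 # cs)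
     - altform \<pi> A (w1 # cs @ [w4]) * altform \<pi> A (w2 # w3 # cs) = 0"
    by (simp add: numeral_eq_Suc algebra_simps)
  \<comment> \<open>Bringing the last vector to second place passes all m columns of
    \<open>cs\<close>; the sign is common to the three terms and cancels.\<close>
  have "altform \<pi> A (w1 # cs @ [v]) = (-1) ^ m * altform \<pi> A (w1 # v # cs)" for v
    using alternating_move[of "altform \<pi> A" "[w1]" v cs "[]", OF altform_swap_adjacent] len
    by (simp add: minus_one_power_iff)
  then have "(-1) ^ m * (altform \<pi> A (w1 # w2 # cs) * altform \<pi> A (w3 # w4 # cs)
       - altform \<pi> A (w1 # w3 # cs) * altform \<pi> A (w2 # w4 # cs)
       + altform \<pi> A (w1 # w4 # cs) * altform \<pi> A (w2 # w3 # cs)) = 0"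
    using sum0 by (simp add: algebra_simps eq_neg_iff_add_eq_0)
  then show ?thesis by simp
qed

section \<open>Partitions, Jacobi--Trudi determinants and the Fay identity\<close>

text \<open>The ring is left open because the same determinant is used with the polynomials
  \<open>hpoly\<close>, with their complex values, and with the series
  \<open>graded h\<close>.\<close>

definition jacobi_trudi :: "(int \<Rightarrow> 'a::comm_ring_1) \<Rightarrow> nat list \<Rightarrow> 'a" where
  "jacobi_trudi h lam = (\<Sum>\<sigma> | \<sigma> permutes {0..<length lam}.
     of_int (sign \<sigma>) * (\<Prod>i<length lam. h (int (lam ! i) - int i + int (\<sigma> i))))"

definition part :: "nat list \<Rightarrow> nat \<Rightarrow> nat" where
  "part lam r = (if r < length lam then lam ! r else 0)"

text \<open>A row belonging to a zero part has entries h of a negative index left of the diagonal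
  and h 0 = 1 on it. Expanding along the last row removes it, so the size may be any k that is at
  least the number of parts.\<close>

lemma jacobi_trudi_pad:
  assumes "length lam \<le> k" and h0: "h 0 = 1" and hneg: "\<And>l. l < 0 \<Longrightarrow> h l = 0"
  shows "(\<Sum>\<sigma> | \<sigma> permutes {0..<k}.
     of_int (sign \<sigma>) * (\<Prod>i<k. h (int (part lam i) - int i + int (\<sigma> i)))) = jacobi_trudi h lam"
  using assms(1)
proof (induction k rule: nat_induct_at_least)
  case base
  show ?case by (auto simp: jacobi_trudi_def part_def intro!: sum.cong prod.cong)
next
  case (Suc k)
  let ?t = "\<lambda>k \<sigma>. of_int (sign \<sigma>) * (\<Prod>i<k. h (int (part lam i) - int i + int (\<sigma> i)))"
  have "(\<Sum>\<sigma> | \<sigma> permutes {0..<Suc k}. ?t (Suc k) \<sigma>) = (\<Sum>\<sigma> | \<sigma> permutes {0..<k}. ?t (Suc k) \<sigma>)"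
  proof (rule sum.mono_neutral_right)
    show "finite {\<sigma>. \<sigma> permutes {0..<Suc k}}" by (simp add: finite_permutations)
    show "{\<sigma>. \<sigma> permutes {0..<k}} \<subseteq> {\<sigma>. \<sigma> permutes {0..<Suc k}}"
      using permutes_subset by fastforce
    show "\<forall>\<sigma>\<in>{\<sigma>. \<sigma> permutes {0..<Suc k}} - {\<sigma>. \<sigma> permutes {0..<k}}. ?t (Suc k) \<sigma> = 0"
    proof
      fix \<sigma> assume \<sigma>: "\<sigma> \<in> {\<sigma>. \<sigma> permutes {0..<Suc k}} - {\<sigma>. \<sigma> permutes {0..<k}}"
      then have "\<sigma> k \<noteq> k"
        using permutes_superset[of \<sigma> "{0..<Suc k}" "{0..<k}"] by (auto simp: less_Suc_eq)
      moreover have "\<sigma> k < Suc k" using \<sigma> permutes_in_image[of \<sigma> "{0..<Suc k}" k] by simp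
      ultimately have "h (int (part lam k) - int k + int (\<sigma> k)) = 0"
        using Suc.hyps by (intro hneg) (simp add: part_def)
      then show "?t (Suc k) \<sigma> = 0" by simp
    qed
  qed
  also have "\<dots> = (\<Sum>\<sigma> | \<sigma> permutes {0..<k}. ?t k \<sigma>)"
  proof (rule sum.cong[OF refl])
    fix \<sigma> assume "\<sigma> \<in> {\<sigma>. \<sigma> permutes {0..<k}}"
    then have "\<sigma> k = k" by (auto simp: permutes_not_in)
    then have "h (int (part lam k) - int k + int (\<sigma> k)) = 1"
      using Suc.hyps h0 by (simp add: part_def)
    then show "?t (Suc k) \<sigma> = ?t k \<sigma>" by simp
  qed
  finally show ?case using Suc.IH by simp
qed

section \<open>Beta numbers: partitions in a box as strictly decreasing index tuples\<close>

definition beta_list :: "nat \<Rightarrow> nat list \<Rightarrow> int list" where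
  "beta_list k lam = map (\<lambda>r. int (part lam r) - int r - 1) [0..<k]"

definition box :: "nat \<Rightarrow> nat \<Rightarrow> nat list set" where
  "box k M = {lam \<in> partitions. length lam \<le> k \<and> (\<forall>x\<in>set lam. x \<le> M)}"

lemma finite_box [simp]: "finite (box k M)"
  by (rule finite_subset[OF _ finite_lists_length_le[of "{..M}" k]]) (auto simp: box_def)

lemma sorted_desc_filter_pos:
  fixes xs :: "nat list"
  shows "sorted_wrt (\<ge>) xs \<Longrightarrow> xs = filter (\<lambda>x. x > 0) xs @ replicate (length xs - length (filter (\<lambda>x. x > 0) xs)) 0"
proof (induction xs)
  case (Cons x xs)
  show ?case
  proof (cases "x = 0")
    case True
    then have z: "\<forall>y\<in>set (x # xs). y = 0" using Cons.prems by auto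
    then have "filter (\<lambda>x. x > 0) (x # xs) = []" by (auto simp: filter_empty_conv)
    moreover have "x # xs = replicate (length (x # xs)) 0"
      using z by (metis replicate_length_same)
    ultimately show ?thesis by (metis append_Nil diff_zero list.size(3))
  next
    case False
    then show ?thesis using Cons by simp
  qed
qed simp

lemma part_antimono:
  assumes "lam \<in> partitions" "r \<le> s"
  shows "part lam s \<le> part lam r"
  using assms sorted_wrt_nth_less[of "(\<ge>)" lam r s]
  by (cases "r = s") (auto simp: part_def partitions_def)

lemma sorted_beta_list: "lam \<in> partitions \<Longrightarrow> sorted_wrt (>) (beta_list k lam)"
  using part_antimono[of lam]
  by (auto simp: sorted_wrt_iff_nth_less beta_list_def) (smt (verit) int_ops less_imp_le_nat of_nat_less_iff of_nat_mono)

lemma map_part: "length lam \<le> k \<Longrightarrow> map (part lam) [0..<k] = lam @ replicate (k - length lam) 0"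
  by (rule nth_equalityI) (auto simp: part_def nth_append)

lemma lamL_decreasing:
  assumes "sorted_wrt (>) s"
  shows "lamL s = filter (\<lambda>x. x > 0) (map (\<lambda>r. nat (s ! r + int r + 1)) [0..<length s])"
proof -
  have "sort s = rev s"
    using assms by (intro properties_for_sort)
      (auto simp: sorted_wrt_rev intro: sorted_wrt_mono_rel[rotated])
  moreover have "[1..<length s + 1] = map Suc [0..<length s]"
    by (simp add: map_Suc_upt)
  ultimately show ?thesis
    by (auto simp: lamL_def Let_def rev_nth algebra_simps intro!: arg_cong[where f = "filter _"] map_cong)
qed

lemma lamL_beta_list:
  assumes "lam \<in> partitions" "length lam \<le> k"
  shows "lamL (beta_list k lam) = lam"
proof -
  have "lamL (beta_list k lam) = filter (\<lambda>x. x > 0) (map (part lam) [0..<k])"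
    unfolding lamL_decreasing[OF sorted_beta_list[OF assms(1)]]
    by (rule arg_cong[where f = "filter _"], rule nth_equalityI) (simp_all add: beta_list_def)
  also have "\<dots> = lam"
    using assms by (auto simp: map_part partitions_def filter_id_conv intro!: gr0I)
  finally show ?thesis .
qed

lemma lamL_in_box:
  assumes s: "sorted_wrt (>) s" "s \<in> tuples {- int k .. int N - int k - 1} k" "k < N"
  shows "lamL s \<in> box k (N - k)" and "beta_list k (lamL s) = s"
proof -
  have len: "length s = k" using s by (simp add: tuples_def)
  define mu where "mu = map (\<lambda>r. nat (s ! r + int r + 1)) [0..<k]"
  \<comment> \<open>Strict decrease of integers means weak decrease of \<open>s ! r + r\<close>, so
    the bounds of the window at the first and last entry bound all parts.\<close>
  have step: "s ! j + int j \<le> s ! i + int i" if "i \<le> j" "j < k" for i j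
    using that
  proof (induction j rule: dec_induct)
    case (step n)
    then have "s ! Suc n < s ! n" using s(1) len by (simp add: sorted_wrt_iff_nth_less)
    then show ?case using step by simp
  qed simp
  have lower: "- int k \<le> s ! r" and upper: "s ! r \<le> int N - int k - 1" if "r < k" for r
    using s(2) that nth_mem[of r s] unfolding tuples_def by force+
  have nonneg: "0 \<le> s ! r + int r + 1" if "r < k" for r
    using step[of r "k - 1"] lower[of "k - 1"] that by (simp add: Suc_leI of_nat_diff) linarith
  have le: "s ! r + int r + 1 \<le> int (N - k)" if "r < k" for r
    using step[of 0 r] upper[of 0] that \<open>k < N\<close> by (simp add: of_nat_diff)
  have sorted: "sorted_wrt (\<ge>) mu"
    using step by (auto simp: mu_def sorted_wrt_iff_nth_less nat_mono)
  have lam: "lamL s = filter (\<lambda>x. x > 0) mu"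
    using lamL_decreasing[OF s(1)] len by (simp add: mu_def)
  have mu: "mu = lamL s @ replicate (k - length (lamL s)) 0"
    using sorted_desc_filter_pos[OF sorted] unfolding lam by (simp add: mu_def)
  have length: "length (lamL s) \<le> k"
    unfolding lam using length_filter_le[of _ mu] by (simp add: mu_def)
  show "lamL s \<in> box k (N - k)"
    unfolding box_def mem_Collect_eq
  proof (intro conjI ballI length)
    show "lamL s \<in> partitions"
      unfolding partitions_def lam using sorted_wrt_filter[OF sorted] by simp
    fix x assume "x \<in> set (lamL s)"
    then obtain r where "r < k" "x = nat (s ! r + int r + 1)"
      unfolding lam mu_def by auto
    then show "x \<le> N - k" using le[of r] by simp
  qed
  show "beta_list k (lamL s) = s"
  proof (rule nth_equalityI)
    fix r assume "r < length (beta_list k (lamL s))"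
    then have r: "r < k" by (simp add: beta_list_def)
    have "part (lamL s) r = mu ! r"
      using arg_cong[OF trans[OF map_part[OF length] mu[symmetric]], of "\<lambda>L. L ! r"] r by simp
    then show "beta_list k (lamL s) ! r = s ! r"
      using r nonneg[OF r] by (simp add: beta_list_def mu_def)
  qed (simp add: beta_list_def len)
qed

lemma beta_list_in_tuples:
  assumes "lam \<in> box k (N - k)" "k < N"
  shows "beta_list k lam \<in> tuples {- int k .. int N - int k - 1} k"
proof -
  have "int (part lam r) \<le> int N - int k" for r
    using assms nth_mem[of r lam] by (fastforce simp: part_def box_def)
  then have "- int k \<le> int (part lam r) - int r - 1" "int (part lam r) - int r - 1 \<le> int N - int k - 1"
    if "r < k" for r
    using that by (smt (verit) of_nat_0_le_iff zless_nat_eq_int_zless int_ops(2) of_nat_less_iff)+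
  then show ?thesis by (auto simp: tuples_def beta_list_def)
qed

lemma colprod_nth:
  "length L = length vs \<Longrightarrow> colprod vs L = (\<Prod>i<length vs. (vs ! i) (L ! i))"
proof (induction vs arbitrary: L)
  case (Cons v vs)
  then obtain l L' where "L = l # L'" "length L' = length vs" by (cases L) auto
  then show ?case using Cons.IH[of L'] by (simp add: prod.lessThan_Suc_shift del: prod.lessThan_Suc)
qed simp

text \<open>A tuple without repetition is a rearrangement of exactly one strictly decreasing tuple,
  by exactly one permutation.\<close>

lemma sum_distinct_tuples:
  fixes g :: "int list \<Rightarrow> 'b::comm_monoid_add"
  assumes "\<And>L. L \<in> tuples A k \<Longrightarrow> \<not> distinct L \<Longrightarrow> g L = 0" and "finite A"
  shows "(\<Sum>L\<in>tuples A k. g L)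
       = (\<Sum>s | s \<in> tuples A k \<and> sorted_wrt (>) s. \<Sum>\<sigma> | \<sigma> permutes {..<k}. g (permute_list \<sigma> s))"
proof -
  let ?D = "{s. s \<in> tuples A k \<and> sorted_wrt (>) s}" and ?P = "{\<sigma>. \<sigma> permutes {..<k}}"
  have sort: "s = rev (sort s)" and dist: "distinct s" if "sorted_wrt (>) s" for s :: "int list"
  proof -
    have "sort s = rev s"
      using that by (intro properties_for_sort)
        (auto simp: sorted_wrt_rev intro: sorted_wrt_mono_rel[rotated])
    then show "s = rev (sort s)" by simp
    show "distinct s" using that by (auto simp: distinct_conv_nth sorted_wrt_iff_nth_less) (metis less_irrefl linorder_neqE_nat)
  qed
  have bij: "bij_betw (\<lambda>(s, \<sigma>). permute_list \<sigma> s) (?D \<times> ?P) {L \<in> tuples A k. distinct L}"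
    unfolding bij_betw_def
  proof
    show "inj_on (\<lambda>(s, \<sigma>). permute_list \<sigma> s) (?D \<times> ?P)"
    proof (rule inj_onI, clarify)
      fix s \<sigma> s' \<sigma>'
      assume s: "s \<in> tuples A k" "sorted_wrt (>) s" and s': "s' \<in> tuples A k" "sorted_wrt (>) s'"
        and p: "\<sigma> permutes {..<k}" "\<sigma>' permutes {..<k}"
        and eq: "permute_list \<sigma> s = permute_list \<sigma>' s'"
      have "mset s = mset s'"
        using p s s' arg_cong[OF eq, of mset] by (simp add: length_tuples)
      then have "sort s = sort s'" by (intro properties_for_sort) simp_all
      then have ss: "s = s'" using sort[OF s(2)] sort[OF s'(2)] by simp
      have "\<sigma> i = \<sigma>' i" for i
      proof (cases "i < k")
        case True
        then have "s ! \<sigma> i = s ! \<sigma>' i"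
          using arg_cong[OF eq, of "\<lambda>L. L ! i"] p s ss by (simp add: permute_list_nth length_tuples)
        moreover have "\<sigma> i < k" "\<sigma>' i < k" using p True permutes_in_image by fastforce+
        ultimately show ?thesis
          using dist[OF s(2)] s(1) by (simp add: nth_eq_iff_index_eq length_tuples)
      next
        case False
        then show ?thesis using p by (simp add: permutes_not_in)
      qed
      then show "s = s' \<and> \<sigma> = \<sigma>'" using ss by auto
    qed
    show "(\<lambda>(s, \<sigma>). permute_list \<sigma> s) ` (?D \<times> ?P) = {L \<in> tuples A k. distinct L}"
    proof (intro equalityI subsetI)
      fix L assume "L \<in> (\<lambda>(s, \<sigma>). permute_list \<sigma> s) ` (?D \<times> ?P)"
      then show "L \<in> {L \<in> tuples A k. distinct L}" using dist by (auto simp: tuples_def)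
    next
      fix L assume L: "L \<in> {L \<in> tuples A k. distinct L}"
      obtain \<sigma> where \<sigma>: "\<sigma> permutes {..<length (rev (sort L))}" "permute_list \<sigma> (rev (sort L)) = L"
        using mset_eq_permutation[of L "rev (sort L)"] by auto
      moreover have "sorted_wrt (>) (rev (sort L))"
        using L by (simp add: sorted_wrt_rev strict_sorted_iff)
      ultimately show "L \<in> (\<lambda>(s, \<sigma>). permute_list \<sigma> s) ` (?D \<times> ?P)"
        using L by (intro image_eqI[of _ _ "(rev (sort L), \<sigma>)"]) (auto simp: tuples_def)
    qed
  qed
  have "(\<Sum>L\<in>tuples A k. g L) = (\<Sum>L\<in>{L \<in> tuples A k. distinct L}. g L)"
    using assms by (intro sum.mono_neutral_right) auto
  also have "\<dots> = (\<Sum>(s, \<sigma>)\<in>?D \<times> ?P. g (permute_list \<sigma> s))"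
    using sum.reindex_bij_betw[OF bij, of g] by (simp add: case_prod_beta)
  finally show ?thesis by (simp add: sum.cartesian_product)
qed

text \<open>Grouping the tuples by their decreasing rearrangement \<open>s\<close> turns the inner
  sum into the minor with rows \<open>s\<close>, which is the Jacobi-Trudi determinant of
  \<open>lamL s\<close>. The global sign comes from \<open>pit\<close> being normalised on
  increasing tuples.\<close>

lemma altform_columns:
  assumes h0: "h 0 = 1" and hneg: "\<And>l. l < 0 \<Longrightarrow> h l = 0" and "k < N"
    and A: "A = {- int k .. int N - int k - 1}"
  shows "altform \<pi> A (map (\<lambda>i l. h (l + int i)) [1..<k + 1])
     = (-1) ^ (k choose 2) * (\<Sum>lam\<in>box k (N - k). fps_const (\<pi> lam) * jacobi_trudi h lam)"
proof -
  let ?vs = "map (\<lambda>i l. h (l + int i)) [1..<k + 1]"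
  let ?g = "\<lambda>L. fps_const (pit \<pi> L) * (\<Prod>i<k. h (L ! i + int i + 1))"
  have "altform \<pi> A ?vs = (\<Sum>L\<in>tuples A k. ?g L)"
    unfolding altform_def
    by (rule sum.cong) (auto simp: colprod_nth length_tuples algebra_simps intro!: prod.cong simp del: upt_Suc)
  also have "\<dots> = (\<Sum>s | s \<in> tuples A k \<and> sorted_wrt (>) s. \<Sum>\<sigma> | \<sigma> permutes {..<k}. ?g (permute_list \<sigma> s))"
    by (rule sum_distinct_tuples) (auto simp: pit_def sgnL_def A)
  also have "\<dots> = (\<Sum>s | s \<in> tuples A k \<and> sorted_wrt (>) s.
      (-1) ^ (k choose 2) * (fps_const (\<pi> (lamL s)) * (\<Sum>\<sigma> | \<sigma> permutes {..<k}.
        of_int (sign \<sigma>) * (\<Prod>i<k. h (s ! i + int (\<sigma> i) + 1)))))"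
  proof (rule sum.cong[OF refl], clarify)
    fix s assume s: "s \<in> tuples A k" "sorted_wrt (>) s"
    have len: "length s = k" using s by (simp add: tuples_def)
    have pits: "fps_const (pit \<pi> s) = (-1) ^ (k choose 2) * fps_const (\<pi> (lamL s))"
      using sgnL_decreasing[OF s(2)] len
      by (cases "even (k choose 2)") (simp_all add: pit_def)
    have "(\<Sum>\<sigma> | \<sigma> permutes {..<k}. ?g (permute_list \<sigma> s))
      = (\<Sum>\<sigma> | \<sigma> permutes {..<k}. fps_const (pit \<pi> s) * (of_int (sign \<sigma>) * (\<Prod>i<k. h (s ! \<sigma> i + int i + 1))))"
    proof (rule sum.cong[OF refl], clarify)
      fix \<sigma> assume \<sigma>: "\<sigma> permutes {..<k}"
      have "fps_const (pit \<pi> (permute_list \<sigma> s)) = of_int (sign \<sigma>) * fps_const (pit \<pi> s)"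
        using \<sigma> len fps_const_mult[of "of_int (sign \<sigma>)" "pit \<pi> s"]
        by (simp add: pit_permute fps_of_int del: fps_const_mult)
      moreover have "(\<Prod>i<k. h (permute_list \<sigma> s ! i + int i + 1)) = (\<Prod>i<k. h (s ! \<sigma> i + int i + 1))"
        using \<sigma> len by (intro prod.cong) (simp_all add: permute_list_nth)
      ultimately show "?g (permute_list \<sigma> s)
          = fps_const (pit \<pi> s) * (of_int (sign \<sigma>) * (\<Prod>i<k. h (s ! \<sigma> i + int i + 1)))"
        by (simp add: mult_ac)
    qed
    also have "\<dots> = fps_const (pit \<pi> s) * (\<Sum>\<sigma> | \<sigma> permutes {..<k}.
        of_int (sign \<sigma>) * (\<Prod>i<k. h (s ! \<sigma> i + int i + 1)))"
      by (simp add: sum_distrib_left)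
    \<comment> \<open>Passing to inverse permutations transposes the determinant: the product over
      columns becomes a product over rows.\<close>
    also have "(\<Sum>\<sigma> | \<sigma> permutes {..<k}. of_int (sign \<sigma>) * (\<Prod>i<k. h (s ! \<sigma> i + int i + 1)))
      = (\<Sum>\<sigma> | \<sigma> permutes {..<k}. of_int (sign (inv \<sigma>)) * (\<Prod>i<k. h (s ! inv \<sigma> i + int i + 1)))"
      by (rule sum_permutations_inverse)
    also have "\<dots> = (\<Sum>\<sigma> | \<sigma> permutes {..<k}. of_int (sign \<sigma>) * (\<Prod>i<k. h (s ! i + int (\<sigma> i) + 1)))"
    proof (rule sum.cong[OF refl], clarify)
      fix \<sigma> assume \<sigma>: "\<sigma> permutes {..<k}"
      have "(\<Prod>i<k. h (s ! inv \<sigma> i + int i + 1)) = (\<Prod>i<k. h (s ! i + int (\<sigma> i) + 1))"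
        using prod.permute[OF \<sigma>, of "\<lambda>i. h (s ! inv \<sigma> i + int i + 1)"] permutes_inverses(2)[OF \<sigma>]
        by (simp add: o_def)
      moreover have "sign (inv \<sigma>) = sign \<sigma>"
        using \<sigma> by (intro sign_inverse) (auto simp: permutation_permutes)
      ultimately show "of_int (sign (inv \<sigma>)) * (\<Prod>i<k. h (s ! inv \<sigma> i + int i + 1))
          = of_int (sign \<sigma>) * (\<Prod>i<k. h (s ! i + int (\<sigma> i) + 1))" by simp
    qed
    finally show "(\<Sum>\<sigma> | \<sigma> permutes {..<k}. ?g (permute_list \<sigma> s)) = (-1) ^ (k choose 2) *
        (fps_const (\<pi> (lamL s)) * (\<Sum>\<sigma> | \<sigma> permutes {..<k}.
          of_int (sign \<sigma>) * (\<Prod>i<k. h (s ! i + int (\<sigma> i) + 1))))"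
      unfolding pits by (simp only: mult.assoc)
  qed
  also have "\<dots> = (\<Sum>lam\<in>box k (N - k).
      (-1) ^ (k choose 2) * (fps_const (\<pi> lam) * jacobi_trudi h lam))"
  proof (rule sum.reindex_bij_witness[of _ "beta_list k" lamL])
    fix s assume "s \<in> {s. s \<in> tuples A k \<and> sorted_wrt (>) s}"
    then have s: "s \<in> tuples {- int k .. int N - int k - 1} k" "sorted_wrt (>) s" by (auto simp: A)
    note box = lamL_in_box[OF s(2,1) \<open>k < N\<close>]
    show "beta_list k (lamL s) = s" "lamL s \<in> box k (N - k)" by (rule box)+
    have "jacobi_trudi h (lamL s) = (\<Sum>\<sigma> | \<sigma> permutes {0..<k}.
        of_int (sign \<sigma>) * (\<Prod>i<k. h (int (part (lamL s) i) - int i + int (\<sigma> i))))"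
      using box(1) by (intro jacobi_trudi_pad[symmetric] h0 hneg) (auto simp: box_def)
    also have "\<dots> = (\<Sum>\<sigma> | \<sigma> permutes {..<k}.
        of_int (sign \<sigma>) * (\<Prod>i<k. h (s ! i + int (\<sigma> i) + 1)))"
    proof (intro sum.cong prod.cong arg_cong2[where f = "(*)"] refl)
      fix \<sigma> i assume "i \<in> {..<k}"
      then have "s ! i = int (part (lamL s) i) - int i - 1"
        using arg_cong[OF box(2), of "\<lambda>L. L ! i"] by (simp add: beta_list_def)
      then show "h (int (part (lamL s) i) - int i + int (\<sigma> i)) = h (s ! i + int (\<sigma> i) + 1)"
        by (intro arg_cong[where f = h]) simp
    qed (simp add: atLeast0LessThan)
    finally show "(-1) ^ (k choose 2) * (fps_const (\<pi> (lamL s)) * jacobi_trudi h (lamL s))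
      = (-1) ^ (k choose 2) * (fps_const (\<pi> (lamL s)) * (\<Sum>\<sigma> | \<sigma> permutes {..<k}.
        of_int (sign \<sigma>) * (\<Prod>i<k. h (s ! i + int (\<sigma> i) + 1))))" by simp
  next
    fix lam assume "lam \<in> box k (N - k)"
    then show "lamL (beta_list k lam) = lam" "beta_list k lam \<in> {s. s \<in> tuples A k \<and> sorted_wrt (>) s}"
      using lamL_beta_list sorted_beta_list beta_list_in_tuples[OF _ \<open>k < N\<close>]
      by (auto simp: A box_def)
  qed
  finally show ?thesis by (simp add: sum_distrib_left)
qed

section \<open>Homogeneous components of tau and the Fay identity\<close>

definition tau_fps :: "(nat list \<Rightarrow> complex) \<Rightarrow> (int \<Rightarrow> complex) \<Rightarrow> complex fps" where
  "tau_fps \<pi> h = Abs_fps (\<lambda>d. \<Sum>lam | lam \<in> partitions \<and> sum_list lam = d. \<pi> lam * jacobi_trudi h lam)"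

text \<open>The power of u records the weight of h_l. For negative l the exponent is cut to 0, which
  does no harm for an \<open>h\<close> that vanishes there.\<close>

definition graded :: "(int \<Rightarrow> complex) \<Rightarrow> int \<Rightarrow> complex fps" where
  "graded h l = fps_const (h l) * fps_X ^ nat l"

lemma jacobi_trudi_degree:
  assumes "\<sigma> permutes {0..<length lam}"
  shows "(\<Sum>i<length lam. int (lam ! i) - int i + int (\<sigma> i)) = int (sum_list lam)"
proof -
  have "(\<Sum>i<length lam. int (\<sigma> i)) = (\<Sum>i<length lam. int i)"
    using sum.permute[of \<sigma> "{..<length lam}" int] assms by (simp add: atLeast0LessThan o_def)
  then show ?thesis by (simp add: sum.distrib sum_subtractf sum_list_sum_nth atLeast0LessThan)
qed

lemma fps_const_prod: "(\<Prod>i\<in>I. fps_const (f i)) = fps_const (\<Prod>i\<in>I. f i :: 'a::comm_ring_1)"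
  by (induction I rule: infinite_finite_induct) (simp_all flip: fps_const_mult)

text \<open>In each nonzero term of the determinant the indices add up to the size of the partition,
  so one power of u factors out.\<close>

lemma jacobi_trudi_graded:
  assumes hneg: "\<And>l. l < 0 \<Longrightarrow> h l = 0"
  shows "jacobi_trudi (graded h) lam = fps_const (jacobi_trudi h lam) * fps_X ^ sum_list lam"
proof -
  let ?e = "\<lambda>\<sigma> i. int (lam ! i) - int i + int (\<sigma> i)"
  have "(\<Prod>i<length lam. graded h (?e \<sigma> i)) = fps_const (\<Prod>i<length lam. h (?e \<sigma> i)) * fps_X ^ sum_list lam"
    if \<sigma>: "\<sigma> permutes {0..<length lam}" for \<sigma>
  proof (cases "\<forall>i<length lam. 0 \<le> ?e \<sigma> i")
    case True
    have "int (\<Sum>i<length lam. nat (?e \<sigma> i)) = (\<Sum>i<length lam. ?e \<sigma> i)"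
      unfolding of_nat_sum using True by (intro sum.cong) auto
    then have "(\<Sum>i<length lam. nat (?e \<sigma> i)) = sum_list lam"
      using jacobi_trudi_degree[OF \<sigma>] by linarith
    then show ?thesis
      by (simp add: graded_def prod.distrib fps_const_prod flip: power_sum)
  next
    case False
    \<comment> \<open>Some index is negative. Then \<open>nat\<close> would spoil the count of
      exponents, but both products contain a zero factor.\<close>
    then obtain i where i: "i < length lam" "h (?e \<sigma> i) = 0" using hneg by force
    have "(\<Prod>i<length lam. graded h (?e \<sigma> i)) = 0"
      using i by (intro prod_zero bexI[of _ i]) (simp_all add: graded_def)
    moreover have "(\<Prod>i<length lam. h (?e \<sigma> i)) = 0"
      using i by (intro prod_zero bexI[of _ i]) simp_all
    ultimately show ?thesis by (simp only: fps_const_0_eq_0 mult_zero_left)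
  qed
  then have "jacobi_trudi (graded h) lam = (\<Sum>\<sigma> | \<sigma> permutes {0..<length lam}.
     fps_const (of_int (sign \<sigma>) * (\<Prod>i<length lam. h (?e \<sigma> i))) * fps_X ^ sum_list lam)"
    unfolding jacobi_trudi_def
    by (intro sum.cong) (simp_all add: fps_of_int mult.assoc flip: fps_const_mult)
  also have "\<dots> = fps_const (jacobi_trudi h lam) * fps_X ^ sum_list lam"
    by (simp add: jacobi_trudi_def fps_const_sum flip: sum_distrib_right)
  finally show ?thesis .
qed

lemma sum_list_ge_length: "0 \<notin> set lam \<Longrightarrow> length lam \<le> sum_list (lam :: nat list)"
  by (induction lam) (auto simp: Suc_le_eq)

text \<open>A partition of d has at most d parts, each at most d, so the box misses none of
  them.\<close>

lemma box_sum_nth: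
  assumes hneg: "\<And>l. l < 0 \<Longrightarrow> h l = 0" and "d \<le> k" "d \<le> M"
  shows "fps_nth (\<Sum>lam\<in>box k M. fps_const (\<pi> lam) * jacobi_trudi (graded h) lam) d = fps_nth (tau_fps \<pi> h) d"
proof -
  have "fps_nth (\<Sum>lam\<in>box k M. fps_const (\<pi> lam) * jacobi_trudi (graded h) lam) d
     = (\<Sum>lam\<in>box k M. if sum_list lam = d then \<pi> lam * jacobi_trudi h lam else 0)"
    unfolding fps_sum_nth
    by (intro sum.cong) (simp_all add: jacobi_trudi_graded[OF hneg])
  also have "\<dots> = (\<Sum>lam\<in>box k M \<inter> {lam. sum_list lam = d}. \<pi> lam * jacobi_trudi h lam)"
    by (simp add: sum.inter_restrict)
  also have "box k M \<inter> {lam. sum_list lam = d} = {lam. lam \<in> partitions \<and> sum_list lam = d}"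
    using assms(2,3) sum_list_ge_length member_le_sum_list
    by (fastforce simp: box_def partitions_def)
  finally show ?thesis by (simp add: tau_fps_def)
qed

text \<open>Here \<open>h Z\<close> abstracts the complete homogeneous functions after inserting the
  points of \<open>Z\<close>; a multiset is used because the order of insertion must not matter.
  Each coefficient of u is compared in a window adapted to it.\<close>

lemma tau_fps_three_term:
  fixes h :: "complex multiset \<Rightarrow> int \<Rightarrow> complex"
  assumes "plucker \<pi>" and h0: "\<And>Z. h Z 0 = 1" and hneg: "\<And>Z l. l < 0 \<Longrightarrow> h Z l = 0"
    and hstep: "\<And>Z z l. h Z l = h (add_mset z Z) l - z * h (add_mset z Z) (l - 1)"
  defines "y \<equiv> \<lambda>z. fps_const z * fps_X"
  shows "(y a - y b) * (y c - y d) * tau_fps \<pi> (h {#a, b#}) * tau_fps \<pi> (h {#c, d#})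
       - (y a - y c) * (y b - y d) * tau_fps \<pi> (h {#a, c#}) * tau_fps \<pi> (h {#b, d#})
       + (y a - y d) * (y b - y c) * tau_fps \<pi> (h {#a, d#}) * tau_fps \<pi> (h {#b, c#}) = 0"
    (is "?F (\<lambda>Z. tau_fps \<pi> (h Z)) = 0")
proof (rule fps_ext)
  fix D :: nat
  \<comment> \<open>\<open>k = D + 2\<close> leaves D columns beside the two inserted ones. Also
    \<open>N - k = D + 2\<close>, so the box contains every partition of size at most D.\<close>
  define k N where "k = D + 2" and "N = 2 * D + 4"
  define A where "A = {- int k .. int N - int k - 1}"
  define S :: "complex multiset \<Rightarrow> complex fps" where "S = (\<lambda>Z. \<Sum>lam\<in>box k (N - k). fps_const (\<pi> lam) * jacobi_trudi (graded (h Z)) lam)"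
  define W where "W = (\<lambda>z l. graded (h {#z#}) (l + 2))"
  define cs where "cs = map (\<lambda>i l. graded (h {#}) (l + int i)) [3..<D + 3]"
  have gstep: "graded (h Z) l = graded (h (add_mset z Z)) l - y z * graded (h (add_mset z Z)) (l - 1)" for Z z l
  proof (cases "l \<ge> 1")
    case True
    then have "nat l = Suc (nat (l - 1))" by simp
    have c: "fps_const (h Z l)
        = fps_const (h (add_mset z Z) l) - fps_const z * fps_const (h (add_mset z Z) (l - 1))"
      by (subst hstep[of Z l z]) simp
    show ?thesis
      unfolding graded_def y_def \<open>nat l = Suc (nat (l - 1))\<close> power_Suc c
      by (simp only: left_diff_distrib right_diff_distrib mult_ac)
  next
    case False
    \<comment> \<open>For l below 1 the cut-off in \<open>nat\<close> makes all exponents 0; the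
      only term that this would spoil has a negative index.\<close>
    then have "h (add_mset z Z) (l - 1) = 0" "h Z l = h (add_mset z Z) l"
      using hneg hstep[of Z l z] by simp_all
    then show ?thesis by (simp add: graded_def)
  qed
  have g0: "graded (h Z) 0 = 1" for Z by (simp add: graded_def h0)
  have gneg: "graded (h Z) l = 0" if "l < 0" for Z l using that by (simp add: graded_def hneg)
  have pair: "altform \<pi> A (W p # W q # cs) = (-1) ^ (k choose 2) * ((y p - y q) * S {#p, q#})" for p q
  proof -
    have "altform \<pi> A (W p # W q # cs)
      = (y p - y q) * altform \<pi> A (map (\<lambda>i l. graded (h {#p, q#}) (l + int i)) [1..<D + 3])"
      unfolding W_def cs_def
    proof (rule altform_insert_two)
      fix l
      show "graded (h {#p#}) l = graded (h {#p, q#}) l - y q * graded (h {#p, q#}) (l - 1)"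
        using gstep[of "{#p#}" l q] by (simp add: add_mset_commute)
      show "graded (h {#q#}) l = graded (h {#p, q#}) l - y p * graded (h {#p, q#}) (l - 1)"
        by (rule gstep)
      show "graded (h {#}) l = graded (h {#p#}) l - y p * graded (h {#p#}) (l - 1)"
        by (rule gstep)
    qed
    also have "altform \<pi> A (map (\<lambda>i l. graded (h {#p, q#}) (l + int i)) [1..<D + 3]) = (-1) ^ (k choose 2) * S {#p, q#}"
    proof -
      have "k < N" "k + 1 = D + 3" by (simp_all add: k_def N_def)
      then show ?thesis
        using altform_columns[of "graded (h {#p, q#})" k N A \<pi>, OF g0 gneg _ A_def]
        by (simp only: S_def)
    qed
    finally show ?thesis by (simp only: mult_ac)
  qed
  \<comment> \<open>The sign from \<open>altform_columns\<close> occurs twice in every product of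
    two forms.\<close>
  have sq: "(-1) ^ n * (-1) ^ n = (1 :: complex fps)" for n
    by (simp flip: power_mult_distrib)
  have prod: "altform \<pi> A (W p # W q # cs) * altform \<pi> A (W p' # W q' # cs)
     = (y p - y q) * (y p' - y q') * S {#p, q#} * S {#p', q'#}" for p q p' q'
  proof -
    have "altform \<pi> A (W p # W q # cs) * altform \<pi> A (W p' # W q' # cs)
     = ((-1) ^ (k choose 2) * (-1) ^ (k choose 2)) * ((y p - y q) * (y p' - y q') * S {#p, q#} * S {#p', q'#})"
      unfolding pair by (simp only: mult_ac)
    then show ?thesis unfolding sq by simp
  qed
  have "?F S = 0"
    unfolding prod[symmetric]
    by (rule altform_three_term[where m = D and N = N])
       (use assms(1) in \<open>simp_all add: A_def k_def N_def cs_def\<close>)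
  \<comment> \<open>The coefficient of u^D in a product involves only coefficients up to D, where
    the box sum and tau coincide.\<close>
  moreover have agree: "fps_nth (u * tau_fps \<pi> (h Z) * tau_fps \<pi> (h Z')) D = fps_nth (u * S Z * S Z') D" for u Z Z'
  proof -
    have "fps_nth (tau_fps \<pi> (h Z)) i = fps_nth (S Z) i" if "i \<le> D" for i Z
      unfolding S_def using that by (intro box_sum_nth[symmetric] hneg) (auto simp: k_def N_def)
    then show ?thesis by (auto simp: fps_mult_nth intro!: sum.cong)
  qed
  ultimately show "fps_nth (?F (\<lambda>Z. tau_fps \<pi> (h Z))) D = fps_nth 0 D"
    by (metis (no_types, lifting) agree fps_add_nth fps_sub_nth)
qed

section \<open>Evaluation of polynomials and power series\<close>

definition monev :: "(var \<Rightarrow> complex) \<Rightarrow> mono \<Rightarrow> complex" where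
  "monev q m = (\<Prod>v\<in>Poly_Mapping.keys m. q v ^ Poly_Mapping.lookup m v)"

definition peval :: "(var \<Rightarrow> complex) \<Rightarrow> (mono \<Rightarrow>\<^sub>0 complex) \<Rightarrow> complex" where
  "peval q p = (\<Sum>m\<in>Poly_Mapping.keys p. Poly_Mapping.lookup p m * monev q m)"

lemma keys_plus_nat: "Poly_Mapping.keys (a + b :: mono) = Poly_Mapping.keys a \<union> Poly_Mapping.keys b"
  by (auto simp: in_keys_iff lookup_add)

lemma monev_superset:
  "finite V \<Longrightarrow> Poly_Mapping.keys m \<subseteq> V \<Longrightarrow> monev q m = (\<Prod>v\<in>V. q v ^ Poly_Mapping.lookup m v)"
  unfolding monev_def by (rule prod.mono_neutral_left) (auto simp: in_keys_iff)

lemma monev_0 [simp]: "monev q 0 = 1"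
  by (simp add: monev_def)

lemma monev_add: "monev q (a + b) = monev q a * monev q b"
  by (simp add: monev_superset[of "Poly_Mapping.keys a \<union> Poly_Mapping.keys b"] keys_plus_nat
      lookup_add power_add prod.distrib)

lemma wdeg_superset:
  "finite V \<Longrightarrow> Poly_Mapping.keys m \<subseteq> V \<Longrightarrow> wdeg m = (\<Sum>v\<in>V. Poly_Mapping.lookup m v * weight v)"
  unfolding wdeg_def by (rule sum.mono_neutral_left) (auto simp: in_keys_iff)

lemma wdeg_0 [simp]: "wdeg 0 = 0"
  by (simp add: wdeg_def)

lemma wdeg_add: "wdeg (a + b) = wdeg a + wdeg b"
  by (simp add: wdeg_superset[of "Poly_Mapping.keys a \<union> Poly_Mapping.keys b"] keys_plus_nat
      lookup_add sum.distrib algebra_simps)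

lemma poly_sum_single:
  fixes p :: "mono \<Rightarrow>\<^sub>0 complex"
  shows "p = (\<Sum>m\<in>Poly_Mapping.keys p. Poly_Mapping.single m (Poly_Mapping.lookup p m))"
proof (rule poly_mapping_eqI)
  fix k
  have "(\<Sum>m\<in>Poly_Mapping.keys p. Poly_Mapping.lookup p m when m = k) = Poly_Mapping.lookup p k"
    by (cases "k \<in> Poly_Mapping.keys p") (auto simp: when_def sum.delta in_keys_iff)
  then show "Poly_Mapping.lookup p k
      = Poly_Mapping.lookup (\<Sum>m\<in>Poly_Mapping.keys p. Poly_Mapping.single m (Poly_Mapping.lookup p m)) k"
    by (simp add: lookup_sum lookup_single)
qed

text \<open>Additivity reduces multiplicativity to single terms. It serves both the evaluation in
  complex numbers and the one in power series.\<close>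

lemma poly_mult_hom:
  fixes \<phi> :: "(mono \<Rightarrow>\<^sub>0 complex) \<Rightarrow> 'r::comm_ring_1"
  assumes zero: "\<phi> 0 = 0" and add: "\<And>p r. \<phi> (p + r) = \<phi> p + \<phi> r"
    and single: "\<And>a b x y. \<phi> (Poly_Mapping.single (a + b) (x * y))
       = \<phi> (Poly_Mapping.single a x) * \<phi> (Poly_Mapping.single b y)"
  shows "\<phi> (p * r) = \<phi> p * \<phi> r"
proof -
  have sum_hom: "\<phi> (sum g I) = (\<Sum>i\<in>I. \<phi> (g i))" for g and I :: "mono set"
    by (induction I rule: infinite_finite_induct) (simp_all add: zero add)
  let ?s = "\<lambda>p m. Poly_Mapping.single m (Poly_Mapping.lookup p m) :: mono \<Rightarrow>\<^sub>0 complex"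
  have "p * r = (\<Sum>m\<in>Poly_Mapping.keys p. ?s p m) * (\<Sum>m\<in>Poly_Mapping.keys r. ?s r m)"
    by (metis poly_sum_single)
  also have "\<dots> = (\<Sum>m\<in>Poly_Mapping.keys p. \<Sum>m'\<in>Poly_Mapping.keys r. ?s p m * ?s r m')"
    by (simp add: sum_product)
  finally have "\<phi> (p * r) = (\<Sum>m\<in>Poly_Mapping.keys p. \<Sum>m'\<in>Poly_Mapping.keys r. \<phi> (?s p m) * \<phi> (?s r m'))"
    by (simp add: sum_hom mult_single single)
  also have "\<dots> = \<phi> (\<Sum>m\<in>Poly_Mapping.keys p. ?s p m) * \<phi> (\<Sum>m\<in>Poly_Mapping.keys r. ?s r m)"
    by (simp add: sum_product sum_hom)
  also have "\<dots> = \<phi> p * \<phi> r"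
    by (metis poly_sum_single)
  finally show ?thesis .
qed

lemma peval_superset:
  "finite M \<Longrightarrow> Poly_Mapping.keys p \<subseteq> M \<Longrightarrow> peval q p = (\<Sum>m\<in>M. Poly_Mapping.lookup p m * monev q m)"
  unfolding peval_def by (rule sum.mono_neutral_left) (auto simp: in_keys_iff)

lemma peval_0 [simp]: "peval q 0 = 0"
  by (simp add: peval_def)

lemma peval_add [simp]: "peval q (p + r) = peval q p + peval q r"
  using keys_add[of p r]
  by (simp add: peval_superset[of "Poly_Mapping.keys p \<union> Poly_Mapping.keys r"] lookup_add
      sum.distrib algebra_simps)

lemma peval_single [simp]: "peval q (Poly_Mapping.single m x) = x * monev q m"
  by (cases "x = 0") (simp_all add: peval_def)

lemma peval_mult [simp]: "peval q (p * r) = peval q p * peval q r"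
  by (rule poly_mult_hom) (simp_all add: monev_add)

lemma peval_1 [simp]: "peval q 1 = 1"
  using peval_single[of q 0 1] by (simp del: peval_single)

lemma peval_of_int [simp]: "peval q (of_int n) = of_int n"
  using peval_single[of q 0 "of_int n"] by (simp del: peval_single)

lemma peval_power [simp]: "peval q (p ^ n) = peval q p ^ n"
  by (induction n) simp_all

lemma peval_sum [simp]: "peval q (sum g I) = (\<Sum>i\<in>I. peval q (g i))"
  by (induction I rule: infinite_finite_induct) simp_all

lemma peval_prod [simp]: "peval q (prod g I) = (\<Prod>i\<in>I. peval q (g i))"
  by (induction I rule: infinite_finite_induct) simp_all

lemma peval_pconst [simp]: "peval q (pconst c) = c"
  by (simp add: pconst_def)

lemma peval_pvar [simp]: "peval q (pvar v) = q v"
  by (simp add: pvar_def monev_def)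

lemma peval_jacobi_trudi: "peval q (jacobi_trudi h lam) = jacobi_trudi (\<lambda>l. peval q (h l)) lam"
  by (simp add: jacobi_trudi_def)

lemma schur_jacobi_trudi: "schur lam = jacobi_trudi hpoly lam"
  by (simp add: schur_def det_def jacobi_trudi_def)

lemma psubst_pmonom:
  "psubst \<sigma> (pmonom m) = (\<Prod>v\<in>Poly_Mapping.keys m. \<sigma> v ^ Poly_Mapping.lookup m v)"
proof -
  have "pconst 1 = 1" by (simp add: pconst_def)
  then show ?thesis by (simp add: psubst_def pmonom_def)
qed

section \<open>Weighted homogeneity of Schur functions and of shifted times\<close>

definition homog :: "var set \<Rightarrow> nat \<Rightarrow> (mono \<Rightarrow>\<^sub>0 complex) \<Rightarrow> bool" where
  "homog V d p \<longleftrightarrow> (\<forall>m\<in>Poly_Mapping.keys p. Poly_Mapping.keys m \<subseteq> V \<and> wdeg m = d)"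

lemma homog_0 [simp]: "homog V d 0"
  by (simp add: homog_def)

lemma homog_1 [simp]: "homog V 0 1"
  by (simp add: homog_def)

lemma homog_mult: "homog V d p \<Longrightarrow> homog V e r \<Longrightarrow> homog V (d + e) (p * r)"
  using keys_mult[of p r] by (fastforce simp: homog_def keys_plus_nat wdeg_add)

lemma homog_add: "homog V d p \<Longrightarrow> homog V d r \<Longrightarrow> homog V d (p + r)"
  using keys_add[of p r] by (auto simp: homog_def)

lemma homog_sum: "(\<And>i. i \<in> I \<Longrightarrow> homog V d (g i)) \<Longrightarrow> homog V d (sum g I)"
  by (induction I rule: infinite_finite_induct) (auto intro: homog_add)

lemma homog_power: "homog V d p \<Longrightarrow> homog V (d * n) (p ^ n)"
  by (induction n) (auto intro: homog_mult)

lemma homog_prod: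
  "finite I \<Longrightarrow> (\<And>i. i \<in> I \<Longrightarrow> homog V (d i) (g i)) \<Longrightarrow> homog V (sum d I) (prod g I)"
  by (induction I rule: finite_induct) (auto intro: homog_mult)

lemma homog_single:
  "Poly_Mapping.keys m \<subseteq> V \<Longrightarrow> wdeg m = d \<Longrightarrow> homog V d (Poly_Mapping.single m x)"
  by (simp add: homog_def)

lemma homog_of_int: "homog V 0 (of_int n)"
  using homog_single[of 0 V 0 "of_int n"] by simp

lemma homog_hpoly: "homog Tvars (nat l) (hpoly l)"
  by (auto simp: hpoly_def intro!: homog_sum homog_single)

lemma homog_schur: "homog Tvars (sum_list lam) (schur lam)"
proof -
  let ?e = "\<lambda>\<sigma> i. int (lam ! i) - int i + int (\<sigma> i)"
  have "homog Tvars (0 + sum_list lam) (of_int (sign \<sigma>) * (\<Prod>i<length lam. hpoly (?e \<sigma> i)))"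
    if \<sigma>: "\<sigma> permutes {0..<length lam}" for \<sigma>
  proof (cases "\<forall>i<length lam. 0 \<le> ?e \<sigma> i")
    case True
    have "int (\<Sum>i<length lam. nat (?e \<sigma> i)) = (\<Sum>i<length lam. ?e \<sigma> i)"
      unfolding of_nat_sum using True by (intro sum.cong) auto
    then have "sum_list lam = (\<Sum>i<length lam. nat (?e \<sigma> i))"
      using jacobi_trudi_degree[OF \<sigma>] by linarith
    then show ?thesis
      by (simp only:) (intro homog_mult homog_prod homog_of_int homog_hpoly finite_lessThan)
  next
    case False
    then obtain i where i: "i < length lam" "hpoly (?e \<sigma> i) = 0" by (auto simp: hpoly_def not_le)
    have "(\<Prod>i<length lam. hpoly (?e \<sigma> i)) = 0"
      using i by (intro prod_zero bexI[of _ i]) simp_all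
    then show ?thesis by (simp only: mult_zero_right homog_0)
  qed
  then show ?thesis unfolding schur_jacobi_trudi jacobi_trudi_def by (auto intro: homog_sum)
qed

lemma homog_shift:
  assumes "{i. n i \<noteq> 0} \<subseteq> F" "1 \<le> j"
  shows "homog (X ` F \<union> Tvars) j (shift n (T j))"
proof -
  have T: "homog (X ` F \<union> Tvars) j (pvar (T j))"
    using assms(2) by (auto simp: pvar_def homog_def Tvars_def wdeg_def)
  have Xi: "homog (X ` F \<union> Tvars) 1 (pvar (X i))" if "n i \<noteq> 0" for i
    using that assms(1) by (auto simp: pvar_def homog_def wdeg_def)
  have "homog (X ` F \<union> Tvars) (0 + 1 * j) (pconst c * pvar (X i) ^ j)" if "n i \<noteq> 0" for c i
    unfolding pconst_def by (intro homog_mult homog_power Xi homog_single that) simp_all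
  then show ?thesis by (auto simp: shift_def intro!: homog_add homog_sum T)
qed

lemma homog_psubst_shift:
  assumes "{i. n i \<noteq> 0} \<subseteq> F" "Poly_Mapping.keys m \<subseteq> Tvars"
  shows "homog (X ` F \<union> Tvars) (wdeg m) (psubst (shift n) (pmonom m))"
proof -
  have "wdeg m = (\<Sum>v\<in>Poly_Mapping.keys m. weight v * Poly_Mapping.lookup m v)"
    by (simp add: wdeg_def mult.commute)
  moreover have "homog (X ` F \<union> Tvars) (weight v * Poly_Mapping.lookup m v) (shift n v ^ Poly_Mapping.lookup m v)"
    if "v \<in> Poly_Mapping.keys m" for v
    using that assms homog_shift[of n F] by (auto simp: Tvars_def intro!: homog_power)
  ultimately show ?thesis unfolding psubst_pmonom by (auto intro: homog_prod)
qed

text \<open>\<^const>\<open>weight\<close> vanishes on \<open>T 0\<close>; giving this unused variable weight one makes every graded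
  piece involve finitely many monomials.\<close>

definition slice :: "int set \<Rightarrow> nat \<Rightarrow> mono set" where
  "slice F d = {m. Poly_Mapping.keys m \<subseteq> X ` F \<union> range T \<and> wdeg m + Poly_Mapping.lookup m (T 0) = d}"

text \<open>Every variable now counts with weight at least 1, so the total d bounds both the
  exponents and the indices of the t's, while the x's are confined to \<open>F\<close>.\<close>

lemma finite_slice [simp]:
  assumes "finite F"
  shows "finite (slice F d)"
proof -
  define V where "V = X ` F \<union> T ` {..d}"
  have V: "finite V" using assms by (simp add: V_def)
  have bound: "Poly_Mapping.lookup m v \<le> d \<and> (v \<in> Poly_Mapping.keys m \<longrightarrow> v \<in> V)" if "m \<in> slice F d" for m v
  proof (cases "v \<in> Poly_Mapping.keys m")
    case True
    have w: "Poly_Mapping.lookup m v * weight v \<le> wdeg m"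
      unfolding wdeg_def using True by (intro member_le_sum) auto
    have d: "wdeg m + Poly_Mapping.lookup m (T 0) = d" using that by (simp add: slice_def)
    have pos: "Poly_Mapping.lookup m v \<ge> 1" using True by (simp add: in_keys_iff Suc_le_eq)
    show ?thesis
    proof (cases v)
      case (X i)
      then show ?thesis using that True w d by (auto simp: slice_def V_def)
    next
      case (T j)
      show ?thesis
      proof (cases j)
        case 0
        then show ?thesis using T d by (simp add: V_def)
      next
        case (Suc j')
        have "Poly_Mapping.lookup m v \<le> Poly_Mapping.lookup m v * j" "j \<le> Poly_Mapping.lookup m v * j"
          using mult_le_mono1[OF pos, of j] Suc by simp_all
        moreover have "Poly_Mapping.lookup m v * j \<le> d" using T w d by simp
        ultimately have "Poly_Mapping.lookup m v \<le> d" "j \<le> d" by linarith+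
        then show ?thesis using T by (simp add: V_def)
      qed
    qed
  qed (simp add: in_keys_iff)
  have "inj_on Poly_Mapping.lookup (slice F d)"
    by (auto intro!: inj_onI poly_mapping_eqI)
  moreover have "Poly_Mapping.lookup ` slice F d
      \<subseteq> {f. \<forall>v. (v \<in> V \<longrightarrow> f v \<in> {..d}) \<and> (v \<notin> V \<longrightarrow> f v = 0)}"
    using bound by (auto simp: in_keys_iff)
  then have "finite (Poly_Mapping.lookup ` slice F d)"
    by (rule finite_subset) (intro finite_set_of_finite_funs V finite_atMost)
  ultimately show ?thesis using finite_imageD by blast
qed

text \<open>The substitution x_i = q(X i) u for i in \<open>F\<close>, x_i = 0 for other i, t_j =
  q(T j) u^j for positive j, collected by powers of u. It requires no convergence, since each
  coefficient is a finite sum when \<open>F\<close> is finite.\<close>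

definition ser_eval :: "int set \<Rightarrow> (var \<Rightarrow> complex) \<Rightarrow> ser \<Rightarrow> complex fps" where
  "ser_eval F q f = Abs_fps (\<lambda>d. \<Sum>m\<in>slice F d. f m * monev q m)"

lemma ser_eval_add: "ser_eval F q (ser_add f g) = ser_eval F q f + ser_eval F q g"
  by (rule fps_ext) (simp add: ser_eval_def ser_add_def sum.distrib algebra_simps)

lemma ser_eval_neg: "ser_eval F q (ser_neg f) = - ser_eval F q f"
  by (rule fps_ext) (simp add: ser_eval_def ser_neg_def sum_negf)

lemma slice_add_iff:
  "a + b \<in> slice F d \<longleftrightarrow> (\<exists>i\<le>d. a \<in> slice F i \<and> b \<in> slice F (d - i))"
  by (auto simp: slice_def keys_plus_nat wdeg_add lookup_add) 

text \<open>Both factors use only variables of m and have at most its degree, so they lie in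
  finitely many finite slices.\<close>

lemma finite_splits: "finite {(a, b). a + b = (m :: mono)}"
proof -
  obtain F where F: "finite F" "Poly_Mapping.keys m \<subseteq> X ` F \<union> range T"
  proof
    show "finite (X -` Poly_Mapping.keys m)"
      by (intro finite_vimageI) (auto simp: inj_def)
    show "Poly_Mapping.keys m \<subseteq> X ` (X -` Poly_Mapping.keys m) \<union> range T"
    proof
      fix v assume "v \<in> Poly_Mapping.keys m"
      then show "v \<in> X ` (X -` Poly_Mapping.keys m) \<union> range T" by (cases v) auto
    qed
  qed
  define d where "d = wdeg m + Poly_Mapping.lookup m (T 0)"
  have m: "m \<in> slice F d" using F by (simp add: slice_def d_def)
  have "{(a, b). a + b = m} \<subseteq> (\<Union>i\<le>d. slice F i) \<times> (\<Union>i\<le>d. slice F i)"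
    using m slice_add_iff by force
  then show ?thesis by (rule finite_subset) (use F in auto)
qed

text \<open>A pair of factors determines both their product and the degree of the first factor, so
  the double sum can be organised by either.\<close>

lemma ser_eval_mult:
  assumes F: "finite F"
  shows "ser_eval F q (ser_mult f g) = ser_eval F q f * ser_eval F q g"
proof (rule fps_ext)
  fix d
  let ?t = "\<lambda>(a, b). (f a * monev q a) * (g b * monev q b)"
  have "fps_nth (ser_eval F q (ser_mult f g)) d
      = (\<Sum>m\<in>slice F d. \<Sum>(a, b)\<in>{(a, b). a + b = m}. (f a * g b) * monev q m)"
    by (simp add: ser_eval_def ser_mult_def sum_distrib_right case_prod_beta)
  also have "\<dots> = (\<Sum>m\<in>slice F d. \<Sum>ab\<in>{(a, b). a + b = m}. ?t ab)"
    by (intro sum.cong refl) (auto simp: monev_add)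
  also have "\<dots> = (\<Sum>(m, ab)\<in>(SIGMA m:slice F d. {(a, b). a + b = m}). ?t ab)"
    using F finite_splits by (subst sum.Sigma) auto
  also have "\<dots> = (\<Sum>(i, ab)\<in>(SIGMA i:{0..d}. slice F i \<times> slice F (d - i)). ?t ab)"
  proof (rule sum.reindex_bij_witness[of _ "\<lambda>(i, (a, b)). (a + b, (a, b))"
        "\<lambda>(m, (a, b)). (wdeg a + Poly_Mapping.lookup a (T 0), (a, b))"])
    fix x assume "x \<in> (SIGMA m:slice F d. {(a, b). a + b = m})"
    then obtain m a b where x: "x = (m, (a, b))" "a + b = m" "a + b \<in> slice F d" by auto
    then obtain i where i: "i \<le> d" "a \<in> slice F i" "b \<in> slice F (d - i)"
      using slice_add_iff by blast
    then have "wdeg a + Poly_Mapping.lookup a (T 0) = i" by (simp add: slice_def)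
    then show "(case x of (m, (a, b)) \<Rightarrow> (wdeg a + Poly_Mapping.lookup a (T 0), (a, b)))
        \<in> (SIGMA i:{0..d}. slice F i \<times> slice F (d - i))"
      using x i by simp
  next
    fix x assume "x \<in> (SIGMA i:{0..d}. slice F i \<times> slice F (d - i))"
    then obtain i a b where x: "x = (i, (a, b))" "i \<le> d" "a \<in> slice F i" "b \<in> slice F (d - i)" by auto
    then show "(case x of (i, (a, b)) \<Rightarrow> (a + b, (a, b))) \<in> (SIGMA m:slice F d. {(a, b). a + b = m})"
      using slice_add_iff[of a b F d] by auto
    show "(case (case x of (i, (a, b)) \<Rightarrow> (a + b, (a, b))) of
        (m, (a, b)) \<Rightarrow> (wdeg a + Poly_Mapping.lookup a (T 0), (a, b))) = x"
      using x by (simp add: slice_def)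
  qed auto
  also have "\<dots> = (\<Sum>i=0..d. \<Sum>ab\<in>slice F i \<times> slice F (d - i). ?t ab)"
    using F by (subst sum.Sigma) auto
  also have "\<dots> = fps_nth (ser_eval F q f * ser_eval F q g) d"
    by (simp add: fps_mult_nth ser_eval_def sum_product sum.cartesian_product case_prod_beta)
  finally show "fps_nth (ser_eval F q (ser_mult f g)) d = fps_nth (ser_eval F q f * ser_eval F q g) d" .
qed

lemma ser_eval_single:
  assumes "finite F"
  shows "ser_eval F q (ser_of (Poly_Mapping.single m x)) = (if Poly_Mapping.keys m \<subseteq> X ` F \<union> range T
    then fps_const (x * monev q m) * fps_X ^ (wdeg m + Poly_Mapping.lookup m (T 0)) else 0)"
proof (rule fps_ext)
  fix d
  have "fps_nth (ser_eval F q (ser_of (Poly_Mapping.single m x))) d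
     = (\<Sum>k\<in>slice F d. if m = k then x * monev q m else 0)"
    unfolding ser_eval_def ser_of_def
    by (auto simp: lookup_single when_def intro!: sum.cong)
  also have "\<dots> = (if m \<in> slice F d then x * monev q m else 0)"
    using assms by (simp add: sum.delta')
  finally show "fps_nth (ser_eval F q (ser_of (Poly_Mapping.single m x))) d = fps_nth (if Poly_Mapping.keys m \<subseteq> X ` F \<union> range T
    then fps_const (x * monev q m) * fps_X ^ (wdeg m + Poly_Mapping.lookup m (T 0)) else 0) d"
    by (auto simp: slice_def)
qed

lemma ser_eval_of_mult:
  assumes "finite F"
  shows "ser_eval F q (ser_of (p * r)) = ser_eval F q (ser_of p) * ser_eval F q (ser_of r)"
proof (rule poly_mult_hom[of "\<lambda>p. ser_eval F q (ser_of p)"])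
  show "ser_eval F q (ser_of 0) = 0"
    by (rule fps_ext) (simp add: ser_eval_def ser_of_def)
  show "ser_eval F q (ser_of (p + r)) = ser_eval F q (ser_of p) + ser_eval F q (ser_of r)" for p r
  proof -
    have "ser_of (p + r) = ser_add (ser_of p) (ser_of r)"
      by (simp add: ser_add_def ser_of_def lookup_add fun_eq_iff)
    then show ?thesis by (simp add: ser_eval_add)
  qed
  show "ser_eval F q (ser_of (Poly_Mapping.single (a + b) (x * y)))
     = ser_eval F q (ser_of (Poly_Mapping.single a x)) * ser_eval F q (ser_of (Poly_Mapping.single b y))" for a b x y
    using assms by (auto simp: ser_eval_single keys_plus_nat wdeg_add lookup_add monev_add power_add mult_ac
        simp flip: fps_const_mult)
qed

lemma ser_eval_of_1: "finite F \<Longrightarrow> ser_eval F q (ser_of 1) = 1"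
  using ser_eval_single[of F q 0 1] by simp

lemma ser_eval_xdiff:
  assumes "finite F" "i \<in> F" "j \<in> F"
  shows "ser_eval F q (ser_of (xdiff i j)) = fps_const (q (X i)) * fps_X - fps_const (q (X j)) * fps_X"
proof -
  have v: "ser_eval F q (ser_of (pvar (X i))) = fps_const (q (X i)) * fps_X" if "i \<in> F" for i
    using that assms(1) by (simp add: pvar_def ser_eval_single monev_def wdeg_def lookup_single)
  have "ser_of (xdiff i j) = ser_add (ser_of (pvar (X i))) (ser_neg (ser_of (pvar (X j))))"
    by (simp add: ser_of_def ser_add_def ser_neg_def xdiff_def lookup_minus fun_eq_iff)
  then show ?thesis using v assms by (simp add: ser_eval_add ser_eval_neg)
qed

lemma ser_eval_of_prod:
  "finite F \<Longrightarrow> ser_eval F q (ser_of (prod g I)) = (\<Prod>i\<in>I. ser_eval F q (ser_of (g i)))"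
  by (induction I rule: infinite_finite_induct) (simp_all add: ser_eval_of_mult ser_eval_of_1)

lemma ser_eval_of_power:
  "finite F \<Longrightarrow> ser_eval F q (ser_of (p ^ n)) = ser_eval F q (ser_of p) ^ n"
  by (induction n) (simp_all add: ser_eval_of_mult ser_eval_of_1)

section \<open>Vanishing of series\<close>

definition var_code :: "var \<Rightarrow> nat" where
  "var_code v = (case v of X i \<Rightarrow> 2 * int_encode i | T j \<Rightarrow> 2 * j + 1)"

lemma inj_var_code: "inj var_code"
proof (rule injI)
  fix u v assume "var_code u = var_code v"
  then show "u = v"
    by (cases u; cases v) (auto simp: var_code_def int_encode_eq, presburger+)
qed

definition var_prime :: "var \<Rightarrow> nat" where
  "var_prime v = enumerate {p. prime p} (var_code v)"

lemma prime_var_prime: "prime (var_prime v)"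
  using enumerate_in_set[OF primes_infinite] by (simp add: var_prime_def)

lemma inj_var_prime: "inj var_prime"
  using inj_var_code inj_enumerate[OF primes_infinite]
  by (auto simp: inj_def var_prime_def)

text \<open>Evaluating at the \<open>r\<close>-th powers of distinct primes separates all monomials.\<close>

lemma inj_mono_prime_power:
  "inj (\<lambda>m :: mono. \<Prod>v\<in>Poly_Mapping.keys m. var_prime v ^ Poly_Mapping.lookup m v)"
proof (rule injI)
  let ?P = "\<lambda>m :: mono. \<Prod>v\<in>Poly_Mapping.keys m. var_prime v ^ Poly_Mapping.lookup m v"
  fix m m' :: mono
  assume eq: "?P m = ?P m'"
  have mult: "multiplicity (var_prime v) (?P m) = Poly_Mapping.lookup m v" for v and m :: mono
  proof -
    let ?f = "\<lambda>p. Poly_Mapping.lookup m (inv var_prime p)"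
    have "?P m = (\<Prod>v\<in>Poly_Mapping.keys m. var_prime v ^ ?f (var_prime v))"
      by (simp add: inv_f_f[OF inj_var_prime])
    also have "\<dots> = (\<Prod>p\<in>var_prime ` Poly_Mapping.keys m. p ^ ?f p)"
      using inj_var_prime by (subst prod.reindex) (auto intro: inj_on_subset)
    finally have "multiplicity (var_prime v) (?P m)
        = (if var_prime v \<in> var_prime ` Poly_Mapping.keys m then ?f (var_prime v) else 0)"
      by (simp only:) (rule multiplicity_prod_prime_powers, auto simp: prime_var_prime)
    then show ?thesis
      using inj_var_prime by (auto simp: inv_f_f in_keys_iff inj_image_mem_iff)
  qed
  then show "m = m'" using eq by (intro poly_mapping_eqI) metis
qed

text \<open>The power sums combine to sums of f times any polynomial in a; the Lagrange polynomial
  vanishing at all nodes but a m isolates f m.\<close>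

lemma power_sums_eq_0:
  fixes a :: "'i \<Rightarrow> complex"
  assumes "finite M" "inj_on a M" and sums: "\<And>r. (\<Sum>m\<in>M. f m * a m ^ r) = 0" and "m \<in> M"
  shows "f m = 0"
proof -
  define p :: "complex Polynomial.poly" where "p = (\<Prod>m'\<in>M - {m}. [:- a m', 1:])"
  have p: "Polynomial.poly p x = (\<Prod>m'\<in>M - {m}. x - a m')" for x
    by (simp add: p_def poly_prod)
  have "(\<Sum>m'\<in>M. f m' * Polynomial.poly p (a m')) = (\<Sum>r\<le>degree p. coeff p r * (\<Sum>m'\<in>M. f m' * a m' ^ r))"
    by (subst sum_distrib_left, subst sum.swap) (simp add: poly_altdef sum_distrib_left mult_ac)
  also have "\<dots> = 0" by (simp add: sums)
  finally have "0 = (\<Sum>m'\<in>M. f m' * Polynomial.poly p (a m'))" by simp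
  also have "\<dots> = (\<Sum>m'\<in>{m}. f m' * Polynomial.poly p (a m'))"
    using assms by (intro sum.mono_neutral_right) (auto simp: p)
  finally have "f m * Polynomial.poly p (a m) = 0" by simp
  moreover have "Polynomial.poly p (a m) \<noteq> 0"
    using assms by (auto simp: p inj_on_def)
  ultimately show ?thesis by simp
qed

text \<open>At the r-th powers of primes the monomial m takes the value a^r for an integer a that
  determines m, so the hypothesis supplies all power sums with distinct bases.\<close>

lemma monev_sums_eq_0:
  assumes "finite M" and zero: "\<And>q. (\<Sum>m\<in>M. f m * monev q m) = 0" and "m \<in> M"
  shows "f m = 0"
proof (rule power_sums_eq_0[OF assms(1) _ _ assms(3)])
  let ?a = "\<lambda>m :: mono. of_nat (\<Prod>v\<in>Poly_Mapping.keys m. var_prime v ^ Poly_Mapping.lookup m v) :: complex"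
  show "inj_on ?a M"
    using inj_mono_prime_power by (auto simp: inj_on_def inj_def simp del: of_nat_prod)
  show "(\<Sum>m\<in>M. f m * ?a m ^ r) = 0" for r
  proof -
    have "monev (\<lambda>v. of_nat (var_prime v) ^ r) m = ?a m ^ r" for m
      by (simp add: monev_def prod_power_distrib mult.commute flip: power_mult)
    then show ?thesis using zero[of "\<lambda>v. of_nat (var_prime v) ^ r"] by simp
  qed
qed

lemma ser_eval_eq_0:
  assumes "finite F" and zero: "\<And>q. ser_eval F q f = 0"
    and "Poly_Mapping.keys m \<subseteq> X ` F \<union> range T"
  shows "f m = 0"
proof (rule monev_sums_eq_0)
  let ?d = "wdeg m + Poly_Mapping.lookup m (T 0)"
  show "finite (slice F ?d)" using assms(1) by (rule finite_slice)
  show "m \<in> slice F ?d" using assms by (simp add: slice_def)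
  show "(\<Sum>m\<in>slice F ?d. f m * monev q m) = 0" for q
    using arg_cong[OF zero[of q], of "\<lambda>s. fps_nth s ?d"] by (simp add: ser_eval_def)
qed

section \<open>The tau function and its shifts\<close>

text \<open>The value 0 for the x's is a dummy: \<open>hpoly\<close> contains only t's.\<close>

definition hval :: "(nat \<Rightarrow> complex) \<Rightarrow> int \<Rightarrow> complex" where
  "hval t l = peval (case_var (\<lambda>_. 0) t) (hpoly l)"

lemma hval_neg: "l < 0 \<Longrightarrow> hval t l = 0"
  by (simp add: hval_def hpoly_def)

definition tmonos :: "nat \<Rightarrow> mono set" where
  "tmonos n = {m. Poly_Mapping.keys m \<subseteq> Tvars \<and> wdeg m = n}"

lemma finite_tmonos [simp]: "finite (tmonos n)"
proof (rule finite_subset[of _ "slice {} n"])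
  show "tmonos n \<subseteq> slice {} n" by (auto simp: tmonos_def slice_def Tvars_def in_keys_iff)
qed simp

definition exp_coeff :: "(nat \<Rightarrow> complex) \<Rightarrow> mono \<Rightarrow> complex" where
  "exp_coeff t m = (\<Prod>v\<in>Poly_Mapping.keys m. case_var (\<lambda>_. 0) t v ^ Poly_Mapping.lookup m v / fact (Poly_Mapping.lookup m v))"

lemma hval_tmonos: "hval t (int n) = (\<Sum>m\<in>tmonos n. exp_coeff t m)"
proof -
  have "hval t (int n) = (\<Sum>m\<in>tmonos n. (\<Prod>v\<in>Poly_Mapping.keys m. 1 / of_nat (fact (Poly_Mapping.lookup m v)))
      * monev (case_var (\<lambda>_. 0) t) m)"
    by (simp add: hval_def hpoly_def tmonos_def)
  also have "\<dots> = (\<Sum>m\<in>tmonos n. exp_coeff t m)"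
    by (intro sum.cong) (simp_all add: exp_coeff_def monev_def flip: prod.distrib)
  finally show ?thesis .
qed

lemma hval_0: "hval t 0 = 1"
proof -
  have "tmonos 0 = {0}"
  proof (intro equalityI subsetI)
    fix m assume m: "m \<in> tmonos 0"
    have "v \<notin> Poly_Mapping.keys m" for v
    proof
      assume v: "v \<in> Poly_Mapping.keys m"
      then have "Poly_Mapping.lookup m v * weight v = 0"
        using m by (auto simp: tmonos_def wdeg_def)
      moreover obtain j where "v = T j" "1 \<le> j" using v m by (auto simp: tmonos_def Tvars_def)
      ultimately show False using v by (simp add: in_keys_iff)
    qed
    then have "m = 0" by (intro poly_mapping_eqI) (simp add: in_keys_iff)
    then show "m \<in> {0}" by simp
  qed (simp add: tmonos_def)
  then show ?thesis using hval_tmonos[of t 0] by (simp add: exp_coeff_def)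
qed

lemma exp_coeff_superset:
  "finite V \<Longrightarrow> Poly_Mapping.keys m \<subseteq> V \<Longrightarrow> exp_coeff t m =
     (\<Prod>v\<in>V. case_var (\<lambda>_. 0) t v ^ Poly_Mapping.lookup m v / fact (Poly_Mapping.lookup m v))"
  unfolding exp_coeff_def by (rule prod.mono_neutral_left) (auto simp: in_keys_iff)

text \<open>The divided power t^m / m! changes by the factor t_j / (m_j + 1) when the exponent of
  t_j grows by one.\<close>

lemma exp_coeff_add_single:
  "of_nat (Suc (Poly_Mapping.lookup m (T j))) * exp_coeff t (m + Poly_Mapping.single (T j) 1) = t j * exp_coeff t m"
proof -
  let ?V = "insert (T j) (Poly_Mapping.keys m)" and ?m' = "m + Poly_Mapping.single (T j) 1"
  let ?e = "\<lambda>m v. case_var (\<lambda>_. 0) t v ^ Poly_Mapping.lookup m v / fact (Poly_Mapping.lookup m v) :: complex"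
  have split: "exp_coeff t m'' = ?e m'' (T j) * (\<Prod>v\<in>?V - {T j}. ?e m'' v)" if "Poly_Mapping.keys m'' \<subseteq> ?V" for m''
    unfolding exp_coeff_superset[OF finite.insertI[OF finite_keys] that]
    by (rule prod.remove) simp_all
  have other: "(\<Prod>v\<in>?V - {T j}. ?e ?m' v) = (\<Prod>v\<in>?V - {T j}. ?e m v)"
    by (intro prod.cong) (auto simp: lookup_add lookup_single)
  have head: "of_nat (Suc (Poly_Mapping.lookup m (T j))) * ?e ?m' (T j) = t j * ?e m (T j)"
    using of_nat_neq_0[of "Poly_Mapping.lookup m (T j)", where 'a = complex] by (simp add: lookup_add)
  have sub: "Poly_Mapping.keys m \<subseteq> ?V" "Poly_Mapping.keys ?m' \<subseteq> ?V" by (auto simp: keys_plus_nat)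
  have "of_nat (Suc (Poly_Mapping.lookup m (T j))) * exp_coeff t ?m'
      = (of_nat (Suc (Poly_Mapping.lookup m (T j))) * ?e ?m' (T j)) * (\<Prod>v\<in>?V - {T j}. ?e ?m' v)"
    by (simp only: split[OF sub(2)] mult.assoc)
  also have "\<dots> = t j * exp_coeff t m"
    by (simp only: head other split[OF sub(1)] mult.assoc)
  finally show ?thesis .
qed

text \<open>This is t_j times the derivative of h_n by t_j, and that derivative is h_(n-j). On
  monomials, one factor t_j is removed.\<close>

lemma sum_lookup_exp_coeff:
  assumes "1 \<le> j" "j \<le> n"
  shows "(\<Sum>m\<in>tmonos n. of_nat (Poly_Mapping.lookup m (T j)) * exp_coeff t m)
       = t j * (\<Sum>m\<in>tmonos (n - j). exp_coeff t m)"
proof -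
  let ?s = "Poly_Mapping.single (T j) (1::nat)"
  have wt: "wdeg (m + ?s) = wdeg m + j" for m
    by (simp add: wdeg_add) (simp add: wdeg_def)
  have "(\<Sum>m\<in>tmonos n. of_nat (Poly_Mapping.lookup m (T j)) * exp_coeff t m)
      = (\<Sum>m | m \<in> tmonos n \<and> Poly_Mapping.lookup m (T j) \<noteq> 0. of_nat (Poly_Mapping.lookup m (T j)) * exp_coeff t m)"
    by (rule sum.mono_neutral_right) auto
  also have "\<dots> = (\<Sum>m\<in>tmonos (n - j). t j * exp_coeff t m)"
  proof (rule sum.reindex_bij_witness[of _ "\<lambda>m. m + ?s" "\<lambda>m. m - ?s"])
    fix m assume m: "m \<in> {m. m \<in> tmonos n \<and> Poly_Mapping.lookup m (T j) \<noteq> 0}"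
    show restore: "m - ?s + ?s = m"
      using m by (intro poly_mapping_eqI) (auto simp: lookup_add lookup_minus lookup_single when_def)
    have "wdeg (m - ?s) + j = n" using wt[of "m - ?s"] m restore by (simp add: tmonos_def)
    moreover have "Poly_Mapping.keys (m - ?s) \<subseteq> Tvars"
      using m by (auto simp: tmonos_def in_keys_iff lookup_minus)
    ultimately show "m - ?s \<in> tmonos (n - j)" by (simp add: tmonos_def)
    have "Suc (Poly_Mapping.lookup (m - ?s) (T j)) = Poly_Mapping.lookup m (T j)"
      using m by (simp add: lookup_minus)
    then show "t j * exp_coeff t (m - ?s) = of_nat (Poly_Mapping.lookup m (T j)) * exp_coeff t m"
      using exp_coeff_add_single[of "m - ?s" j t] restore by simp
  next
    fix m assume m: "m \<in> tmonos (n - j)"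
    show "m + ?s - ?s = m" by simp
    show "m + ?s \<in> {m. m \<in> tmonos n \<and> Poly_Mapping.lookup m (T j) \<noteq> 0}"
      using m assms wt[of m] by (auto simp: tmonos_def keys_plus_nat Tvars_def lookup_add)
  qed
  finally show ?thesis by (simp add: sum_distrib_left)
qed

text \<open>Euler's identity for the weighted degree: n h_n is the sum of j t_j times the derivative
  of h_n by t_j. It is the differential equation of the generating function, read
  coefficientwise.\<close>

lemma hval_recurrence:
  "of_nat n * hval t (int n) = (\<Sum>j=1..n. of_nat j * t j * hval t (int (n - j)))"
proof -
  have deg: "n = (\<Sum>j=1..n. j * Poly_Mapping.lookup m (T j))" if m: "m \<in> tmonos n" for m
  proof -
    have sub: "Poly_Mapping.keys m \<subseteq> T ` {1..n}"
    proof
      fix v assume v: "v \<in> Poly_Mapping.keys m"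
      then obtain j where j: "v = T j" "1 \<le> j" using m by (auto simp: tmonos_def Tvars_def)
      have deg: "Poly_Mapping.lookup m v * weight v \<le> n"
        using m v member_le_sum[of v "Poly_Mapping.keys m" "\<lambda>v. Poly_Mapping.lookup m v * weight v"]
        by (simp add: tmonos_def wdeg_def)
      have "1 \<le> Poly_Mapping.lookup m v" using v by (simp add: in_keys_iff Suc_le_eq)
      then have "1 * j \<le> Poly_Mapping.lookup m v * j" by (rule mult_le_mono1)
      also have "\<dots> \<le> n" using deg j by simp
      finally have "j \<le> n" by simp
      then show "v \<in> T ` {1..n}" using j by simp
    qed
    have "n = wdeg m" using m by (simp add: tmonos_def)
    also have "\<dots> = (\<Sum>v\<in>T ` {1..n}. Poly_Mapping.lookup m v * weight v)"
      using sub by (intro wdeg_superset) auto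
    also have "\<dots> = (\<Sum>j=1..n. j * Poly_Mapping.lookup m (T j))"
      by (subst sum.reindex) (auto simp: inj_on_def mult.commute)
    finally show ?thesis .
  qed
  have "of_nat n * hval t (int n) = (\<Sum>m\<in>tmonos n. of_nat n * exp_coeff t m)"
    by (simp add: hval_tmonos sum_distrib_left)
  also have "\<dots> = (\<Sum>m\<in>tmonos n. of_nat (\<Sum>j=1..n. j * Poly_Mapping.lookup m (T j)) * exp_coeff t m)"
    using deg by (intro sum.cong) auto
  also have "\<dots> = (\<Sum>m\<in>tmonos n. \<Sum>j=1..n. of_nat j * (of_nat (Poly_Mapping.lookup m (T j)) * exp_coeff t m))"
    by (simp add: sum_distrib_right mult.assoc)
  also have "\<dots> = (\<Sum>j=1..n. of_nat j * (\<Sum>m\<in>tmonos n. of_nat (Poly_Mapping.lookup m (T j)) * exp_coeff t m))"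
    by (subst sum.swap) (simp add: sum_distrib_left)
  also have "\<dots> = (\<Sum>j=1..n. of_nat j * t j * hval t (int (n - j)))"
    by (intro sum.cong) (simp_all add: sum_lookup_exp_coeff hval_tmonos mult.assoc del: of_nat_diff)
  finally show ?thesis .
qed

text \<open>The equation gives (k + 1) times coefficient k + 1 in terms of earlier coefficients, and
  k + 1 is invertible.\<close>

lemma fps_linear_ode_unique:
  fixes A B P :: "complex fps"
  assumes "fps_deriv A = P * A" "fps_deriv B = P * B" "fps_nth A 0 = fps_nth B 0"
  shows "A = B"
proof (rule fps_ext)
  fix n show "fps_nth A n = fps_nth B n"
  proof (induction n rule: less_induct)
    case (less n)
    show ?case
    proof (cases n)
      case 0
      then show ?thesis using assms(3) by simp
    next
      case (Suc k)
      have "fps_nth (fps_deriv A) k = fps_nth (fps_deriv B) k"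
        unfolding assms(1,2) fps_mult_nth using less Suc by (intro sum.cong) auto
      then show ?thesis using Suc by (simp del: of_nat_Suc)
    qed
  qed
qed

text \<open>Both sides solve \<open>f' = (\<Sum>j. j t\<^sub>j u\<^sup>j\<^sup>-\<^sup>1) f\<close> for the generating function \<open>exp (\<Sum>j. t\<^sub>j u\<^sup>j)\<close>,
  because inserting \<open>[z]\<close> multiplies that generating function by \<open>1 / (1 - z u)\<close>.\<close>

lemma hval_insert:
  "hval t l = hval (\<lambda>j. t j + z ^ j / of_nat j) l - z * hval (\<lambda>j. t j + z ^ j / of_nat j) (l - 1)"
proof -
  define gen :: "(nat \<Rightarrow> complex) \<Rightarrow> complex fps" where "gen t = Abs_fps (\<lambda>n. hval t (int n))" for t
  define P :: "(nat \<Rightarrow> complex) \<Rightarrow> complex fps" where "P t = Abs_fps (\<lambda>n. of_nat (Suc n) * t (Suc n))" for t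
  let ?t = "\<lambda>j. t j + z ^ j / of_nat j"
  let ?Z = "Abs_fps (\<lambda>n. z ^ Suc n)" and ?L = "1 - fps_const z * fps_X"
  have ode: "fps_deriv (gen t) = P t * gen t" for t
  proof (rule fps_ext)
    fix n
    have "fps_nth (fps_deriv (gen t)) n = (\<Sum>j=1..Suc n. of_nat j * t j * hval t (int (Suc n - j)))"
      using hval_recurrence[of "Suc n" t] by (simp add: gen_def)
    also have "\<dots> = (\<Sum>i=0..n. of_nat (Suc i) * t (Suc i) * hval t (int (n - i)))"
      using sum.shift_bounds_cl_Suc_ivl[of "\<lambda>j. of_nat j * t j * hval t (int (Suc n - j))" 0 n] by simp
    finally show "fps_nth (fps_deriv (gen t)) n = fps_nth (P t * gen t) n"
      by (simp add: fps_mult_nth gen_def P_def)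
  qed
  have P: "P ?t = P t + ?Z"
    by (rule fps_ext) (simp add: P_def algebra_simps divide_simps del: of_nat_Suc)
  \<comment> \<open>\<open>?Z\<close> is the geometric series z / (1 - z u), the logarithmic
    derivative of 1 / (1 - z u).\<close>
  have Z: "?L * ?Z = fps_const z"
  proof (rule fps_ext)
    fix n show "fps_nth (?L * ?Z) n = fps_nth (fps_const z) n"
      by (cases n) (simp_all add: left_diff_distrib mult.assoc)
  qed
  \<comment> \<open>In the product rule the derivative -z of \<open>?L\<close> cancels against
    \<open>?L * ?Z\<close>, leaving the equation that \<open>gen t\<close> satisfies.\<close>
  have "fps_deriv (?L * gen ?t) = ?L * (P ?t * gen ?t) - fps_const z * gen ?t"
    by (simp add: ode algebra_simps)
  also have "\<dots> = P t * (?L * gen ?t) + (?L * ?Z) * gen ?t - fps_const z * gen ?t"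
    unfolding P by (simp add: algebra_simps)
  also have "\<dots> = P t * (?L * gen ?t)" unfolding Z by simp
  finally have "gen t = ?L * gen ?t"
    by (rule fps_linear_ode_unique[OF ode]) (simp add: gen_def hval_0)
  then have nth: "fps_nth (gen t) n = fps_nth (gen ?t - fps_const z * (fps_X * gen ?t)) n" for n
    by (simp add: left_diff_distrib mult.assoc)
  show ?thesis
  proof (cases "l \<le> 0")
    \<comment> \<open>\<open>gen\<close> records only indices from 0 on; at 0 both sides are 1,
      below 0 they vanish.\<close>
    case True
    then show ?thesis by (cases "l = 0") (simp_all add: hval_0 hval_neg)
  next
    case False
    then obtain n where "l = int (Suc n)" by (metis not_le zero_less_imp_eq_int gr0_implies_Suc)
    then show ?thesis using nth[of "Suc n"] by (simp add: gen_def)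
  qed
qed

definition shift_times :: "(var \<Rightarrow> complex) \<Rightarrow> (int \<Rightarrow> int) \<Rightarrow> nat \<Rightarrow> complex" where
  "shift_times q n j = q (T j) + (\<Sum>i | n i \<noteq> 0. of_int (n i) / of_nat j * q (X i) ^ j)"

text \<open>Evaluation commutes with the substitution degree by degree: the shifted series at q is
  the unshifted one at the times \<open>shift_times q n\<close>, where each Schur function becomes a
  Jacobi-Trudi determinant of values \<open>hval\<close>.\<close>

lemma ser_eval_shift_tau:
  assumes F: "finite F" "{i. n i \<noteq> 0} \<subseteq> F"
  shows "ser_eval F q (ser_shift n (tau \<pi>)) = tau_fps \<pi> (hval (shift_times q n))"
proof (rule fps_ext)
  fix d
  let ?q = "case_var (\<lambda>_. 0) (shift_times q n)"
  let ?ps = "\<lambda>m. psubst (shift n) (pmonom m)"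
  have eval_ps: "peval q (?ps m) = monev ?q m" if "Poly_Mapping.keys m \<subseteq> Tvars" for m
    unfolding psubst_pmonom monev_def
    using that by (auto simp: Tvars_def shift_def shift_times_def intro!: prod.cong)
  have hom: "homog (X ` F \<union> Tvars) d (?ps m)" if "m \<in> tmonos d" for m
    using homog_psubst_shift[OF F(2), of m] that by (simp add: tmonos_def)
  have sum_slice: "(\<Sum>M\<in>slice F d. Poly_Mapping.lookup (?ps m) M * monev q M) = monev ?q m" if m: "m \<in> tmonos d" for m
  proof -
    have "Poly_Mapping.keys (?ps m) \<subseteq> slice F d"
    proof
      fix M assume M: "M \<in> Poly_Mapping.keys (?ps m)"
      then have K: "Poly_Mapping.keys M \<subseteq> X ` F \<union> Tvars" "wdeg M = d"
        using hom[OF m] by (simp_all add: homog_def)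
      have "T 0 \<notin> X ` F \<union> Tvars" by (auto simp: Tvars_def)
      then have "Poly_Mapping.lookup M (T 0) = 0" using K(1) by (meson in_keys_iff subsetD)
      moreover have "Tvars \<subseteq> range T" by (auto simp: Tvars_def)
      ultimately show "M \<in> slice F d" using K unfolding slice_def by auto
    qed
    then show ?thesis
      using F(1) m eval_ps[of m] peval_superset[of "slice F d" "?ps m" q] by (simp add: tmonos_def)
  qed
  \<comment> \<open>\<open>wdeg\<close> ignores \<open>T 0\<close>, so for a monomial containing
    \<open>T 0\<close> the sum defining \<open>ser_shift\<close> runs over a degree below d. Both
    sides are then 0, because images of t-monomials never contain \<open>T 0\<close>.\<close>
  have coeff: "ser_shift n (tau \<pi>) M = (\<Sum>m\<in>tmonos d. tau \<pi> m * Poly_Mapping.lookup (?ps m) M)" if M: "M \<in> slice F d" for M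
  proof (cases "Poly_Mapping.lookup M (T 0) = 0")
    case True
    then show ?thesis using M by (simp add: ser_shift_def slice_def tmonos_def)
  next
    case False
    then have "T 0 \<in> Poly_Mapping.keys M" by (simp add: in_keys_iff)
    moreover have "T 0 \<notin> X ` F \<union> Tvars" by (auto simp: Tvars_def)
    ultimately have "M \<notin> Poly_Mapping.keys (?ps m)" if "Poly_Mapping.keys m \<subseteq> Tvars" for m
      using homog_psubst_shift[OF F(2) that] unfolding homog_def by blast
    then have "Poly_Mapping.lookup (?ps m) M = 0" if "Poly_Mapping.keys m \<subseteq> Tvars" for m
      using that by (simp add: in_keys_iff)
    then show ?thesis by (simp add: ser_shift_def tmonos_def)
  qed
  have "fps_nth (ser_eval F q (ser_shift n (tau \<pi>))) d
      = (\<Sum>M\<in>slice F d. \<Sum>m\<in>tmonos d. tau \<pi> m * (Poly_Mapping.lookup (?ps m) M * monev q M))"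
    by (simp add: ser_eval_def coeff sum_distrib_right mult.assoc)
  also have "\<dots> = (\<Sum>m\<in>tmonos d. tau \<pi> m * (\<Sum>M\<in>slice F d. Poly_Mapping.lookup (?ps m) M * monev q M))"
    by (subst sum.swap) (simp add: sum_distrib_left)
  also have "\<dots> = (\<Sum>m\<in>tmonos d. tau \<pi> m * monev ?q m)"
    by (simp add: sum_slice)
  also have "\<dots> = (\<Sum>m\<in>tmonos d. \<Sum>lam | lam \<in> partitions \<and> sum_list lam = d.
      \<pi> lam * (Poly_Mapping.lookup (schur lam) m * monev ?q m))"
    by (intro sum.cong) (simp_all add: tau_def tmonos_def sum_distrib_right mult.assoc)
  also have "\<dots> = (\<Sum>lam | lam \<in> partitions \<and> sum_list lam = d.
      \<pi> lam * (\<Sum>m\<in>tmonos d. Poly_Mapping.lookup (schur lam) m * monev ?q m))"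
    by (subst sum.swap) (simp add: sum_distrib_left)
  also have "\<dots> = (\<Sum>lam | lam \<in> partitions \<and> sum_list lam = d. \<pi> lam * jacobi_trudi (hval (shift_times q n)) lam)"
  proof (intro sum.cong refl arg_cong2[where f = "(*)"], clarify)
    fix lam assume "lam \<in> partitions" "d = sum_list lam"
    have "Poly_Mapping.keys (schur lam) \<subseteq> tmonos (sum_list lam)"
      using homog_schur[of lam] by (auto simp: homog_def tmonos_def)
    then have "(\<Sum>m\<in>tmonos (sum_list lam). Poly_Mapping.lookup (schur lam) m * monev ?q m) = peval ?q (schur lam)"
      by (rule peval_superset[OF finite_tmonos, symmetric])
    also have "\<dots> = jacobi_trudi (\<lambda>l. peval ?q (hpoly l)) lam"
      by (simp add: schur_jacobi_trudi peval_jacobi_trudi)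
    also have "(\<lambda>l. peval ?q (hpoly l)) = hval (shift_times q n)"
      by (simp add: hval_def fun_eq_iff)
    finally show "(\<Sum>m\<in>tmonos (sum_list lam). Poly_Mapping.lookup (schur lam) m * monev ?q m)
       = jacobi_trudi (hval (shift_times q n)) lam" .
  qed
  finally show "fps_nth (ser_eval F q (ser_shift n (tau \<pi>))) d = fps_nth (tau_fps \<pi> (hval (shift_times q n))) d"
    by (simp add: tau_fps_def)
qed

text \<open>Adding \<open>alpha a\<close> to n adds q(X a)^j / j to the times, that is, inserts the
  point q(X a); the base times come from n.\<close>

lemma tau_three_term:
  fixes n :: "int \<Rightarrow> int" and q :: "var \<Rightarrow> complex"
  assumes "plucker \<pi>" and fin: "finite {i. n i \<noteq> 0}"
  defines "y \<equiv> \<lambda>i. fps_const (q (X i)) * fps_X"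
    and "Tn \<equiv> \<lambda>n. tau_fps \<pi> (hval (shift_times q n))"
  shows "(y a - y b) * (y c - y d) * Tn (n + alpha a + alpha b) * Tn (n + alpha c + alpha d)
       - (y a - y c) * (y b - y d) * Tn (n + alpha a + alpha c) * Tn (n + alpha b + alpha d)
       + (y a - y d) * (y b - y c) * Tn (n + alpha a + alpha d) * Tn (n + alpha b + alpha c) = 0"
proof -
  define h where "h = (\<lambda>Z :: complex multiset. hval (\<lambda>j. shift_times q n j + (\<Sum>z\<in>#Z. z ^ j / of_nat j)))"
  have step: "h Z l = h (add_mset z Z) l - z * h (add_mset z Z) (l - 1)" for Z z l
    unfolding h_def
    by (subst hval_insert[where z = z]) (simp add: algebra_simps)
  have shift: "shift_times q (n + alpha a + alpha b) j = shift_times q n j + q (X a) ^ j / of_nat j + q (X b) ^ j / of_nat j" for a b j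
  proof -
    define S where "S = {i. n i \<noteq> 0} \<union> {a, b}"
    have S: "finite S" using fin by (simp add: S_def)
    have ext: "(\<Sum>i | m i \<noteq> 0. of_int (m i) / of_nat j * q (X i) ^ j) = (\<Sum>i\<in>S. of_int (m i) / of_nat j * q (X i) ^ j)"
      if "{i. m i \<noteq> 0} \<subseteq> S" for m :: "int \<Rightarrow> int"
      using that S by (intro sum.mono_neutral_left) auto
    have al: "(\<Sum>i\<in>S. of_int (alpha c i) / of_nat j * q (X i) ^ j) = q (X c) ^ j / of_nat j" if "c \<in> S" for c
    proof -
      have "(\<Sum>i\<in>S. of_int (alpha c i) / of_nat j * q (X i) ^ j) = (\<Sum>i\<in>S. if i = c then q (X i) ^ j / of_nat j else 0)"
        by (intro sum.cong) (auto simp: alpha_def)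
      then show ?thesis using that S by simp
    qed
    have sub: "{i. (n + alpha a + alpha b) i \<noteq> 0} \<subseteq> S"
      by (auto simp: S_def alpha_def)
    have sub_n: "{i. n i \<noteq> 0} \<subseteq> S" by (auto simp: S_def)
    show ?thesis
      unfolding shift_times_def ext[OF sub]
      using ext[OF sub_n] al[of a] al[of b]
      by (simp add: S_def add_divide_distrib ring_distribs sum.distrib)
  qed
  have T: "Tn (n + alpha a + alpha b) = tau_fps \<pi> (h {#q (X a), q (X b)#})" for a b
  proof -
    have "shift_times q (n + alpha a + alpha b)
       = (\<lambda>j. shift_times q n j + (\<Sum>z\<in>#{#q (X a), q (X b)#}. z ^ j / of_nat j))"
      by (simp add: fun_eq_iff shift)
    then show ?thesis by (simp only: Tn_def h_def)
  qed
  show ?thesis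
    unfolding T y_def
    by (rule tau_fps_three_term[OF assms(1)]) (simp add: h_def hval_0, simp add: h_def hval_neg, rule step)
qed

section \<open>Evaluation of fractions\<close>

text \<open>Laurent series are taken because power series do not form a field.\<close>

definition loc_eval :: "int set \<Rightarrow> (var \<Rightarrow> complex) \<Rightarrow> loc \<Rightarrow> complex fls" where
  "loc_eval F q a = fps_to_fls (ser_eval F q (fst a)) / fps_to_fls (ser_eval F q (ser_of (snd a)))"

text \<open>Division by 0 gives 0, which is compatible with products but not with sums; the additive
  rules therefore ask for nonzero denominators.\<close>

definition loc_defined :: "int set \<Rightarrow> (var \<Rightarrow> complex) \<Rightarrow> loc \<Rightarrow> bool" where
  "loc_defined F q a \<longleftrightarrow> ser_eval F q (ser_of (snd a)) \<noteq> 0"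

context
  fixes F :: "int set" and q :: "var \<Rightarrow> complex"
  assumes F: "finite F"
begin

lemma loc_eval_mul: "loc_eval F q (a **\<^sub>L b) = loc_eval F q a * loc_eval F q b"
  using F by (simp add: loc_eval_def lmul_def ser_eval_mult ser_eval_of_mult fls_times_fps_to_fls)

lemma loc_eval_neg: "loc_eval F q (lneg a) = - loc_eval F q a"
  by (simp add: loc_eval_def lneg_def ser_eval_neg)

lemma loc_eval_add:
  "loc_defined F q a \<Longrightarrow> loc_defined F q b \<Longrightarrow> loc_eval F q (a ++\<^sub>L b) = loc_eval F q a + loc_eval F q b"
  using F by (simp add: loc_eval_def ladd_def loc_defined_def ser_eval_add ser_eval_mult ser_eval_of_mult
      fls_times_fps_to_fls add_frac_eq)

lemma loc_defined_mul: "loc_defined F q a \<Longrightarrow> loc_defined F q b \<Longrightarrow> loc_defined F q (a **\<^sub>L b)"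
  using F by (simp add: loc_defined_def lmul_def ser_eval_of_mult)

lemma loc_defined_neg: "loc_defined F q a \<Longrightarrow> loc_defined F q (lneg a)"
  by (simp add: loc_defined_def lneg_def)

lemma loc_defined_add: "loc_defined F q a \<Longrightarrow> loc_defined F q b \<Longrightarrow> loc_defined F q (a ++\<^sub>L b)"
  using F by (simp add: loc_defined_def ladd_def ser_eval_of_mult)

lemma loc_defined_sub: "loc_defined F q a \<Longrightarrow> loc_defined F q b \<Longrightarrow> loc_defined F q (a --\<^sub>L b)"
  by (simp add: lsub_def loc_defined_add loc_defined_neg)

lemma loc_eval_sub:
  "loc_defined F q a \<Longrightarrow> loc_defined F q b \<Longrightarrow> loc_eval F q (a --\<^sub>L b) = loc_eval F q a - loc_eval F q b"
  by (simp add: lsub_def loc_eval_add loc_defined_neg loc_eval_neg)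

end

definition ordered_pairs :: "int set \<Rightarrow> (int \<times> int) set" where
  "ordered_pairs F = {(i, j). i \<in> F \<and> j \<in> F \<and> i < j}"

lemma finite_ordered_pairs [simp]: "finite F \<Longrightarrow> finite (ordered_pairs F)"
  by (rule finite_subset[of _ "F \<times> F"]) (auto simp: ordered_pairs_def)

lemma prod_xdiff_Sx:
  "finite I \<Longrightarrow> (\<And>i j. (i, j) \<in> I \<Longrightarrow> i \<noteq> j) \<Longrightarrow> (\<Prod>(i, j)\<in>I. xdiff i j) \<in> Sx"
proof (induction I rule: finite_induct)
  case empty
  then show ?case by (simp add: Sx.one)
next
  case (insert p I)
  obtain i j where p: "p = (i, j)" by (cases p)
  have "i \<noteq> j" using insert.prems p by blast
  moreover have "(\<Prod>(i, j)\<in>I. xdiff i j) \<in> Sx" using insert by blast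
  ultimately show ?case
    using insert.hyps Sx.step[of _ i j] by (simp add: p xdiff_def)
qed

text \<open>Multiplying by all \<open>x\<^sub>i - x\<^sub>j\<close> with \<open>i, j \<in> F0\<close> kills the evaluation at every point whose
  coordinates in \<open>F0\<close> are not distinct, so only the other points matter.\<close>

lemma leqI:
  assumes F0: "finite F0"
    and eq: "\<And>F q. finite F \<Longrightarrow> F0 \<subseteq> F \<Longrightarrow> inj_on (\<lambda>i. q (X i)) F0 \<Longrightarrow>
       loc_defined F q a \<and> loc_defined F q b \<and> loc_eval F q a = loc_eval F q b"
  shows "a =\<^sub>L b"
proof -
  define u where "u = (\<Prod>(i, j)\<in>ordered_pairs F0. xdiff i j)"
  define f where "f = ser_mult (ser_of u)
       (ser_add (ser_mult (fst a) (ser_of (snd b))) (ser_neg (ser_mult (fst b) (ser_of (snd a)))))"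
  have "f m = 0" for m
  proof -
    \<comment> \<open>The x-variables of m are included so that the evaluation does not discard
      m.\<close>
    define F where "F = F0 \<union> X -` Poly_Mapping.keys m"
    have F: "finite F" "F0 \<subseteq> F"
      using F0 by (auto simp: F_def inj_def intro!: finite_vimageI)
    have m: "Poly_Mapping.keys m \<subseteq> X ` F \<union> range T"
    proof
      fix v assume "v \<in> Poly_Mapping.keys m"
      then show "v \<in> X ` F \<union> range T" by (cases v) (auto simp: F_def)
    qed
    have "ser_eval F q f = 0" for q
    proof (cases "inj_on (\<lambda>i. q (X i)) F0")
      case True
      let ?e = "ser_eval F q"
      have "loc_defined F q a" "loc_defined F q b" "loc_eval F q a = loc_eval F q b"
        using eq[OF F True] by auto
      then have "fps_to_fls (?e (fst a) * ?e (ser_of (snd b))) = fps_to_fls (?e (fst b) * ?e (ser_of (snd a)))"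
        by (simp add: loc_defined_def loc_eval_def frac_eq_eq fls_times_fps_to_fls)
      then show ?thesis
        using F by (simp add: f_def ser_eval_mult ser_eval_add ser_eval_neg)
    next
      case False
      then obtain i j where ij: "i \<in> F0" "j \<in> F0" "i \<noteq> j" "q (X i) = q (X j)"
        by (auto simp: inj_on_def)
      \<comment> \<open>\<open>u\<close> has factors for increasing pairs only.\<close>
      define i' j' where "i' = min i j" and "j' = max i j"
      have ij': "(i', j') \<in> ordered_pairs F0" "q (X i') = q (X j')"
        using ij by (auto simp: i'_def j'_def ordered_pairs_def min_def max_def)
      then have "ser_eval F q (ser_of (xdiff i' j')) = 0"
        using F by (subst ser_eval_xdiff) (auto simp: ordered_pairs_def)
      then have "ser_eval F q (ser_of u) = 0"
        using F F0 ij'(1) unfolding u_def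
        by (subst ser_eval_of_prod) (auto intro!: prod_zero bexI[of _ "(i', j')"])
      then show ?thesis using F by (simp add: f_def ser_eval_mult)
    qed
    then show ?thesis using ser_eval_eq_0[OF F(1) _ m] by blast
  qed
  moreover have "u \<in> Sx" unfolding u_def
    by (rule prod_xdiff_Sx[OF finite_ordered_pairs[OF F0]]) (auto simp: ordered_pairs_def)
  ultimately show ?thesis unfolding leq_def f_def by (auto simp: fun_eq_iff)
qed

section \<open>The functions H^n at a point whose relevant coordinates are distinct\<close>

lemma frac_power_int:
  fixes x :: "'a::field"
  assumes "x \<noteq> 0"
  shows "x ^ nat k / x ^ nat (- k) = x powi k"
  using assms by (auto simp: power_int_def divide_inverse power_inverse)

lemma power_int_add_four:
  fixes x :: "'a::field"
  assumes "x \<noteq> 0"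
  shows "x powi (a + b + c + (if Q then 1 else 0)) = x powi a * x powi b * x powi c * (if Q then x else 1)"
  using assms by (simp add: power_int_add)

context
  fixes F F0 :: "int set" and q :: "var \<Rightarrow> complex" and \<pi> :: "nat list \<Rightarrow> complex"
  assumes F: "finite F" and F0: "F0 \<subseteq> F" and inj: "inj_on (\<lambda>i. q (X i)) F0"
    and plucker: "plucker \<pi>"
begin

definition coord :: "int \<Rightarrow> complex fls" where
  "coord i = fps_to_fls (fps_const (q (X i)) * fps_X)"

definition tau_at :: "(int \<Rightarrow> int) \<Rightarrow> complex fls" where
  "tau_at n = fps_to_fls (tau_fps \<pi> (hval (shift_times q n)))"

lemma finite_pairs: "finite (ordered_pairs F0)"
  using F F0 finite_subset finite_ordered_pairs by blast

lemma coord_distinct: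
  assumes "(i, j) \<in> ordered_pairs F0"
  shows "coord i - coord j \<noteq> 0"
proof
  assume "coord i - coord j = 0"
  then have "fps_const (q (X i)) * fps_X = fps_const (q (X j)) * fps_X" by (simp add: coord_def)
  from arg_cong[OF this, of "\<lambda>f. fps_nth f 1"] have "q (X i) = q (X j)" by simp
  then show False using assms inj by (auto simp: ordered_pairs_def inj_on_def)
qed

text \<open>Exponent 0 outside \<open>I\<close> lets all prefactors be written over the one index
  set \<open>ordered_pairs F0\<close>, where they can be compared factor by factor.\<close>

lemma eval_xdiff_prod:
  assumes "I \<subseteq> ordered_pairs F0" and "\<And>i j. (i, j) \<in> ordered_pairs F0 - I \<Longrightarrow> e i j = 0"
  shows "fps_to_fls (ser_eval F q (ser_of (\<Prod>(i, j)\<in>I. xdiff i j ^ e i j)))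
    = (\<Prod>(i, j)\<in>ordered_pairs F0. (coord i - coord j) ^ e i j)"
proof -
  have hom: "fps_to_fls (prod g J) = (\<Prod>i\<in>J. fps_to_fls (g i))" for g :: "int \<times> int \<Rightarrow> complex fps" and J
    by (induction J rule: infinite_finite_induct) (simp_all add: fls_times_fps_to_fls)
  have "fps_to_fls (ser_eval F q (ser_of (\<Prod>(i, j)\<in>I. xdiff i j ^ e i j)))
    = (\<Prod>(i, j)\<in>I. (coord i - coord j) ^ e i j)"
    unfolding ser_eval_of_prod[OF F] hom
  proof (intro prod.cong refl, clarify)
    fix i j assume "(i, j) \<in> I"
    then have "i \<in> F" "j \<in> F" using assms(1) F0 by (auto simp: ordered_pairs_def)
    then show "fps_to_fls (ser_eval F q (ser_of (xdiff i j ^ e i j))) = (coord i - coord j) ^ e i j"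
      using F by (simp add: ser_eval_of_power fps_to_fls_power ser_eval_xdiff coord_def)
  qed
  also have "\<dots> = (\<Prod>(i, j)\<in>ordered_pairs F0. (coord i - coord j) ^ e i j)"
    using assms by (intro prod.mono_neutral_left finite_pairs) auto
  finally show ?thesis .
qed

lemma Hn_eval:
  assumes n: "{i. n i \<noteq> 0} \<subseteq> F0"
  shows "loc_defined F q (Hn \<pi> n)"
    and "loc_eval F q (Hn \<pi> n)
      = (\<Prod>(i, j)\<in>ordered_pairs F0. (coord i - coord j) powi (n i * n j)) * tau_at n"
proof -
  let ?pos = "{(i, j). i < j \<and> n i * n j > 0}" and ?neg = "{(i, j). i < j \<and> n i * n j < 0}"
  have sub: "?pos \<subseteq> ordered_pairs F0" "?neg \<subseteq> ordered_pairs F0"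
    using n by (auto simp: ordered_pairs_def)
  have num: "fps_to_fls (ser_eval F q (ser_of (\<Prod>(i, j)\<in>?pos. xdiff i j ^ nat (n i * n j))))
    = (\<Prod>(i, j)\<in>ordered_pairs F0. (coord i - coord j) ^ nat (n i * n j))"
    by (rule eval_xdiff_prod[OF sub(1)]) (auto simp: ordered_pairs_def)
  have den: "fps_to_fls (ser_eval F q (ser_of (\<Prod>(i, j)\<in>?neg. xdiff i j ^ nat (- (n i * n j)))))
    = (\<Prod>(i, j)\<in>ordered_pairs F0. (coord i - coord j) ^ nat (- (n i * n j)))"
    by (rule eval_xdiff_prod[OF sub(2)]) (auto simp: ordered_pairs_def)
  have "\<dots> \<noteq> 0"
    using coord_distinct finite_pairs by (auto simp: prod_zero_iff)
  then show "loc_defined F q (Hn \<pi> n)"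
    unfolding den[symmetric] by (simp add: loc_defined_def Hn_def)
  have "loc_eval F q (Hn \<pi> n) = (\<Prod>(i, j)\<in>ordered_pairs F0. (coord i - coord j) ^ nat (n i * n j)) * tau_at n
      / (\<Prod>(i, j)\<in>ordered_pairs F0. (coord i - coord j) ^ nat (- (n i * n j)))"
    using F F0 n unfolding num[symmetric] den[symmetric]
    by (simp add: loc_eval_def Hn_def ser_eval_mult fls_times_fps_to_fls tau_at_def ser_eval_shift_tau)
  also have "\<dots> = (\<Prod>(i, j)\<in>ordered_pairs F0. (coord i - coord j) ^ nat (n i * n j)
      / (coord i - coord j) ^ nat (- (n i * n j))) * tau_at n"
    by (simp add: prod_dividef case_prod_beta)
  also have "(\<Prod>(i, j)\<in>ordered_pairs F0. (coord i - coord j) ^ nat (n i * n j)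
      / (coord i - coord j) ^ nat (- (n i * n j))) = (\<Prod>(i, j)\<in>ordered_pairs F0. (coord i - coord j) powi (n i * n j))"
    by (intro prod.cong refl, clarify) (intro frac_power_int coord_distinct)
  finally show "loc_eval F q (Hn \<pi> n)
      = (\<Prod>(i, j)\<in>ordered_pairs F0. (coord i - coord j) powi (n i * n j)) * tau_at n" .
qed

text \<open>The part of the prefactor of \<open>n + alpha a\<close> that is bilinear in n and
  \<open>alpha a\<close>.\<close>

definition cross_factor :: "(int \<Rightarrow> int) \<Rightarrow> int \<Rightarrow> complex fls" where
  "cross_factor n a = (\<Prod>(i, j)\<in>ordered_pairs F0. (coord i - coord j) powi (n i * alpha a j + alpha a i * n j))"

lemma Hn_eval_add_two:
  assumes n: "{i. n i \<noteq> 0} \<subseteq> F0" and ab: "a \<in> F0" "b \<in> F0" "a < b"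
  shows "loc_eval F q (Hn \<pi> (n + alpha a + alpha b))
     = (\<Prod>(i, j)\<in>ordered_pairs F0. (coord i - coord j) powi (n i * n j)) * cross_factor n a * cross_factor n b
       * (coord a - coord b) * tau_at (n + alpha a + alpha b)"
proof -
  let ?v = "n + alpha a + alpha b" and ?y = "\<lambda>i j. coord i - coord j"
  have "{i. ?v i \<noteq> 0} \<subseteq> F0" using n ab by (auto simp: alpha_def)
  note eval = Hn_eval(2)[OF this]
  have "(\<Prod>(i, j)\<in>ordered_pairs F0. ?y i j powi (?v i * ?v j))
     = (\<Prod>(i, j)\<in>ordered_pairs F0. ?y i j powi (n i * n j) * ?y i j powi (n i * alpha a j + alpha a i * n j)
         * ?y i j powi (n i * alpha b j + alpha b i * n j) * (if (i, j) = (a, b) then ?y i j else 1))"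
  proof (intro prod.cong refl, clarify)
    fix i j assume ij: "(i, j) \<in> ordered_pairs F0"
    \<comment> \<open>Since i < j and a < b, the product of the two added unit vectors contributes
      at (a, b) only, and the squares of \<open>alpha a\<close> and \<open>alpha b\<close>
      contribute nothing off the diagonal.\<close>
    have "?v i * ?v j = n i * n j + (n i * alpha a j + alpha a i * n j) + (n i * alpha b j + alpha b i * n j)
        + (if (i, j) = (a, b) then 1 else 0)"
      using ij ab(3) by (auto simp: alpha_def ordered_pairs_def algebra_simps)
    then show "?y i j powi (?v i * ?v j) = ?y i j powi (n i * n j) * ?y i j powi (n i * alpha a j + alpha a i * n j)
         * ?y i j powi (n i * alpha b j + alpha b i * n j) * (if (i, j) = (a, b) then ?y i j else 1)"
      by (simp only: power_int_add_four[OF coord_distinct[OF ij]])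
  qed
  also have "\<dots> = (\<Prod>(i, j)\<in>ordered_pairs F0. ?y i j powi (n i * n j)) * cross_factor n a * cross_factor n b
      * (\<Prod>(i, j)\<in>ordered_pairs F0. if (i, j) = (a, b) then ?y i j else 1)"
    by (simp add: cross_factor_def prod.distrib case_prod_beta)
  also have "(\<Prod>(i, j)\<in>ordered_pairs F0. if (i, j) = (a, b) then ?y i j else 1)
      = (\<Prod>p\<in>ordered_pairs F0. if p = (a, b) then ?y a b else 1)"
    by (intro prod.cong) (auto split: if_splits)
  also have "\<dots> = ?y a b"
    using ab finite_pairs by (simp add: prod.delta ordered_pairs_def)
  finally show ?thesis unfolding eval by simp
qed

lemma Hn_three_term:
  assumes n: "{i. n i \<noteq> 0} \<subseteq> F0" and mem: "a \<in> F0" "b \<in> F0" "c \<in> F0" "d \<in> F0"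
    and less: "a < b" "b < c" "c < d"
  defines "E \<equiv> \<lambda>n. loc_eval F q (Hn \<pi> n)"
  shows "E (n + alpha a + alpha b) * E (n + alpha c + alpha d)
     = E (n + alpha a + alpha c) * E (n + alpha b + alpha d)
     - E (n + alpha a + alpha d) * E (n + alpha b + alpha c)"
proof -
  let ?t = "\<lambda>a b c d. (coord a - coord b) * (coord c - coord d)
    * tau_at (n + alpha a + alpha b) * tau_at (n + alpha c + alpha d)"
  \<comment> \<open>All three products contain the prefactor of n twice and each of the four cross
    factors once, so they differ from the Fay terms by the same factor.\<close>
  define K where "K = (\<Prod>(i, j)\<in>ordered_pairs F0. (coord i - coord j) powi (n i * n j)) ^ 2
     * (cross_factor n a * cross_factor n b * cross_factor n c * cross_factor n d)"
  have "finite {i. n i \<noteq> 0}" using n F F0 by (meson finite_subset)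
  then have "fps_to_fls (
        (fps_const (q (X a)) * fps_X - fps_const (q (X b)) * fps_X) * (fps_const (q (X c)) * fps_X - fps_const (q (X d)) * fps_X)
          * tau_fps \<pi> (hval (shift_times q (n + alpha a + alpha b))) * tau_fps \<pi> (hval (shift_times q (n + alpha c + alpha d)))
      - (fps_const (q (X a)) * fps_X - fps_const (q (X c)) * fps_X) * (fps_const (q (X b)) * fps_X - fps_const (q (X d)) * fps_X)
          * tau_fps \<pi> (hval (shift_times q (n + alpha a + alpha c))) * tau_fps \<pi> (hval (shift_times q (n + alpha b + alpha d)))
      + (fps_const (q (X a)) * fps_X - fps_const (q (X d)) * fps_X) * (fps_const (q (X b)) * fps_X - fps_const (q (X c)) * fps_X)
          * tau_fps \<pi> (hval (shift_times q (n + alpha a + alpha d))) * tau_fps \<pi> (hval (shift_times q (n + alpha b + alpha c)))) = 0"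
    by (subst tau_three_term[OF plucker]) simp_all
  then have fay: "?t a b c d - ?t a c b d + ?t a d b c = 0"
    by (simp only: fps_to_fls_plus fps_to_fls_minus fls_times_fps_to_fls coord_def tau_at_def)
  have E: "E (n + alpha a' + alpha b') = (\<Prod>(i, j)\<in>ordered_pairs F0. (coord i - coord j) powi (n i * n j))
      * cross_factor n a' * cross_factor n b' * (coord a' - coord b') * tau_at (n + alpha a' + alpha b')"
    if "a' \<in> F0" "b' \<in> F0" "a' < b'" for a' b'
    unfolding E_def by (rule Hn_eval_add_two[OF n that])
  have 1: "E (n + alpha a + alpha b) * E (n + alpha c + alpha d) = K * ?t a b c d"
    using mem less by (simp add: E K_def power2_eq_square mult_ac)
  have 2: "E (n + alpha a + alpha c) * E (n + alpha b + alpha d) = K * ?t a c b d"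
    using mem less by (simp add: E K_def power2_eq_square mult_ac)
  have 3: "E (n + alpha a + alpha d) * E (n + alpha b + alpha c) = K * ?t a d b c"
    using mem less by (simp add: E K_def power2_eq_square mult_ac)
  have "K * (?t a b c d - ?t a c b d + ?t a d b c) = 0" unfolding fay by simp
  then show ?thesis unfolding 1 2 3 by (simp only: right_diff_distrib distrib_left) (simp add: algebra_simps)
qed

end

section \<open>Hook superscripts and the identities in Gr(3,6)\<close>

lemma Hlam_hook: "Hlam \<pi> n (hook p r) = Hn \<pi> (n + alpha (int p) - alpha (- int r - 1))"
proof -
  have "{i. 1 \<le> i \<and> i \<le> length (hook p r) \<and> hook p r ! (i - 1) \<ge> i} = {1}"
    by (auto simp: hook_def nth_Cons' split: if_splits)
  then have rank: "frob_rank (hook p r) = 1" by (simp add: frob_rank_def)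
  have "{j. j < length (hook p r) \<and> hook p r ! j \<ge> 1} = {..<Suc r}"
    by (auto simp: hook_def nth_Cons')
  then have "conj_part (hook p r) 1 = Suc r" by (simp add: conj_part_def)
  moreover have "hook p r ! 0 = Suc p" by (simp add: hook_def)
  ultimately show ?thesis using rank by (simp add: Hlam_def frob_a_def frob_b_def)
qed

text \<open>Subscripts 1 to 6 stand for the increasing indices \<open>-k-1, -j-1, -i-1, i, j, k\<close>. In the last identity,
  the relation with pivot \<open>p134\<close> makes a division by \<open>p123\<close> unnecessary.\<close>

lemma gr36_identities:
  fixes p123 p124 p135 p236 p145 p246 p356 p456 p134 p235 p126 p125 p136 p234 p146 p345 p256 p245 p156 p346 :: "'a::comm_ring_1"
  assumes
    r1: "p123 * p146 = p124 * p136 - p126 * p134"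
    and
    r2: "p123 * p356 = p135 * p236 - p136 * p235"
    and
    r3: "p123 * p345 = p134 * p235 - p135 * p234"
    and
    r4: "p123 * p246 = p124 * p236 - p126 * p234"
    and
    r5: "p123 * p256 = p125 * p236 - p126 * p235"
    and
    r6: "p123 * p145 = p124 * p135 - p125 * p134"
    and
    r7: "p123 * p245 = p124 * p235 - p125 * p234"
    and
    r8: "p123 * p156 = p125 * p136 - p126 * p135"
    and
    r9: "p123 * p346 = p134 * p236 - p136 * p234"
    and
    r10: "p134 * p456 = p145 * p346 - p146 * p345"
  shows
    "p123 * p235 * p146 = - (p123 * p124 * p356) + p124 * p135 * p236 - p134 * p235 * p126"
    and
    "p123 * p126 * p345 = p123 * p135 * p246 - p124 * p135 * p236 + p134 * p235 * p126"
    and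
    "p123 * p134 * p256 = - (p123 * p236 * p145) + p124 * p135 * p236 - p134 * p235 * p126"
    and
    "p123 * p136 * p245 = - (p123 * p124 * p356) + p124 * p135 * p236 - p125 * p136 * p234"
    and
    "p123 * p234 * p156 = p123 * p135 * p246 - p124 * p135 * p236 + p125 * p136 * p234"
    and
    "p123 * p125 * p346 = - (p123 * p236 * p145) + p124 * p135 * p236 - p125 * p136 * p234"
    and
    "p123 * p123 * (p134 * p235 * p126) * p456 = (p134 * p235 * p126) * (p134 * p235 * p126) - (p134 * p235 * p126) * ((p124 * p135 * p236 + p124 * p135 * p236) - p123 * (p124 * p356 + p135 * p246 + p236 * p145)) + (p124 * p135 - p123 * p145) * (p124 * p236 - p123 * p246) * (p135 * p236 - p123 * p356)"
proof -
  have "p123 * p235 * p146 = p235 * (p123 * p146)"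
    by (simp only: mult_ac)
  \<comment> \<open>\<open>r1\<close> produces the mixed product \<open>p136 * p235\<close>, which
    \<open>r2\<close> trades for \<open>p135 * p236\<close> minus a multiple of \<open>p123\<close>.
    The next five identities pair two relations in the same way.\<close>
  also have "\<dots> = - (p124 * (p123 * p356)) + p124 * p135 * p236 - p134 * p235 * p126"
    unfolding r1 r2 by (simp add: algebra_simps)
  finally show "p123 * p235 * p146 = - (p123 * p124 * p356) + p124 * p135 * p236 - p134 * p235 * p126"
    by (simp only: mult_ac)
  have "p123 * p126 * p345 = p126 * (p123 * p345)"
    by (simp only: mult_ac)
  also have "\<dots> = p135 * (p123 * p246) - p124 * p135 * p236 + p134 * p235 * p126"
    unfolding r3 r4 by (simp add: algebra_simps)
  finally show "p123 * p126 * p345 = p123 * p135 * p246 - p124 * p135 * p236 + p134 * p235 * p126"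
    by (simp only: mult_ac)
  have "p123 * p134 * p256 = p134 * (p123 * p256)"
    by (simp only: mult_ac)
  also have "\<dots> = - (p236 * (p123 * p145)) + p124 * p135 * p236 - p134 * p235 * p126"
    unfolding r5 r6 by (simp add: algebra_simps)
  finally show "p123 * p134 * p256 = - (p123 * p236 * p145) + p124 * p135 * p236 - p134 * p235 * p126"
    by (simp only: mult_ac)
  have "p123 * p136 * p245 = p136 * (p123 * p245)"
    by (simp only: mult_ac)
  also have "\<dots> = - (p124 * (p123 * p356)) + p124 * p135 * p236 - p125 * p136 * p234"
    unfolding r7 r2 by (simp add: algebra_simps)
  finally show "p123 * p136 * p245 = - (p123 * p124 * p356) + p124 * p135 * p236 - p125 * p136 * p234"
    by (simp only: mult_ac)
  have "p123 * p234 * p156 = p234 * (p123 * p156)"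
    by (simp only: mult_ac)
  also have "\<dots> = p135 * (p123 * p246) - p124 * p135 * p236 + p125 * p136 * p234"
    unfolding r8 r4 by (simp add: algebra_simps)
  finally show "p123 * p234 * p156 = p123 * p135 * p246 - p124 * p135 * p236 + p125 * p136 * p234"
    by (simp only: mult_ac)
  have "p123 * p125 * p346 = p125 * (p123 * p346)"
    by (simp only: mult_ac)
  also have "\<dots> = - (p236 * (p123 * p145)) + p124 * p135 * p236 - p125 * p136 * p234"
    unfolding r9 r6 by (simp add: algebra_simps)
  finally show "p123 * p125 * p346 = - (p123 * p236 * p145) + p124 * p135 * p236 - p125 * p136 * p234"
    by (simp only: mult_ac)
  \<comment> \<open>Once \<open>r10\<close> replaces \<open>p134 * p456\<close>, each of its four
    coordinates has exactly one index among 1, 2, 3 and absorbs one \<open>p123\<close>, becoming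
    quadratic in coordinates with two such indices.\<close>
  have "p123 * p123 * (p134 * p235 * p126) * p456 = p235 * p126 * (p123 * p123 * (p134 * p456))" by (simp only: mult_ac)
  also have "\<dots> = p235 * p126 * ((p123 * p145) * (p123 * p346) - (p123 * p146) * (p123 * p345))"
    unfolding r10 by (simp add: algebra_simps)
  also have "\<dots> = (p134 * p235 * p126) * (p134 * p235 * p126) - (p134 * p235 * p126) * ((p124 * p135 * p236 + p124 * p135 * p236) - (p124 * (p123 * p356) + p135 * (p123 * p246) + p236 * (p123 * p145))) + (p124 * p135 - p123 * p145) * (p124 * p236 - p123 * p246) * (p135 * p236 - p123 * p356)"
    unfolding r1 r2 r3 r4 r6 r9 by (simp add: algebra_simps)
  also have "\<dots> = (p134 * p235 * p126) * (p134 * p235 * p126) - (p134 * p235 * p126) * ((p124 * p135 * p236 + p124 * p135 * p236) - p123 * (p124 * p356 + p135 * p246 + p236 * p145)) + (p124 * p135 - p123 * p145) * (p124 * p236 - p123 * p246) * (p135 * p236 - p123 * p356)"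
    by (simp add: algebra_simps)
  finally show "p123 * p123 * (p134 * p235 * p126) * p456 = (p134 * p235 * p126) * (p134 * p235 * p126) - (p134 * p235 * p126) * ((p124 * p135 * p236 + p124 * p135 * p236) - p123 * (p124 * p356 + p135 * p246 + p236 * p145)) + (p124 * p135 - p123 * p145) * (p124 * p236 - p123 * p246) * (p135 * p236 - p123 * p356)" .
qed

text \<open>By \<open>leqI\<close> each identity of fractions may be checked on values in a field.
  There every function is a triple \<open>D x y z\<close>, and \<open>gr36_identities\<close>
  applies.\<close>

theorem mainTheorem10:
  fixes \<pi> :: "nat list \<Rightarrow> complex" and n' :: "int \<Rightarrow> int" and i j k :: nat
  assumes "grass \<pi>" and "n' \<in> Bset" and "i < j" and "j < k"
  defines "H \<equiv> Hn \<pi> n'"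
      and "Hv \<equiv> (\<lambda>v. Hn \<pi> (n' + v))"
      and "Hh \<equiv> (\<lambda>p q. Hlam \<pi> n' (hook p q))"
      and "Hhv \<equiv> (\<lambda>v p q. Hlam \<pi> (n' + v) (hook p q))"
  defines "P \<equiv> Hv (gam i) **\<^sub>L Hv (gam j) **\<^sub>L Hv (gam k)"
      and "Xm \<equiv> Hh i j **\<^sub>L Hh j k **\<^sub>L Hh k i"
      and "XT \<equiv> Hh j i **\<^sub>L Hh k j **\<^sub>L Hh i k"
  shows
    "(H **\<^sub>L Hh j k **\<^sub>L Hhv (gam i) k j =\<^sub>L
       lneg (H **\<^sub>L Hv (gam i) **\<^sub>L Hv (gam j + gam k)) ++\<^sub>L P --\<^sub>L Xm)
   \<and> (H **\<^sub>L Hh k i **\<^sub>L Hhv (gam j) i k =\<^sub>L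
       H **\<^sub>L Hv (gam j) **\<^sub>L Hv (gam i + gam k) --\<^sub>L P ++\<^sub>L Xm)
   \<and> (H **\<^sub>L Hh i j **\<^sub>L Hhv (gam k) j i =\<^sub>L
       lneg (H **\<^sub>L Hv (gam k) **\<^sub>L Hv (gam i + gam j)) ++\<^sub>L P --\<^sub>L Xm)
   \<and> (H **\<^sub>L Hh k j **\<^sub>L Hhv (gam i) j k =\<^sub>L
       lneg (H **\<^sub>L Hv (gam i) **\<^sub>L Hv (gam j + gam k)) ++\<^sub>L P --\<^sub>L XT)
   \<and> (H **\<^sub>L Hh i k **\<^sub>L Hhv (gam j) k i =\<^sub>L
       H **\<^sub>L Hv (gam j) **\<^sub>L Hv (gam i + gam k) --\<^sub>L P ++\<^sub>L XT)
   \<and> (H **\<^sub>L Hh j i **\<^sub>L Hhv (gam k) i j =\<^sub>L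
       lneg (H **\<^sub>L Hv (gam k) **\<^sub>L Hv (gam i + gam j)) ++\<^sub>L P --\<^sub>L XT)
   \<and> (H **\<^sub>L H **\<^sub>L Xm **\<^sub>L Hv (gam i + gam j + gam k) =\<^sub>L
       Xm **\<^sub>L Xm
       --\<^sub>L Xm **\<^sub>L ((P ++\<^sub>L P) --\<^sub>L H **\<^sub>L (Hv (gam i) **\<^sub>L Hv (gam j + gam k)
                   ++\<^sub>L Hv (gam j) **\<^sub>L Hv (gam i + gam k) ++\<^sub>L Hv (gam k) **\<^sub>L Hv (gam i + gam j)))
       ++\<^sub>L (Hv (gam i) **\<^sub>L Hv (gam j) --\<^sub>L H **\<^sub>L Hv (gam i + gam j))
          **\<^sub>L (Hv (gam i) **\<^sub>L Hv (gam k) --\<^sub>L H **\<^sub>L Hv (gam i + gam k))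
          **\<^sub>L (Hv (gam j) **\<^sub>L Hv (gam k) --\<^sub>L H **\<^sub>L Hv (gam j + gam k)))"
proof -
  define b1 b2 b3 a1 a2 a3 where "b1 = - int k - 1" and "b2 = - int j - 1" and "b3 = - int i - 1"
    and "a1 = int i" and "a2 = int j" and "a3 = int k"
  note idx = b1_def b2_def b3_def a1_def a2_def a3_def
  have b_eq: "- a1 - 1 = b3" "- a2 - 1 = b2" "- a3 - 1 = b1" by (simp_all add: idx)
  define N where "N = n' - alpha b1 - alpha b2 - alpha b3"
  \<comment> \<open>It holds the support of n' and the six indices, so all exponent vectors are
    supported in it and only its coordinates have to be distinct.\<close>
  define F0 where "F0 = {i. n' i \<noteq> 0} \<union> {b1, b2, b3, a1, a2, a3}"
  have F0: "finite F0" using assms(2) by (simp add: F0_def Bset_def)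
  define D where "D = (\<lambda>x y z. Hn \<pi> (N + alpha x + alpha y + alpha z))"
  have gens:
    "H = D b1 b2 b3" "Hv (gam i) = D b1 b2 a1" "Hv (gam j) = D b1 b3 a2" "Hv (gam k) = D b2 b3 a3"
    "Hv (gam i + gam j) = D b1 a1 a2" "Hv (gam i + gam k) = D b2 a1 a3" "Hv (gam j + gam k) = D b3 a2 a3"
    "Hv (gam i + gam j + gam k) = D a1 a2 a3"
    "Hh i j = D b1 b3 a1" "Hh j k = D b2 b3 a2" "Hh k i = D b1 b2 a3"
    "Hh j i = D b1 b2 a2" "Hh k j = D b1 b3 a3" "Hh i k = D b2 b3 a1"
    "Hhv (gam i) k j = D b1 a1 a3" "Hhv (gam j) i k = D b3 a1 a2" "Hhv (gam k) j i = D b2 a2 a3"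
    "Hhv (gam i) j k = D b2 a1 a2" "Hhv (gam j) k i = D b1 a2 a3" "Hhv (gam k) i j = D b3 a1 a3"
    by (simp_all add: H_def Hv_def Hh_def Hhv_def Hlam_hook D_def N_def gam_def b_eq flip: a1_def a2_def a3_def)
       (simp_all add: algebra_simps)
  have less: "b1 < b2" "b2 < b3" "b3 < a1" "a1 < a2" "a2 < a3"
    using assms(3,4) by (simp_all add: idx)
  let ?V = "{b1, b2, b3, a1, a2, a3}"
  have supp: "{m. (N + alpha x) m \<noteq> 0} \<subseteq> F0" "{m. (N + alpha x + alpha y + alpha z) m \<noteq> 0} \<subseteq> F0"
    if "x \<in> ?V" "y \<in> ?V" "z \<in> ?V" for x y z
  proof -
    have "alpha v m = 0" if "v \<in> ?V" "m \<notin> F0" for v m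
      using that by (auto simp: F0_def alpha_def)
    moreover from this have "N m = 0" if "m \<notin> F0" for m
      using that by (simp add: N_def F0_def)
    ultimately have "(N + alpha x) m = 0" "(N + alpha x + alpha y + alpha z) m = 0" if "m \<notin> F0" for m
      using \<open>x \<in> ?V\<close> \<open>y \<in> ?V\<close> \<open>z \<in> ?V\<close> that by simp_all
    then show "{m. (N + alpha x) m \<noteq> 0} \<subseteq> F0" "{m. (N + alpha x + alpha y + alpha z) m \<noteq> 0} \<subseteq> F0"
      by blast+
  qed
  have plucker: "plucker \<pi>" using assms(1) by (simp add: grass_def)
  let ?E = "\<lambda>F q x y z. loc_eval F q (D x y z)"
  have identities:
    "?E F q b1 b2 b3 * ?E F q b2 b3 a2 * ?E F q b1 a1 a3
     = - (?E F q b1 b2 b3 * ?E F q b1 b2 a1 * ?E F q b3 a2 a3) + ?E F q b1 b2 a1 * ?E F q b1 b3 a2 * ?E F q b2 b3 a3 - ?E F q b1 b3 a1 * ?E F q b2 b3 a2 * ?E F q b1 b2 a3"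
    "?E F q b1 b2 b3 * ?E F q b1 b2 a3 * ?E F q b3 a1 a2
     = ?E F q b1 b2 b3 * ?E F q b1 b3 a2 * ?E F q b2 a1 a3 - ?E F q b1 b2 a1 * ?E F q b1 b3 a2 * ?E F q b2 b3 a3 + ?E F q b1 b3 a1 * ?E F q b2 b3 a2 * ?E F q b1 b2 a3"
    "?E F q b1 b2 b3 * ?E F q b1 b3 a1 * ?E F q b2 a2 a3
     = - (?E F q b1 b2 b3 * ?E F q b2 b3 a3 * ?E F q b1 a1 a2) + ?E F q b1 b2 a1 * ?E F q b1 b3 a2 * ?E F q b2 b3 a3 - ?E F q b1 b3 a1 * ?E F q b2 b3 a2 * ?E F q b1 b2 a3"
    "?E F q b1 b2 b3 * ?E F q b1 b3 a3 * ?E F q b2 a1 a2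
     = - (?E F q b1 b2 b3 * ?E F q b1 b2 a1 * ?E F q b3 a2 a3) + ?E F q b1 b2 a1 * ?E F q b1 b3 a2 * ?E F q b2 b3 a3 - ?E F q b1 b2 a2 * ?E F q b1 b3 a3 * ?E F q b2 b3 a1"
    "?E F q b1 b2 b3 * ?E F q b2 b3 a1 * ?E F q b1 a2 a3
     = ?E F q b1 b2 b3 * ?E F q b1 b3 a2 * ?E F q b2 a1 a3 - ?E F q b1 b2 a1 * ?E F q b1 b3 a2 * ?E F q b2 b3 a3 + ?E F q b1 b2 a2 * ?E F q b1 b3 a3 * ?E F q b2 b3 a1"
    "?E F q b1 b2 b3 * ?E F q b1 b2 a2 * ?E F q b3 a1 a3
     = - (?E F q b1 b2 b3 * ?E F q b2 b3 a3 * ?E F q b1 a1 a2) + ?E F q b1 b2 a1 * ?E F q b1 b3 a2 * ?E F q b2 b3 a3 - ?E F q b1 b2 a2 * ?E F q b1 b3 a3 * ?E F q b2 b3 a1"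
    "?E F q b1 b2 b3 * ?E F q b1 b2 b3 * (?E F q b1 b3 a1 * ?E F q b2 b3 a2 * ?E F q b1 b2 a3) * ?E F q a1 a2 a3
     = (?E F q b1 b3 a1 * ?E F q b2 b3 a2 * ?E F q b1 b2 a3) * (?E F q b1 b3 a1 * ?E F q b2 b3 a2 * ?E F q b1 b2 a3) - (?E F q b1 b3 a1 * ?E F q b2 b3 a2 * ?E F q b1 b2 a3) * ((?E F q b1 b2 a1 * ?E F q b1 b3 a2 * ?E F q b2 b3 a3 + ?E F q b1 b2 a1 * ?E F q b1 b3 a2 * ?E F q b2 b3 a3) - ?E F q b1 b2 b3 * (?E F q b1 b2 a1 * ?E F q b3 a2 a3 + ?E F q b1 b3 a2 * ?E F q b2 a1 a3 + ?E F q b2 b3 a3 * ?E F q b1 a1 a2)) + (?E F q b1 b2 a1 * ?E F q b1 b3 a2 - ?E F q b1 b2 b3 * ?E F q b1 a1 a2) * (?E F q b1 b2 a1 * ?E F q b2 b3 a3 - ?E F q b1 b2 b3 * ?E F q b2 a1 a3) * (?E F q b1 b3 a2 * ?E F q b2 b3 a3 - ?E F q b1 b2 b3 * ?E F q b3 a2 a3)"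
    if F: "finite F" "F0 \<subseteq> F" and inj: "inj_on (\<lambda>i. q (X i)) F0" for F q
  proof -
    define E where "E = (\<lambda>x y z. loc_eval F q (D x y z))"
    \<comment> \<open>The common index e is put into the base vector \<open>N + alpha e\<close>. It
      may lie anywhere relative to a, b, c, d: \<open>E\<close> is symmetric, so its place produces
      no sign.\<close>
    have three_term: "E e a b * E e c d = E e a c * E e b d - E e a d * E e b c"
      if "e \<in> ?V" "{a, b, c, d} \<subseteq> ?V" "a < b" "b < c" "c < d" for e a b c d
      unfolding E_def D_def using that supp(1)[of e e e]
      by (intro Hn_three_term[OF F inj plucker]) (auto simp: F0_def)
    have E_sym: "E x y z = E y x z" "E x y z = E x z y" for x y z
      by (simp_all add: E_def D_def algebra_simps)
    have r1: "E b1 b2 b3 * E b1 a1 a3 = E b1 b2 a1 * E b1 b3 a3 - E b1 b2 a3 * E b1 b3 a1"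
      using three_term[of b1 b2 b3 a1 a3] less
      by (simp add: E_sym mult_ac)
    have r2: "E b1 b2 b3 * E b3 a2 a3 = E b1 b3 a2 * E b2 b3 a3 - E b1 b3 a3 * E b2 b3 a2"
      using three_term[of b3 b1 b2 a2 a3] less
      by (simp add: E_sym mult_ac)
    have r3: "E b1 b2 b3 * E b3 a1 a2 = E b1 b3 a1 * E b2 b3 a2 - E b1 b3 a2 * E b2 b3 a1"
      using three_term[of b3 b1 b2 a1 a2] less
      by (simp add: E_sym mult_ac)
    have r4: "E b1 b2 b3 * E b2 a1 a3 = E b1 b2 a1 * E b2 b3 a3 - E b1 b2 a3 * E b2 b3 a1"
      using three_term[of b2 b1 b3 a1 a3] less
      by (simp add: E_sym mult_ac)
    have r5: "E b1 b2 b3 * E b2 a2 a3 = E b1 b2 a2 * E b2 b3 a3 - E b1 b2 a3 * E b2 b3 a2"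
      using three_term[of b2 b1 b3 a2 a3] less
      by (simp add: E_sym mult_ac)
    have r6: "E b1 b2 b3 * E b1 a1 a2 = E b1 b2 a1 * E b1 b3 a2 - E b1 b2 a2 * E b1 b3 a1"
      using three_term[of b1 b2 b3 a1 a2] less
      by (simp add: E_sym mult_ac)
    have r7: "E b1 b2 b3 * E b2 a1 a2 = E b1 b2 a1 * E b2 b3 a2 - E b1 b2 a2 * E b2 b3 a1"
      using three_term[of b2 b1 b3 a1 a2] less
      by (simp add: E_sym mult_ac)
    have r8: "E b1 b2 b3 * E b1 a2 a3 = E b1 b2 a2 * E b1 b3 a3 - E b1 b2 a3 * E b1 b3 a2"
      using three_term[of b1 b2 b3 a2 a3] less
      by (simp add: E_sym mult_ac)
    have r9: "E b1 b2 b3 * E b3 a1 a3 = E b1 b3 a1 * E b2 b3 a3 - E b1 b3 a3 * E b2 b3 a1"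
      using three_term[of b3 b1 b2 a1 a3] less
      by (simp add: E_sym mult_ac)
    \<comment> \<open>The common index a1 brings in the triple of all nonnegative indices, which no
      earlier relation contains.\<close>
    have r10: "E b1 b3 a1 * E a1 a2 a3 = E b1 a1 a2 * E b3 a1 a3 - E b1 a1 a3 * E b3 a1 a2"
      using three_term[of a1 b1 b3 a2 a3] less
      by (simp add: E_sym mult_ac)
    note ids = gr36_identities[OF r1 r2 r3 r4 r5 r6 r7 r8 r9 r10]
    show "?E F q b1 b2 b3 * ?E F q b2 b3 a2 * ?E F q b1 a1 a3
     = - (?E F q b1 b2 b3 * ?E F q b1 b2 a1 * ?E F q b3 a2 a3) + ?E F q b1 b2 a1 * ?E F q b1 b3 a2 * ?E F q b2 b3 a3 - ?E F q b1 b3 a1 * ?E F q b2 b3 a2 * ?E F q b1 b2 a3"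
      using ids(1) unfolding E_def .
    show "?E F q b1 b2 b3 * ?E F q b1 b2 a3 * ?E F q b3 a1 a2
     = ?E F q b1 b2 b3 * ?E F q b1 b3 a2 * ?E F q b2 a1 a3 - ?E F q b1 b2 a1 * ?E F q b1 b3 a2 * ?E F q b2 b3 a3 + ?E F q b1 b3 a1 * ?E F q b2 b3 a2 * ?E F q b1 b2 a3"
      using ids(2) unfolding E_def .
    show "?E F q b1 b2 b3 * ?E F q b1 b3 a1 * ?E F q b2 a2 a3
     = - (?E F q b1 b2 b3 * ?E F q b2 b3 a3 * ?E F q b1 a1 a2) + ?E F q b1 b2 a1 * ?E F q b1 b3 a2 * ?E F q b2 b3 a3 - ?E F q b1 b3 a1 * ?E F q b2 b3 a2 * ?E F q b1 b2 a3"
      using ids(3) unfolding E_def .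
    show "?E F q b1 b2 b3 * ?E F q b1 b3 a3 * ?E F q b2 a1 a2
     = - (?E F q b1 b2 b3 * ?E F q b1 b2 a1 * ?E F q b3 a2 a3) + ?E F q b1 b2 a1 * ?E F q b1 b3 a2 * ?E F q b2 b3 a3 - ?E F q b1 b2 a2 * ?E F q b1 b3 a3 * ?E F q b2 b3 a1"
      using ids(4) unfolding E_def .
    show "?E F q b1 b2 b3 * ?E F q b2 b3 a1 * ?E F q b1 a2 a3
     = ?E F q b1 b2 b3 * ?E F q b1 b3 a2 * ?E F q b2 a1 a3 - ?E F q b1 b2 a1 * ?E F q b1 b3 a2 * ?E F q b2 b3 a3 + ?E F q b1 b2 a2 * ?E F q b1 b3 a3 * ?E F q b2 b3 a1"
      using ids(5) unfolding E_def .
    show "?E F q b1 b2 b3 * ?E F q b1 b2 a2 * ?E F q b3 a1 a3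
     = - (?E F q b1 b2 b3 * ?E F q b2 b3 a3 * ?E F q b1 a1 a2) + ?E F q b1 b2 a1 * ?E F q b1 b3 a2 * ?E F q b2 b3 a3 - ?E F q b1 b2 a2 * ?E F q b1 b3 a3 * ?E F q b2 b3 a1"
      using ids(6) unfolding E_def .
    show "?E F q b1 b2 b3 * ?E F q b1 b2 b3 * (?E F q b1 b3 a1 * ?E F q b2 b3 a2 * ?E F q b1 b2 a3) * ?E F q a1 a2 a3
     = (?E F q b1 b3 a1 * ?E F q b2 b3 a2 * ?E F q b1 b2 a3) * (?E F q b1 b3 a1 * ?E F q b2 b3 a2 * ?E F q b1 b2 a3) - (?E F q b1 b3 a1 * ?E F q b2 b3 a2 * ?E F q b1 b2 a3) * ((?E F q b1 b2 a1 * ?E F q b1 b3 a2 * ?E F q b2 b3 a3 + ?E F q b1 b2 a1 * ?E F q b1 b3 a2 * ?E F q b2 b3 a3) - ?E F q b1 b2 b3 * (?E F q b1 b2 a1 * ?E F q b3 a2 a3 + ?E F q b1 b3 a2 * ?E F q b2 a1 a3 + ?E F q b2 b3 a3 * ?E F q b1 a1 a2)) + (?E F q b1 b2 a1 * ?E F q b1 b3 a2 - ?E F q b1 b2 b3 * ?E F q b1 a1 a2) * (?E F q b1 b2 a1 * ?E F q b2 b3 a3 - ?E F q b1 b2 b3 * ?E F q b2 a1 a3) * (?E F q b1 b3 a2 * ?E F q b2 b3 a3 - ?E F q b1 b2 b3 * ?E F q b3 a2 a3)"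
      using ids(7) unfolding E_def .
  qed
  have defined: "loc_defined F q (D x y z)"
    if "finite F" "F0 \<subseteq> F" "inj_on (\<lambda>i. q (X i)) F0" "x \<in> ?V" "y \<in> ?V" "z \<in> ?V" for F q x y z
    unfolding D_def using Hn_eval(1)[OF that(1-3) plucker supp(2)[OF that(4-6)]] .
  show ?thesis
    unfolding P_def Xm_def XT_def gens
    \<comment> \<open>Definedness of the triples passes to sums and products, so
      \<open>loc_eval\<close> distributes over both sides and \<open>identities\<close> closes each
      goal.\<close>
    by (intro conjI; rule leqI[OF F0]; simp only: loc_defined_mul loc_defined_add loc_defined_sub loc_defined_neg
        loc_eval_mul loc_eval_add loc_eval_sub loc_eval_neg defined identities insert_iff simp_thms)
qed

end
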